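(* (a) Let $d=2g+2$ (with $g\ge2$). There does not exist a quasi-cocycle $\mathfrak S_{2g+2}\to M$. Consequently there is no subgroup $H\subseteq\varpi_{4\to2}^{-1}(\mathfrak S_{2g+2})$ with $\varpi_{4\to2}(H)=\mathfrak S_{2g+2}$ and $H\cap\varpi_4(\Gamma(2))=N$. (b) Let $d=2g+1$. For each $\mathbf c=(c_2,\dots,c_{2g+1})\in\mathbb F_2^{2g}$ there is a unique quasi-cocycle $\varphi_{\mathbf c}:\mathfrak S_{2g+1}\to M$ with $\varphi_{\mathbf c}((1,j))=c_jv_{\{1,j\}}+v_{\{2,\dots,2g+1\}}$ for $2\le j\le 2g+1$. Every quasi-cocycle $\varphi:\mathfrak S_{2g+1}\to M$ equals $\varphi_{\mathbf c}$ for some $\mathbf c\in\mathbb F_2^{2g}$. Consequently there are exactly $2^{2g}$ subgroups $H\subseteq\varpi_{4\to2}^{-1}(\mathfrak S_{2g+1})$ satisfying $\varpi_{4\to2}(H)=\mathfrak S_{2g+1}$ and $H\cap\varpi_4(\Gamma(2))=N$, and these subgroups form one full conjugacy class of subgroups of $\varpi_{4\to2}^{-1}(\mathfrak S_{2g+1})$.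
   Context: Let $d\ge 3$, $d\ne4$, and $g=\lfloor (d-1)/2\rfloor$. Let $W$ be an $\mathbb F_2$-vector space with basis $e_1,\dots,e_d$, with $S_d$ acting by ${}^{\sigma}e_i=e_{\sigma(i)}$, and $W_0$ the subspace of vectors with coordinate sum $0$; $\bar V=W_0$ if $d$ is odd, $\bar V=W_0/\langle e_1+\cdots+e_d\rangle$ if $d$ is even ($\dim \bar V=2g$). For even-cardinality $I\subseteq\{1,\dots,d\}$, $v_I$ is the image of $\sum_{i\in I}e_i$. The form $\langle v_I,v_{I'}\rangle=\#(I\cap I')\bmod2$ is nondegenerate alternating and $S_d$-invariant; the standard representation $\rho:S_d\to\mathrm{Sp}(\bar V)$ is injective (as $d\ne4$) with image $\mathfrak S_d$, and we identify $\sigma$ with $\rho(\sigma)$. Let $V$ be a free $\mathbb Z_2$-module of rank $2g$ with alternating form whose reduction under an identification $V/2V=\bar V$ is the form on $\bar V$. $\varpi_{2^n}:\mathrm{Sp}(V)\to\mathrm{Sp}(V/2^nV)$ is reduction, $\varpi_{2^m\to2^n}:\mathrm{Sp}(V/2^mV)\to\mathrm{Sp}(V/2^nV)$ the induced reduction, $\Gamma(2^n)=\ker\varpi_{2^n}$, and $t_a(v)=v+\langle v,a\rangle a$ is the transvection. For $1\le i<j\le d$ fix $a_{i,j}=a_{j,i}\in V$ reducing to $v_{\{i,j\}}$. The group $\varpi_4(\Gamma(2))$ is elementary abelian, written additively; for $1\le i<j\le d$ let $[i,j]=[j,i]=\varpi_4(t_a^{2})$ for any $a\in V$ reducing to $v_{\{i,j\}}$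 (independent of $a$). The $[i,j]$, $1\le i<j\le 2g+1$, form an $\mathbb F_2$-basis, and $S_d$ acts on $\varpi_4(\Gamma(2))$ by ${}^\sigma[i,j]=[\sigma(i),\sigma(j)]$ (equivalently, by conjugation by any element of $\mathrm{Sp}(V/4V)$ reducing to $\sigma$). Let $N\subseteq\varpi_4(\Gamma(2))$ be the set of elements $\sum_{1\le i<j\le 2g+1}c_{i,j}[i,j]$ ($c_{i,j}=c_{j,i}\in\mathbb F_2$) with $\sum_{j\in\{1,\dots,2g+1\}\setminus\{i\}}c_{i,j}=0$ for every $1\le i\le 2g+1$; it is an $S_d$-invariant subgroup. Let $M=\varpi_4(\Gamma(2))/N$, $\pi$ the quotient map, with induced $S_d$-action $m\mapsto{}^\sigma m$. The map $v_{\{i,j\}}\mapsto [i,j]+N$ extends to an $S_d$-equivariant isomorphism $\bar V\cong M$, via which we regard the $v_I$ as elements of $M$ and transport the form. Fix $\tilde\sigma\in\mathrm{Sp}(V)$ for $\sigma\in\mathfrak S_d$ with $\tilde\sigma=1$ for the identity, $\varpi_2(\tilde\sigma)=\sigma$, and $\widetilde{(i,j)}=t_{a_{i,j}}$ for every transposition $(i,j)$ (other lifts arbitrary). A quasi-cocycle is a map $\varphi:\mathfrak S_d\to M$ such that $\varphi(\sigma\tau)=\varphi(\sigma)+{}^\sigma\varphi(\tau)+\pi(\varpi_4(\tilde\sigma\tilde\tau(\widetilde{\sigma\tau})^{-1}))$ for all $\sigma,\tau\in\mathfrak S_d$. *)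

theory Defs
  imports
    Complex_Main
    "HOL-Algebra.Coset"
    "HOL-Algebra.FiniteProduct"
    "HOL-Algebra.Bij"
    "HOL-Library.Z2"
    "HOL-Combinatorics.Permutations"
begin

section \<open>The ring of 2-adic integers\<close>

text \<open>
  The inverse limit of the rings of integers modulo \<open>2 ^ n\<close>: the \<open>n\<close>-th entry of a sequence is the
  representative in \<open>{0..<2 ^ n}\<close> of the residue modulo \<open>2 ^ n\<close>.
\<close>

typedef two_adic = "{x :: nat \<Rightarrow> int. \<forall>n. x n = x (Suc n) mod 2 ^ n}"
  by (rule exI[of _ "\<lambda>_. 0"]) simp

setup_lifting type_definition_two_adic

lemma mod_pow_Suc_mod: "(a mod 2 ^ Suc n) mod 2 ^ n = a mod (2 ^ n :: int)"
  by (simp add: mod_mod_cancel)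

lift_definition residue_mod :: "nat \<Rightarrow> two_adic \<Rightarrow> int" is "\<lambda>n x. x n" .

instantiation two_adic :: comm_ring_1
begin

lift_definition zero_two_adic :: two_adic is "\<lambda>_. 0" by simp

lift_definition one_two_adic :: two_adic is "\<lambda>n. 1 mod 2 ^ n"
  by (simp only: mod_pow_Suc_mod)

lift_definition plus_two_adic :: "two_adic \<Rightarrow> two_adic \<Rightarrow> two_adic"
  is "\<lambda>x y n. (x n + y n) mod 2 ^ n"
  by (subst mod_pow_Suc_mod) (metis mod_add_eq)

lift_definition times_two_adic :: "two_adic \<Rightarrow> two_adic \<Rightarrow> two_adic"
  is "\<lambda>x y n. (x n * y n) mod 2 ^ n"
  by (subst mod_pow_Suc_mod) (metis mod_mult_eq)

lift_definition uminus_two_adic :: "two_adic \<Rightarrow> two_adic"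
  is "\<lambda>x n. (- x n) mod 2 ^ n"
  by (subst mod_pow_Suc_mod) (metis mod_minus_eq)

lift_definition minus_two_adic :: "two_adic \<Rightarrow> two_adic \<Rightarrow> two_adic"
  is "\<lambda>x y n. (x n - y n) mod 2 ^ n"
  by (subst mod_pow_Suc_mod) (metis mod_diff_eq)

lemma two_adic_eqI: "(\<And>n. residue_mod n x = residue_mod n y) \<Longrightarrow> x = y"
  by transfer (rule ext)

lemma residue_mod_mod: "residue_mod n x mod 2 ^ n = residue_mod n x"
  by transfer (metis mod_mod_trivial)

lemma residue_mod_simps:
  "residue_mod n 0 = 0"
  "residue_mod n 1 = 1 mod 2 ^ n"
  "residue_mod n (x + y) = (residue_mod n x + residue_mod n y) mod 2 ^ n"
  "residue_mod n (x * y) = (residue_mod n x * residue_mod n y) mod 2 ^ n"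
  "residue_mod n (- x) = (- residue_mod n x) mod 2 ^ n"
  "residue_mod n (x - y) = (residue_mod n x - residue_mod n y) mod 2 ^ n"
  by (transfer, rule refl)+

instance
proof
  fix a b c :: two_adic
  show "a * b * c = a * (b * c)"
    by (rule two_adic_eqI) (simp add: residue_mod_simps mod_simps mult.assoc)
  show "a * b = b * a"
    by (rule two_adic_eqI) (simp add: residue_mod_simps mult.commute)
  show "1 * a = a"
    by (rule two_adic_eqI)
      (simp only: residue_mod_simps mod_mult_left_eq mult_1 residue_mod_mod)
  show "a + b + c = a + (b + c)"
    by (rule two_adic_eqI) (simp add: residue_mod_simps mod_simps add.assoc)
  show "a + b = b + a"
    by (rule two_adic_eqI) (simp add: residue_mod_simps add.commute)
  show "0 + a = a"
    by (rule two_adic_eqI) (simp add: residue_mod_simps residue_mod_mod)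
  show "- a + a = 0"
    by (rule two_adic_eqI) (simp add: residue_mod_simps mod_simps)
  show "a - b = a + - b"
    by (rule two_adic_eqI) (simp add: residue_mod_simps mod_simps)
  show "(a + b) * c = a * c + b * c"
    by (rule two_adic_eqI) (simp add: residue_mod_simps mod_simps distrib_right)
  have "residue_mod 1 0 \<noteq> residue_mod 1 1"
    by (simp add: residue_mod_simps)
  then show "(0 :: two_adic) \<noteq> 1"
    by metis
qed

end


section \<open>The standard representation of the symmetric group over the field with two elements\<close>

text \<open>A vector of \<open>W\<close> is its coordinate function, extended by \<open>0\<close> outside \<open>{1..d}\<close>.\<close>

definition W0 :: "nat \<Rightarrow> (nat \<Rightarrow> bit) monoid" where
  "W0 d = \<lparr>carrier = {w. (\<forall>i. i \<notin> {1..d} \<longrightarrow> w i = 0) \<and> (\<Sum>i\<in>{1..d}. w i) = 0},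
           monoid.mult = (\<lambda>w w' i. w i + w' i), one = (\<lambda>_. 0)\<rparr>"

definition indicator_vec :: "nat set \<Rightarrow> nat \<Rightarrow> bit" where
  "indicator_vec I = (\<lambda>i. of_bool (i \<in> I))"

definition W0_radical :: "nat \<Rightarrow> (nat \<Rightarrow> bit) set" where
  "W0_radical d = (if odd d then {\<lambda>_. 0} else {\<lambda>_. 0, indicator_vec {1..d}})"

text \<open>For odd \<open>d\<close> this is the quotient of \<open>W0\<close> by zero, that is, \<open>W0\<close> up to writing \<open>{w}\<close> for \<open>w\<close>.\<close>

definition Vbar :: "nat \<Rightarrow> (nat \<Rightarrow> bit) set monoid" where
  "Vbar d = W0 d Mod W0_radical d"

definition vbar :: "nat \<Rightarrow> nat set \<Rightarrow> (nat \<Rightarrow> bit) set" where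
  "vbar d I = W0_radical d #>\<^bsub>W0 d\<^esub> indicator_vec I"

text \<open>On indicator vectors the coordinate sum below is the parity of the size of the intersection.\<close>

definition Vbar_form :: "nat \<Rightarrow> (nat \<Rightarrow> bit) set \<Rightarrow> (nat \<Rightarrow> bit) set \<Rightarrow> bit" where
  "Vbar_form d X Y = the_elem {\<Sum>i\<in>{1..d}. w i * w' i | w w'. w \<in> X \<and> w' \<in> Y}"

text \<open>
  The vector \<open>w = (\<Sum>i. w i e\<^sub>i)\<close> is sent to \<open>(\<Sum>i. w i e\<^bsub>\<sigma> i\<^esub>)\<close>, whose coordinate function is
  \<open>w \<circ> \<sigma>\<^sup>-\<^sup>1\<close>.
\<close>

definition std_rep :: "nat \<Rightarrow> (nat \<Rightarrow> nat) \<Rightarrow> (nat \<Rightarrow> bit) set \<Rightarrow> (nat \<Rightarrow> bit) set" where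
  "std_rep d \<sigma> = (\<lambda>X\<in>carrier (Vbar d). (\<lambda>w. w \<circ> inv_into UNIV \<sigma>) ` X)"

definition Sym :: "nat \<Rightarrow> (nat \<Rightarrow> nat) set" where
  "Sym d = {\<sigma>. \<sigma> permutes {1..d}}"


section \<open>Symplectic groups of a 2-adic lattice\<close>

definition additive_group :: "'v::ab_group_add monoid" where
  "additive_group = \<lparr>carrier = UNIV, monoid.mult = (+), one = 0\<rparr>"

text \<open>
  The module \<open>V\<close> is the whole type \<open>'v\<close>, with scalar multiplication \<open>scale\<close> and alternating
  form \<open>form\<close>. Quotients of \<open>V\<close> and of subgroups are sets of cosets.
\<close>

locale two_adic_form =
  Modules.module scale for scale :: "two_adic \<Rightarrow> 'v::ab_group_add \<Rightarrow> 'v" +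
  fixes form :: "'v \<Rightarrow> 'v \<Rightarrow> two_adic"
  assumes form_add_left: "form (x + y) z = form x z + form y z"
    and form_add_right: "form x (y + z) = form x y + form x z"
    and form_scale_left: "form (scale c x) y = c * form x y"
    and form_scale_right: "form x (scale c y) = c * form x y"
    and form_alternating: "form x x = 0"
begin

definition SpV :: "('v \<Rightarrow> 'v) monoid" where
  "SpV = (BijGroup UNIV)\<lparr>carrier :=
     {f \<in> Bij UNIV. module_hom scale scale f \<and> (\<forall>x y. form (f x) (f y) = form x y)}\<rparr>"

definition Vquot :: "nat \<Rightarrow> 'v set monoid" where
  "Vquot n = additive_group Mod range (scale (2 ^ n))"

definition form_quot :: "nat \<Rightarrow> 'v set \<Rightarrow> 'v set \<Rightarrow> int" where
  "form_quot n X Y = the_elem {residue_mod n (form x y) | x y. x \<in> X \<and> y \<in> Y}"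

text \<open>
  Scalars act on \<open>V / 2 ^ n V\<close> through the integers modulo \<open>2 ^ n\<close>, so that module automorphisms of
  \<open>V / 2 ^ n V\<close> are the same as automorphisms of the additive group.
\<close>

definition SpQ :: "nat \<Rightarrow> ('v set \<Rightarrow> 'v set) monoid" where
  "SpQ n = (AutoGroup (Vquot n))\<lparr>carrier :=
     {f \<in> auto (Vquot n). \<forall>X\<in>carrier (Vquot n). \<forall>Y\<in>carrier (Vquot n).
        form_quot n (f X) (f Y) = form_quot n X Y}\<rparr>"

text \<open>The argument \<open>n\<close> of the following maps stands for the modulus \<open>2 ^ n\<close>.\<close>

definition reduce :: "nat \<Rightarrow> ('v \<Rightarrow> 'v) \<Rightarrow> 'v set \<Rightarrow> 'v set" where
  "reduce n f = (\<lambda>X\<in>carrier (Vquot n). f ` X)"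

text \<open>
  For \<open>n \<le> m\<close>, a coset of \<open>2 ^ n V\<close> is a union of cosets of \<open>2 ^ m V\<close>, whose images under \<open>f\<close> make up
  the image coset.
\<close>

definition reduce_quot :: "nat \<Rightarrow> nat \<Rightarrow> ('v set \<Rightarrow> 'v set) \<Rightarrow> 'v set \<Rightarrow> 'v set" where
  "reduce_quot m n f = (\<lambda>X\<in>carrier (Vquot n). \<Union>Y\<in>{Y \<in> carrier (Vquot m). Y \<subseteq> X}. f Y)"

definition Gamma :: "nat \<Rightarrow> ('v \<Rightarrow> 'v) set" where
  "Gamma n = kernel SpV (SpQ n) (reduce n)"

definition conjugate :: "('v set \<Rightarrow> 'v set) \<Rightarrow> ('v set \<Rightarrow> 'v set) set \<Rightarrow> ('v set \<Rightarrow> 'v set) set" where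
  "conjugate x H = (\<lambda>h. x \<otimes>\<^bsub>SpQ 2\<^esub> h \<otimes>\<^bsub>SpQ 2\<^esub> inv\<^bsub>SpQ 2\<^esub> x) ` H"

definition transvection :: "'v \<Rightarrow> 'v \<Rightarrow> 'v" where
  "transvection a = (\<lambda>v. v + scale (form v a) a)"

text \<open>The group \<open>\<varpi>\<^sub>4 (\<Gamma> (2))\<close>; its composition is what the mathematics writes additively.\<close>

definition Gamma24 :: "('v set \<Rightarrow> 'v set) monoid" where
  "Gamma24 = (SpQ 2)\<lparr>carrier := reduce 2 ` Gamma 1\<rparr>"

end


section \<open>Symmetric groups in symplectic groups and quasi-cocycles\<close>

text \<open>
  The map \<open>red\<close> is reduction modulo \<open>2\<close> followed by the identification of \<open>V / 2 V\<close> with \<open>Vbar d\<close>;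
  \<open>a i j\<close> are the fixed lifts of the vectors \<open>vbar d {i, j}\<close>, and \<open>lift \<sigma>\<close> is the fixed lift of
  \<open>\<sigma>\<close> to \<open>SpV\<close>.
\<close>

locale symmetric_reduction = two_adic_form scale form
  for scale :: "two_adic \<Rightarrow> 'v::ab_group_add \<Rightarrow> 'v" and form :: "'v \<Rightarrow> 'v \<Rightarrow> two_adic" +
  fixes d g :: nat
    and red :: "'v \<Rightarrow> (nat \<Rightarrow> bit) set"
    and a :: "nat \<Rightarrow> nat \<Rightarrow> 'v"
  assumes d_ge_3: "3 \<le> d" and d_neq_4: "d \<noteq> 4" and g_eq: "g = (d - 1) div 2"
    and free: "\<exists>B. finite B \<and> card B = 2 * g \<and> independent B \<and> span B = UNIV"
    and red_hom: "red \<in> hom additive_group (Vbar d)"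
    and red_surj: "range red = carrier (Vbar d)"
    and red_kernel: "kernel additive_group (Vbar d) red = range (scale 2)"
    and red_form: "Vbar_form d (red x) (red y) = of_int (residue_mod 1 (form x y))"
    and a_sym: "i \<in> {1..d} \<Longrightarrow> j \<in> {1..d} \<Longrightarrow> i \<noteq> j \<Longrightarrow> a i j = a j i"
    and red_a: "i \<in> {1..d} \<Longrightarrow> j \<in> {1..d} \<Longrightarrow> i \<noteq> j \<Longrightarrow> red (a i j) = vbar d {i, j}"
begin

text \<open>The standard representation, transported from \<open>Vbar d\<close> to \<open>V / 2 V\<close>, and its image.\<close>

definition std_rep_V :: "(nat \<Rightarrow> nat) \<Rightarrow> 'v set \<Rightarrow> 'v set" where
  "std_rep_V \<sigma> = (\<lambda>X\<in>carrier (Vquot 1). {y. \<exists>x\<in>X. red y = std_rep d \<sigma> (red x)})"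

definition Sym_image :: "('v set \<Rightarrow> 'v set) set" where
  "Sym_image = std_rep_V ` Sym d"

definition Sym_preimage :: "('v set \<Rightarrow> 'v set) set" where
  "Sym_preimage = {f \<in> carrier (SpQ 2). reduce_quot 2 1 f \<in> Sym_image}"

definition bracket :: "nat \<Rightarrow> nat \<Rightarrow> 'v set \<Rightarrow> 'v set" where
  "bracket i j = reduce 2 (transvection (a i j) \<circ> transvection (a i j))"

definition lin_comb :: "(nat \<Rightarrow> nat \<Rightarrow> bit) \<Rightarrow> (nat \<Rightarrow> nat \<Rightarrow> 'v set \<Rightarrow> 'v set) \<Rightarrow> 'v set \<Rightarrow> 'v set" where
  "lin_comb c f = finprod Gamma24 (\<lambda>(i, j). if c i j = 1 then f i j else \<one>\<^bsub>Gamma24\<^esub>)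
     {(i, j). 1 \<le> i \<and> i < j \<and> j \<le> 2 * g + 1}"

text \<open>
  The linear action on \<open>Gamma24\<close> with \<open>\<sigma> [i, j] = [\<sigma> i, \<sigma> j]\<close>. It is well defined because
  the brackets with \<open>1 \<le> i < j \<le> 2 * g + 1\<close> form a basis.
\<close>

definition act_Gamma24 :: "(nat \<Rightarrow> nat) \<Rightarrow> ('v set \<Rightarrow> 'v set) \<Rightarrow> 'v set \<Rightarrow> 'v set" where
  "act_Gamma24 \<sigma> x = (THE y. \<exists>c. x = lin_comb c bracket \<and>
     y = lin_comb c (\<lambda>i j. bracket (\<sigma> i) (\<sigma> j)))"

definition N :: "('v set \<Rightarrow> 'v set) set" where
  "N = {lin_comb c bracket | c. (\<forall>i j. c i j = c j i) \<and>
     (\<forall>i\<in>{1..2 * g + 1}. (\<Sum>j\<in>{1..2 * g + 1} - {i}. c i j) = 0)}"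

definition M :: "('v set \<Rightarrow> 'v set) set monoid" where
  "M = Gamma24 Mod N"

definition proj_M :: "('v set \<Rightarrow> 'v set) \<Rightarrow> ('v set \<Rightarrow> 'v set) set" where
  "proj_M x = N #>\<^bsub>Gamma24\<^esub> x"

definition act_M :: "(nat \<Rightarrow> nat) \<Rightarrow> ('v set \<Rightarrow> 'v set) set \<Rightarrow> ('v set \<Rightarrow> 'v set) set" where
  "act_M \<sigma> m = act_Gamma24 \<sigma> ` m"

text \<open>
  The equivariant isomorphism from \<open>Vbar d\<close> to \<open>M\<close>. The vectors \<open>vbar d {i, j}\<close> generate
  \<open>Vbar d\<close>, so that their images determine it; equivariance is automatic.
\<close>

definition Vbar_to_M :: "(nat \<Rightarrow> bit) set \<Rightarrow> ('v set \<Rightarrow> 'v set) set" where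
  "Vbar_to_M = (THE \<theta>. \<theta> \<in> extensional (carrier (Vbar d)) \<and> \<theta> \<in> iso (Vbar d) M \<and>
     (\<forall>i\<in>{1..d}. \<forall>j\<in>{1..d}. i \<noteq> j \<longrightarrow> \<theta> (vbar d {i, j}) = proj_M (bracket i j)))"

definition v_M :: "nat set \<Rightarrow> ('v set \<Rightarrow> 'v set) set" where
  "v_M I = Vbar_to_M (vbar d I)"

definition lifting_subgroups :: "('v set \<Rightarrow> 'v set) set set" where
  "lifting_subgroups = {H. subgroup H (SpQ 2) \<and> H \<subseteq> Sym_preimage \<and>
     reduce_quot 2 1 ` H = Sym_image \<and> H \<inter> carrier Gamma24 = N}"

end

locale symmetric_lifts = symmetric_reduction scale form d g red a
  for scale :: "two_adic \<Rightarrow> 'v::ab_group_add \<Rightarrow> 'v" and form :: "'v \<Rightarrow> 'v \<Rightarrow> two_adic"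
    and d g :: nat and red :: "'v \<Rightarrow> (nat \<Rightarrow> bit) set" and a :: "nat \<Rightarrow> nat \<Rightarrow> 'v" +
  fixes lift :: "(nat \<Rightarrow> nat) \<Rightarrow> 'v \<Rightarrow> 'v"
  assumes lift_in: "\<sigma> \<in> Sym d \<Longrightarrow> lift \<sigma> \<in> carrier SpV"
    and lift_reduce: "\<sigma> \<in> Sym d \<Longrightarrow> reduce 1 (lift \<sigma>) = std_rep_V \<sigma>"
    and lift_id: "lift id = id"
    and lift_transpose:
      "i \<in> {1..d} \<Longrightarrow> j \<in> {1..d} \<Longrightarrow> i \<noteq> j \<Longrightarrow> lift (transpose i j) = transvection (a i j)"
begin

text \<open>
  Since \<open>std_rep_V\<close> is injective on \<open>Sym d\<close>, its image is identified with \<open>Sym d\<close>: a quasi-cocycle is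
  a function on \<open>Sym d\<close>, made \<open>undefined\<close> elsewhere so that equality is equality on \<open>Sym d\<close>.
\<close>

definition quasi_cocycle :: "((nat \<Rightarrow> nat) \<Rightarrow> ('v set \<Rightarrow> 'v set) set) \<Rightarrow> bool" where
  "quasi_cocycle \<phi> \<longleftrightarrow> \<phi> \<in> Sym d \<rightarrow>\<^sub>E carrier M \<and>
     (\<forall>\<sigma>\<in>Sym d. \<forall>\<tau>\<in>Sym d.
        \<phi> (\<sigma> \<circ> \<tau>) = \<phi> \<sigma> \<otimes>\<^bsub>M\<^esub> act_M \<sigma> (\<phi> \<tau>) \<otimes>\<^bsub>M\<^esub>
          proj_M (reduce 2 (lift \<sigma> \<otimes>\<^bsub>SpV\<^esub> lift \<tau> \<otimes>\<^bsub>SpV\<^esub> inv\<^bsub>SpV\<^esub> lift (\<sigma> \<circ> \<tau>))))"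

text \<open>The quasi-cocycles with the prescribed values on the transpositions \<open>(1 j)\<close>.\<close>

definition quasi_cocycle_with :: "(nat \<Rightarrow> bit) \<Rightarrow> ((nat \<Rightarrow> nat) \<Rightarrow> ('v set \<Rightarrow> 'v set) set) \<Rightarrow> bool" where
  "quasi_cocycle_with c \<phi> \<longleftrightarrow> quasi_cocycle \<phi> \<and>
     (\<forall>j\<in>{2..2 * g + 1}. \<phi> (transpose 1 j) =
        (if c j = 1 then v_M {1, j} else \<one>\<^bsub>M\<^esub>) \<otimes>\<^bsub>M\<^esub> v_M {2..2 * g + 1})"

end

end

theory Submission
  imports Defs
begin

text \<open>
  An element \<open>1 + 2 X\<close> of the kernel of \<open>Sp (V / 4 V) \<rightarrow> Sp (V / 2 V)\<close> is determined by the symmetric form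
  \<open>B (x, y) = \<langle>X x, y\<rangle>\<close> on \<open>V / 2 V\<close>, and \<open>N\<close> consists of the elements with \<open>B\<close> alternating. So
  \<open>M\<close> is the space of the linear forms \<open>x \<mapsto> B (x, x)\<close>.

  Let \<open>u\<close> be the linear form of the value of a quasi-cocycle at the transposition \<open>(i j)\<close>. The relation
  \<open>(i j)\<^sup>2 = 1\<close> gives \<open>u (a\<^bsub>i,j\<^esub>) = 1\<close>, and commutation with a disjoint transposition \<open>(k l)\<close> gives
  \<open>u (a\<^bsub>k,l\<^esub>) = 0\<close>. For even \<open>d\<close> this contradicts
  \<open>a\<^bsub>1,2\<^esub> + a\<^bsub>3,4\<^esub> + \<dots> + a\<^bsub>d-1,d\<^esub> \<in> 2 V\<close>. For odd \<open>d\<close> it leaves exactly two choices at each \<open>(1 j)\<close>,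
  and conjugation by the kernel permutes the resulting \<open>2\<^bsup>2 g\<^esup>\<close> choices transitively.

  A splitting for odd \<open>d\<close> comes from the Clifford algebra with generators \<open>\<gamma>\<^sub>1, \<dots>, \<gamma>\<^sub>d\<close>: a permutation
  \<open>\<sigma>\<close> maps the monomial \<open>\<gamma>\<^sub>I\<close> to \<open>\<plusminus>\<gamma>\<^bsub>\<sigma> I\<^esub>\<close>, with sign given by the number of inversions of \<open>\<sigma>\<close> on
  \<open>I\<close>. Let \<open>q\<close> be the quadratic form of a bilinear form \<open>b\<close> with \<open>b (x, y) - b (y, x) = \<langle>x, y\<rangle>\<close> that lifts the
  multiplication rule of the monomials. The elements \<open>f\<close> over \<open>\<sigma>\<close> such that \<open>q (f x) - q (x)\<close> is modulo \<open>4\<close>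
  twice that number of inversions form a subgroup that meets the kernel in \<open>N\<close>.
\<close>

section \<open>Parity of 2-adic integers\<close>

text \<open>The hard point is existence for odd \<open>d\<close>. Extending prescribed values on the
  transpositions \<open>(1 j)\<close> directly would mean checking a full set of relations of the
  symmetric group. Instead, quasi-cocycles are read off from subgroups: for \<open>h\<close> in
  \<open>H\<close> over \<sigma>, the class in \<open>M\<close> of \<open>h\<close> times the
  inverse of the chosen lift of \<sigma> depends only on \<open>H\<close> and \<sigma>, and these
  classes satisfy the quasi-cocycle equation. One subgroup then yields all parameters by
  conjugation. Precision 4 is what makes the quadratic form q useful: replacing x by x + 2z changes
  q by 2<z,x> modulo 4, so 1 + 2X changes q by 2B(x,x), which is exactly the class in
  \<open>M\<close>. A lift of \<sigma> cannot be expected to preserve q, because the order of the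
  indices enters the bilinear form b modulo 2. The inversion count has the same deviation from
  additivity as this change of q. What remains after subtracting it is twice a linear form modulo 4,
  and the square of a transvection removes it.\<close>

lemmas [simp del] = add_bit_eq_xor mult_bit_eq_and

lemma bit_add_self [simp]: "(x::bit) + x = 0"
  by (cases x) simp_all

lemma bit_add_self_left [simp]: "(x::bit) + (x + y) = y"
  by (simp flip: add.assoc)

lemma bit_mult_self: "(x::bit) * x = x"
  by (cases x) simp_all

lemma bit_add_eq_0_iff: "(x::bit) + y = 0 \<longleftrightarrow> x = y"
  by (cases x; cases y) simp_all

lemma of_int_bit_eq_0_iff: "(of_int k :: bit) = 0 \<longleftrightarrow> even k"
proof
  assume "even k"
  then obtain m where "k = 2 * m" ..
  then show "(of_int k :: bit) = 0" by simp
next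
  assume *: "(of_int k :: bit) = 0"
  show "even k"
  proof (rule ccontr)
    assume "odd k"
    then obtain m where "k = 2 * m + 1" by (auto elim: oddE)
    with * show False by simp
  qed
qed

lemma of_int_mod_2_bit: "(of_int (k mod 2) :: bit) = of_int k"
proof -
  have "(of_int k :: bit) = of_int (2 * (k div 2) + k mod 2)" by simp
  then show ?thesis by (simp only: of_int_add of_int_mult of_int_numeral bit_2_eq_0 mult_zero_left add_0)
qed

definition par :: "two_adic \<Rightarrow> bit" where
  "par t = of_int (residue_mod 1 t)"

lemma par_0 [simp]: "par 0 = 0"
  and par_1 [simp]: "par 1 = 1"
  and par_add: "par (s + t) = par s + par t"
  and par_mult: "par (s * t) = par s * par t"
  and par_uminus [simp]: "par (- t) = par t"
  and par_diff: "par (s - t) = par s + par t"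
  by (simp_all add: par_def residue_mod_simps of_int_mod_2_bit)

lemma par_2 [simp]: "par 2 = 0"
  using par_add[of 1 1] by simp

lemma par_sum: "par (sum f A) = (\<Sum>x\<in>A. par (f x))"
  by (induction A rule: infinite_finite_induct) (simp_all add: par_add)

lemma residue_mod_double: "residue_mod n (2 * t) = (2 * residue_mod n t) mod 2 ^ n"
  by (simp only: mult_2 residue_mod_simps)

lemma two_dvd_iff_residue: "2 dvd t \<longleftrightarrow> residue_mod 1 t = 0"
proof
  assume "2 dvd t"
  then obtain u where "t = 2 * u" ..
  then show "residue_mod 1 t = 0" by (simp add: residue_mod_double)
next
  assume *: "residue_mod 1 t = 0"
  have even: "even (residue_mod (Suc n) t)" for n
  proof (induction n)
    case 0
    then show ?case using * by simp
  next
    case (Suc n)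
    have "residue_mod (Suc n) t = residue_mod (Suc (Suc n)) t mod 2 ^ Suc n"
      by transfer blast
    with Suc show ?case by (simp add: dvd_mod_iff)
  qed
  \<comment> \<open>Halving costs one digit: modulo \<open>2 ^ n\<close> the quotient is determined
    by \<open>t\<close> modulo \<open>2 ^ Suc n\<close>, hence the shift of the index.\<close>
  define u where "u = Abs_two_adic (\<lambda>n. residue_mod (Suc n) t div 2)"
  have "(residue_mod (Suc (Suc n)) t div 2) mod 2 ^ n = residue_mod (Suc n) t div 2" for n
  proof -
    have "residue_mod (Suc n) t = residue_mod (Suc (Suc n)) t mod 2 ^ Suc n"
      by transfer blast
    then show ?thesis by (simp add: zmod_zmult2_eq)
  qed
  then have u: "residue_mod n u = residue_mod (Suc n) t div 2" for n
    by (simp add: u_def residue_mod.rep_eq Abs_two_adic_inverse)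
  have "t = 2 * u"
  proof (rule two_adic_eqI)
    fix n
    have "residue_mod n (2 * u) = residue_mod (Suc n) t mod 2 ^ n"
      using even[of n] by (simp add: residue_mod_double u)
    also have "\<dots> = residue_mod n t" by transfer metis
    finally show "residue_mod n t = residue_mod n (2 * u)" ..
  qed
  then show "2 dvd t" by simp
qed

lemma two_dvd_iff_par: "2 dvd t \<longleftrightarrow> par t = 0"
proof -
  have "residue_mod 1 t mod 2 = residue_mod 1 t" using residue_mod_mod[of 1 t] by simp
  then have "even (residue_mod 1 t) \<longleftrightarrow> residue_mod 1 t = 0" by presburger
  then show ?thesis by (simp add: two_dvd_iff_residue par_def of_int_bit_eq_0_iff)
qed

text \<open>Torsion-freeness, again with a shift of one digit: the hypothesis is read modulo
  \<open>2 ^ Suc n\<close> to obtain the conclusion modulo \<open>2 ^ n\<close>.\<close>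

lemma two_adic_2_mult_eq_0D:
  assumes "(2::two_adic) * t = 0"
  shows "t = 0"
proof (rule two_adic_eqI)
  fix n
  have "residue_mod (Suc n) (2 * t) = 0" using assms by (simp add: residue_mod_simps)
  then have "2 * 2 ^ n dvd 2 * residue_mod (Suc n) t"
    by (simp add: residue_mod_double mod_eq_0_iff_dvd)
  then have "residue_mod (Suc n) t mod 2 ^ n = 0" by (simp only: mod_eq_0_iff_dvd dvd_mult_cancel_left) simp
  moreover have "residue_mod n t = residue_mod (Suc n) t mod 2 ^ n" by transfer blast
  ultimately show "residue_mod n t = residue_mod n 0" by (simp add: residue_mod_simps)
qed

text \<open>The bridge between congruences modulo 4 and identities over the field with two elements.
  Quantities to be compared modulo 4 are first brought to a difference of the form
  \<open>2 * t\<close>.\<close>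

lemma two_adic_4_dvd_2_mult: "4 dvd 2 * t \<longleftrightarrow> par t = 0"
proof
  assume "4 dvd 2 * t"
  then obtain u where "2 * t = 4 * u" ..
  then have "2 * (t - 2 * u) = 0" by (simp add: algebra_simps)
  then have "t = 2 * u" using two_adic_2_mult_eq_0D by fastforce
  then show "par t = 0" by (simp add: par_mult)
next
  assume "par t = 0"
  then obtain u where "t = 2 * u" using two_dvd_iff_par by blast
  then show "4 dvd 2 * t" by simp
qed

lemma residue_mod_diff_eq_0: "residue_mod n s = residue_mod n t \<longleftrightarrow> residue_mod n (s - t) = 0"
  by (simp add: residue_mod_simps)
    (metis mod_eq_dvd_iff mod_0_imp_dvd dvd_imp_mod_0 residue_mod_mod)

lemma residue_mod_2_eq_iff: "residue_mod 2 s = residue_mod 2 t \<longleftrightarrow> 4 dvd s - t"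
proof -
  define u where "u = s - t"
  have "residue_mod 2 u = 0 \<longleftrightarrow> 4 dvd u"
  proof
    assume "4 dvd u"
    then obtain v where "u = 2 * (2 * v)" by (auto elim!: dvdE)
    then show "residue_mod 2 u = 0" by (simp only: residue_mod_double) (simp add: mod_mult_right_eq)
  next
    assume *: "residue_mod 2 u = 0"
    have "residue_mod 1 u = residue_mod 2 u mod 2"
      by transfer (metis One_nat_def Suc_1 power_one_right)
    with * have "2 dvd u" by (simp add: two_dvd_iff_residue)
    then obtain v where v: "u = 2 * v" ..
    have "residue_mod 1 v = residue_mod 2 v mod 2"
      by transfer (metis One_nat_def Suc_1 power_one_right)
    moreover have "4 dvd 2 * residue_mod 2 v"
      using * by (simp add: v residue_mod_double mod_eq_0_iff_dvd)
    ultimately have "residue_mod 1 v = 0" by presburger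
    then obtain w where "v = 2 * w" using two_dvd_iff_residue by blast
    then have "u = 4 * w" by (simp add: v)
    then show "4 dvd u" by simp
  qed
  then show ?thesis using residue_mod_diff_eq_0[of 2] by (simp add: u_def)
qed

section \<open>Symplectic groups of the lattice and of its quotients\<close>

text \<open>Keeps the level \<open>1\<close> in \<open>res 1\<close>, \<open>Vquot 1\<close> and
  \<open>reduce 1\<close>, and the index \<open>1\<close> in \<open>a 1 j\<close>, from being
  rewritten to a successor.\<close>

lemmas [simp del] = One_nat_def

context two_adic_form
begin

lemma form_0_left [simp]: "form 0 y = 0"
  using form_add_left[of 0 0 y] by simp

lemma form_0_right [simp]: "form x 0 = 0"
  using form_add_right[of x 0 0] by simp

lemma form_minus_left: "form (- x) y = - form x y"
  using form_add_left[of "- x" x y] by (simp add: eq_neg_iff_add_eq_0)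

lemma form_minus_right: "form x (- y) = - form x y"
  using form_add_right[of x "- y" y] by (simp add: eq_neg_iff_add_eq_0)

lemma form_diff_left: "form (x - x') y = form x y - form x' y"
  using form_add_left[of x "- x'" y] by (simp add: form_minus_left)

lemma form_diff_right: "form x (y - y') = form x y - form x y'"
  using form_add_right[of x y "- y'"] by (simp add: form_minus_right)

lemmas form_simps = form_add_left form_add_right form_scale_left form_scale_right
  form_minus_left form_minus_right form_diff_left form_diff_right

lemma form_swap: "form y x = - form x y"
proof -
  have "form (x + y) (x + y) = 0" by (rule form_alternating)
  then have "form y x + form x y = 0"
    unfolding form_add_left form_add_right by (simp add: form_alternating add.commute)
  then show ?thesis by (simp add: eq_neg_iff_add_eq_0)
qed

lemma scale_2: "scale 2 x = x + x"
  using scale_left_distrib[of 1 1 x] by simp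

section \<open>Cosets of multiples of the lattice and the quotient groups\<close>

definition res :: "nat \<Rightarrow> 'v \<Rightarrow> 'v set" where
  "res n x = {x + scale (2 ^ n) z | z. True}"

lemma res_eq_iff: "res n x = res n y \<longleftrightarrow> x - y \<in> range (scale (2 ^ n))"
proof
  assume "res n x = res n y"
  moreover have "x \<in> res n x" unfolding res_def by (auto intro!: exI[of _ 0])
  ultimately show "x - y \<in> range (scale (2 ^ n))" unfolding res_def by auto
next
  assume "x - y \<in> range (scale (2 ^ n))"
  then obtain w where w: "x = y + scale (2 ^ n) w" by (auto simp: algebra_simps)
  show "res n x = res n y"
  proof (intro equalityI subsetI)
    fix u assume "u \<in> res n x"
    then obtain z where "u = x + scale (2 ^ n) z" unfolding res_def by auto
    then have "u = y + scale (2 ^ n) (w + z)" by (simp add: w scale_right_distrib algebra_simps)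
    then show "u \<in> res n y" unfolding res_def by auto
  next
    fix u assume "u \<in> res n y"
    then obtain z where "u = y + scale (2 ^ n) z" unfolding res_def by auto
    then have "u = x + scale (2 ^ n) (z - w)" by (simp add: w scale_right_diff_distrib)
    then show "u \<in> res n x" unfolding res_def by auto
  qed
qed

lemma mem_res_iff: "y \<in> res n x \<longleftrightarrow> res n y = res n x"
proof -
  have "y \<in> res n x \<longleftrightarrow> y - x \<in> range (scale (2 ^ n))"
    unfolding res_def by (auto simp: algebra_simps image_iff)
  then show ?thesis by (simp add: res_eq_iff)
qed

lemma self_mem_res [simp]: "x \<in> res n x"
  by (simp add: mem_res_iff)

lemma res_add_cong: "res n x = res n x' \<Longrightarrow> res n y = res n y' \<Longrightarrow> res n (x + y) = res n (x' + y')"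
  unfolding res_eq_iff
proof safe
  fix a b assume "x - x' = scale (2 ^ n) a" "y - y' = scale (2 ^ n) b"
  then have "x + y - (x' + y') = scale (2 ^ n) (a + b)" by (simp add: scale_right_distrib algebra_simps)
  then show "x + y - (x' + y') \<in> range (scale (2 ^ n))" by simp
qed

lemma res_1_if_res_2: "res 2 x = res 2 y \<Longrightarrow> res 1 x = res 1 y"
proof -
  assume "res 2 x = res 2 y"
  then obtain z where "x - y = scale 4 z" by (auto simp: res_eq_iff)
  then have "x - y = scale 2 (scale 2 z)" by simp
  then show ?thesis by (simp add: res_eq_iff del: scale_scale)
qed

lemma group_additive: "group (additive_group :: 'v monoid)"
proof (rule groupI)
  fix x :: 'v
  have "- x \<in> carrier additive_group \<and> - x \<otimes>\<^bsub>additive_group\<^esub> x = \<one>\<^bsub>additive_group\<^esub>"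
    by (simp add: additive_group_def)
  then show "\<exists>y\<in>carrier additive_group. y \<otimes>\<^bsub>additive_group\<^esub> x = \<one>\<^bsub>additive_group\<^esub>"
    by blast
qed (simp_all add: additive_group_def add.assoc)

lemma comm_group_additive: "comm_group (additive_group :: 'v monoid)"
  by (rule group.group_comm_groupI[OF group_additive]) (simp add: additive_group_def add.commute)

lemma inv_additive: "inv\<^bsub>additive_group\<^esub> (x::'v) = - x"
  by (rule group.inv_equality[OF group_additive]) (simp_all add: additive_group_def)

lemma subgroup_range_scale: "subgroup (range (scale c)) additive_group"
proof (rule group.subgroupI[OF group_additive])
  fix x y assume "x \<in> range (scale c)" "y \<in> range (scale c)"
  then obtain a b where "x = scale c a" "y = scale c b" by auto
  then have "x + y = scale c (a + b)" "- x = scale c (- a)" by (simp_all add: scale_right_distrib)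
  then have "x + y \<in> range (scale c)" "- x \<in> range (scale c)" by blast+
  then show "x \<otimes>\<^bsub>additive_group\<^esub> y \<in> range (scale c)" "inv\<^bsub>additive_group\<^esub> x \<in> range (scale c)"
    unfolding inv_additive by (simp_all add: additive_group_def)
qed (simp_all add: additive_group_def)

lemma normal_range_scale: "range (scale c) \<lhd> additive_group"
  using comm_group.subgroup_imp_normal[OF comm_group_additive subgroup_range_scale] .

lemma range_scale_coset: "range (scale (2 ^ n)) #>\<^bsub>additive_group\<^esub> x = res n x"
  by (auto simp: r_coset_def additive_group_def res_def add.commute)

lemma group_Vquot: "group (Vquot n)"
  unfolding Vquot_def by (rule normal.factorgroup_is_group[OF normal_range_scale])

lemma carrier_Vquot: "carrier (Vquot n) = range (res n)"
  unfolding Vquot_def carrier_FactGroup range_scale_coset by (simp add: additive_group_def)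

lemma res_in_Vquot [simp]: "res n x \<in> carrier (Vquot n)"
  by (simp add: carrier_Vquot)

lemma mult_Vquot: "res n x \<otimes>\<^bsub>Vquot n\<^esub> res n y = res n (x + y)"
  using normal.rcos_sum[OF normal_range_scale, of x y "2 ^ n"]
  by (simp add: Vquot_def range_scale_coset) (simp add: additive_group_def)

lemma residue_mod_2_power_mult: "residue_mod n (2 ^ n * t) = 0"
proof -
  have "residue_mod m (2 ^ k * t) = 2 ^ k * residue_mod m t mod 2 ^ m" for m k
  proof (induction k)
    case (Suc k)
    then show ?case by (simp add: mult.assoc residue_mod_double mod_mult_right_eq)
  qed (simp add: residue_mod_mod)
  then show ?thesis by simp
qed

lemma form_quot_res: "form_quot n (res n x) (res n y) = residue_mod n (form x y)"
proof -
  have "residue_mod n (form x' y') = residue_mod n (form x y)"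
    if "res n x' = res n x" "res n y' = res n y" for x' y'
  proof -
    from that obtain a b where ab: "x' = x + scale (2 ^ n) a" "y' = y + scale (2 ^ n) b"
      unfolding res_eq_iff by (auto simp: algebra_simps)
    have "form x' y' - form x y = 2 ^ n * (form a y + form x b + 2 ^ n * form a b)"
      by (simp add: ab form_simps algebra_simps)
    then show ?thesis
      by (subst residue_mod_diff_eq_0) (simp only: residue_mod_2_power_mult)
  qed
  then have "{residue_mod n (form x' y') | x' y'. x' \<in> res n x \<and> y' \<in> res n y} = {residue_mod n (form x y)}"
    unfolding mem_res_iff by blast
  then show ?thesis unfolding form_quot_def by simp
qed

section \<open>The symplectic group of the lattice and its transvections\<close>

lemma SpV_carrier_iff:
  "f \<in> carrier SpV \<longleftrightarrow> bij f \<and> module_hom scale scale f \<and> (\<forall>x y. form (f x) (f y) = form x y)"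
  by (auto simp: SpV_def Bij_def)

lemma SpV_add: "f \<in> carrier SpV \<Longrightarrow> f (x + y) = f x + f y"
  using module_hom.add by (auto simp: SpV_carrier_iff)

lemma SpV_scale: "f \<in> carrier SpV \<Longrightarrow> f (scale c x) = scale c (f x)"
  using module_hom.scale by (auto simp: SpV_carrier_iff)

lemma SpV_form: "f \<in> carrier SpV \<Longrightarrow> form (f x) (f y) = form x y"
  by (simp add: SpV_carrier_iff)

lemma SpV_bij: "f \<in> carrier SpV \<Longrightarrow> bij f"
  by (simp add: SpV_carrier_iff)

lemma SpV_I:
  assumes "bij f" "\<And>x y. f (x + y) = f x + f y" "\<And>c x. f (scale c x) = scale c (f x)"
    "\<And>x y. form (f x) (f y) = form x y"
  shows "f \<in> carrier SpV"
  using assms by (simp add: SpV_carrier_iff module_hom_iff module_axioms)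

lemma subgroup_SpV: "subgroup (carrier SpV) (BijGroup UNIV)"
proof (rule group.subgroupI[OF group_BijGroup])
  show "carrier SpV \<subseteq> carrier (BijGroup UNIV)" by (auto simp: SpV_def BijGroup_def)
  have "id \<in> carrier SpV" by (rule SpV_I) simp_all
  then show "carrier SpV \<noteq> {}" by blast
next
  fix f assume f: "f \<in> carrier SpV"
  have "inv\<^bsub>BijGroup UNIV\<^esub> f = inv_into UNIV f"
    using f by (subst inv_BijGroup) (auto simp: Bij_def SpV_carrier_iff)
  moreover have "inv_into UNIV f \<in> carrier SpV"
  proof (rule SpV_I)
    have b: "f (inv_into UNIV f x) = x" "inv_into UNIV f (f x) = x" for x
      using SpV_bij[OF f] by (simp_all add: bij_is_surj surj_f_inv_f bij_is_inj)
    show "inv_into UNIV f (x + y) = inv_into UNIV f x + inv_into UNIV f y" for x y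
      using SpV_add[OF f, of "inv_into UNIV f x" "inv_into UNIV f y"] b by metis
    show "inv_into UNIV f (scale c x) = scale c (inv_into UNIV f x)" for c x
      using SpV_scale[OF f, of c "inv_into UNIV f x"] b by metis
    show "form (inv_into UNIV f x) (inv_into UNIV f y) = form x y" for x y
      using SpV_form[OF f, of "inv_into UNIV f x" "inv_into UNIV f y"] b by metis
  qed (rule bij_imp_bij_inv[OF SpV_bij[OF f]])
  ultimately show "inv\<^bsub>BijGroup UNIV\<^esub> f \<in> carrier SpV" by simp
next
  fix f h assume f: "f \<in> carrier SpV" and h: "h \<in> carrier SpV"
  have "f \<otimes>\<^bsub>BijGroup UNIV\<^esub> h = f \<circ> h"
    using f h by (simp add: BijGroup_def Bij_def SpV_carrier_iff compose_def fun_eq_iff)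
  moreover have "f \<circ> h \<in> carrier SpV"
    by (rule SpV_I) (simp_all add: SpV_add SpV_scale SpV_form f h bij_comp[OF SpV_bij[OF h] SpV_bij[OF f]])
  ultimately show "f \<otimes>\<^bsub>BijGroup UNIV\<^esub> h \<in> carrier SpV" by simp
qed

lemma group_SpV: "group SpV"
proof -
  have "SpV = (BijGroup UNIV)\<lparr>carrier := carrier SpV\<rparr>" by (simp add: SpV_def)
  then show ?thesis using subgroup.subgroup_is_group[OF subgroup_SpV group_BijGroup] by metis
qed

lemma mult_SpV: "f \<in> carrier SpV \<Longrightarrow> h \<in> carrier SpV \<Longrightarrow> f \<otimes>\<^bsub>SpV\<^esub> h = f \<circ> h"
  by (simp add: SpV_def BijGroup_def Bij_def compose_def fun_eq_iff)

lemma comp_SpV: "f \<in> carrier SpV \<Longrightarrow> h \<in> carrier SpV \<Longrightarrow> f \<circ> h \<in> carrier SpV"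
  using monoid.m_closed[OF group.is_monoid[OF group_SpV], of f h] by (simp add: mult_SpV)

lemma one_SpV: "\<one>\<^bsub>SpV\<^esub> = id"
  by (simp add: SpV_def BijGroup_def fun_eq_iff)

lemma transvection_SpV: "transvection a \<in> carrier SpV"
proof (rule SpV_I)
  show "transvection a (x + y) = transvection a x + transvection a y" for x y
    by (simp add: transvection_def form_simps scale_left_distrib)
  show "transvection a (scale c x) = scale c (transvection a x)" for c x
    by (simp add: transvection_def form_simps scale_right_distrib)
  show "form (transvection a x) (transvection a y) = form x y" for x y
    using form_swap[of a y] by (simp add: transvection_def form_simps form_alternating algebra_simps)
  have "transvection a (v - scale (form v a) a) = v" "transvection a v - scale (form (transvection a v) a) a = v" for v
    by (simp_all add: transvection_def form_simps form_alternating)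
  then show "bij (transvection a)"
    by (intro o_bij[of "\<lambda>v. v - scale (form v a) a"]) (simp_all add: fun_eq_iff)
qed

section \<open>The symplectic groups of the quotients\<close>

lemma SpQ_carrier_iff:
  "k \<in> carrier (SpQ n) \<longleftrightarrow> k \<in> auto (Vquot n) \<and> (\<forall>X\<in>carrier (Vquot n). \<forall>Y\<in>carrier (Vquot n).
        form_quot n (k X) (k Y) = form_quot n X Y)"
  by (simp add: SpQ_def)

lemma SpQ_Bij: "k \<in> carrier (SpQ n) \<Longrightarrow> k \<in> Bij (carrier (Vquot n))"
  by (simp add: SpQ_carrier_iff auto_def)

lemma SpQ_closed: "k \<in> carrier (SpQ n) \<Longrightarrow> X \<in> carrier (Vquot n) \<Longrightarrow> k X \<in> carrier (Vquot n)"
  using SpQ_Bij Bij_imp_funcset by blast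

lemma mult_SpQ: "k \<in> carrier (SpQ n) \<Longrightarrow> l \<in> carrier (SpQ n) \<Longrightarrow>
  k \<otimes>\<^bsub>SpQ n\<^esub> l = compose (carrier (Vquot n)) k l"
  by (simp add: SpQ_def AutoGroup_def BijGroup_def auto_def)

lemma one_SpQ: "\<one>\<^bsub>SpQ n\<^esub> = (\<lambda>X\<in>carrier (Vquot n). X)"
  by (simp add: SpQ_def AutoGroup_def BijGroup_def)

lemma subgroup_SpQ: "subgroup (carrier (SpQ n)) (AutoGroup (Vquot n))"
proof (rule group.subgroupI[OF group.AutoGroup[OF group_Vquot]])
  show "carrier (SpQ n) \<subseteq> carrier (AutoGroup (Vquot n))"
    by (auto simp: SpQ_carrier_iff AutoGroup_def)
  have "(\<lambda>X\<in>carrier (Vquot n). X) \<in> carrier (SpQ n)"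
    using group.id_in_auto[OF group_Vquot] by (simp add: SpQ_carrier_iff)
  then show "carrier (SpQ n) \<noteq> {}" by blast
next
  fix k assume k: "k \<in> carrier (SpQ n)"
  let ?S = "carrier (Vquot n)"
  have sub: "subgroup (auto (Vquot n)) (BijGroup ?S)" by (rule group.subgroup_auto[OF group_Vquot])
  have eq: "inv\<^bsub>AutoGroup (Vquot n)\<^esub> k = (\<lambda>X\<in>?S. inv_into ?S k X)"
    using k group.m_inv_consistent[OF group_BijGroup sub] inv_BijGroup[OF SpQ_Bij[OF k]]
    by (simp add: SpQ_carrier_iff AutoGroup_def)
  have "inv\<^bsub>AutoGroup (Vquot n)\<^esub> k \<in> auto (Vquot n)"
    using group.inv_closed[OF group.AutoGroup[OF group_Vquot], of k n] k
    by (simp add: SpQ_carrier_iff AutoGroup_def)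
  moreover have "form_quot n (inv_into ?S k X) (inv_into ?S k Y) = form_quot n X Y"
    if "X \<in> ?S" "Y \<in> ?S" for X Y
  proof -
    have b: "bij_betw k ?S ?S" using SpQ_Bij[OF k] by (simp add: Bij_def)
    have "inv_into ?S k X \<in> ?S" "inv_into ?S k Y \<in> ?S" "k (inv_into ?S k X) = X" "k (inv_into ?S k Y) = Y"
      using that b by (simp_all add: bij_betw_def inv_into_into f_inv_into_f)
    then show ?thesis using k unfolding SpQ_carrier_iff by metis
  qed
  ultimately show "inv\<^bsub>AutoGroup (Vquot n)\<^esub> k \<in> carrier (SpQ n)"
    by (simp add: SpQ_carrier_iff eq)
next
  fix k l assume k: "k \<in> carrier (SpQ n)" and l: "l \<in> carrier (SpQ n)"
  have "k \<otimes>\<^bsub>AutoGroup (Vquot n)\<^esub> l \<in> auto (Vquot n)"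
    using group.is_monoid[OF group.AutoGroup[OF group_Vquot], THEN monoid.m_closed, of k n l] k l
    by (simp add: SpQ_carrier_iff AutoGroup_def)
  moreover have "k \<otimes>\<^bsub>AutoGroup (Vquot n)\<^esub> l = compose (carrier (Vquot n)) k l"
    using mult_SpQ[OF k l] by (simp add: SpQ_def)
  ultimately show "k \<otimes>\<^bsub>AutoGroup (Vquot n)\<^esub> l \<in> carrier (SpQ n)"
    using k l SpQ_closed[OF l] by (simp add: SpQ_carrier_iff compose_def)
qed

lemma group_SpQ: "group (SpQ n)"
proof -
  have "SpQ n = (AutoGroup (Vquot n))\<lparr>carrier := carrier (SpQ n)\<rparr>" by (simp add: SpQ_def)
  then show ?thesis
    using subgroup.subgroup_is_group[OF subgroup_SpQ group.AutoGroup[OF group_Vquot]] by metis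
qed

section \<open>Reduction as a group homomorphism\<close>

lemma SpV_image_res:
  assumes f: "f \<in> carrier SpV"
  shows "f ` res n x = res n (f x)"
proof -
  have "f ` res n x = {f x + scale (2 ^ n) (f z) | z. True}"
    unfolding res_def by (auto simp: image_iff SpV_add[OF f] SpV_scale[OF f]) (metis SpV_add[OF f] SpV_scale[OF f])
  also have "\<dots> = res n (f x)"
    unfolding res_def using SpV_bij[OF f, THEN bij_is_surj] by (auto, metis surjD)
  finally show ?thesis .
qed

lemma reduce_res: "f \<in> carrier SpV \<Longrightarrow> reduce n f (res n x) = res n (f x)"
  by (simp add: reduce_def SpV_image_res)

lemma reduce_SpQ:
  assumes f: "f \<in> carrier SpV"
  shows "reduce n f \<in> carrier (SpQ n)"
proof -
  have resI: "res n (f x) = res n (f y) \<longleftrightarrow> res n x = res n y" for x y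
  proof -
    have "bij f" using SpV_bij[OF f] .
    have d: "f x - f y = f (x - y)" using SpV_add[OF f, of "x - y" y] by simp
    have "f u \<in> range (scale (2 ^ n)) \<longleftrightarrow> u \<in> range (scale (2 ^ n))" for u
    proof
      assume "f u \<in> range (scale (2 ^ n))"
      then obtain z where "f u = scale (2 ^ n) z" by auto
      moreover obtain z' where "z = f z'" using \<open>bij f\<close> by (metis bij_pointE)
      ultimately have "f u = f (scale (2 ^ n) z')" by (simp add: SpV_scale[OF f])
      then have "u = scale (2 ^ n) z'" using \<open>bij f\<close> by (metis bij_is_inj injD)
      then show "u \<in> range (scale (2 ^ n))" by blast
    qed (auto simp: SpV_scale[OF f])
    then show ?thesis by (simp add: res_eq_iff d)
  qed
  have "bij_betw (reduce n f) (carrier (Vquot n)) (carrier (Vquot n))"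
    unfolding bij_betw_def
  proof
    show "inj_on (reduce n f) (carrier (Vquot n))"
      by (auto simp: inj_on_def carrier_Vquot reduce_res[OF f] resI)
    have "reduce n f ` carrier (Vquot n) = res n ` range f"
      by (simp add: carrier_Vquot image_image reduce_res[OF f])
    then show "reduce n f ` carrier (Vquot n) = carrier (Vquot n)"
      using SpV_bij[OF f, THEN bij_is_surj] by (simp add: carrier_Vquot)
  qed
  moreover have "reduce n f \<in> hom (Vquot n) (Vquot n)"
    by (rule homI) (auto simp: carrier_Vquot reduce_res[OF f] mult_Vquot SpV_add[OF f])
  moreover have "reduce n f \<in> extensional (carrier (Vquot n))" by (simp add: reduce_def)
  ultimately show ?thesis
    by (auto simp: SpQ_carrier_iff auto_def Bij_def carrier_Vquot reduce_res[OF f] form_quot_res SpV_form[OF f])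
qed

lemma reduce_mult:
  assumes f: "f \<in> carrier SpV" and h: "h \<in> carrier SpV"
  shows "reduce n (f \<circ> h) = reduce n f \<otimes>\<^bsub>SpQ n\<^esub> reduce n h"
  unfolding mult_SpQ[OF reduce_SpQ[OF f] reduce_SpQ[OF h]]
proof (rule extensionalityI[where A = "carrier (Vquot n)"])
  fix X assume "X \<in> carrier (Vquot n)"
  then show "reduce n (f \<circ> h) X = compose (carrier (Vquot n)) (reduce n f) (reduce n h) X"
    by (auto simp: carrier_Vquot reduce_res[OF f] reduce_res[OF h] reduce_res[OF comp_SpV[OF f h]] compose_def)
qed (simp_all add: reduce_def compose_def)

lemma group_hom_reduce: "group_hom SpV (SpQ n) (reduce n)"
  by (intro group_hom.intro group_SpV group_SpQ group_hom_axioms.intro homI)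
    (simp_all add: reduce_SpQ mult_SpV reduce_mult)

lemma reduce_id: "reduce n id = \<one>\<^bsub>SpQ n\<^esub>"
  using group_hom.hom_one[OF group_hom_reduce] by (simp add: one_SpV)

text \<open>Elements of \<open>SpQ 2\<close> act on cosets; this picks representatives, so that
  computations take place in the lattice. The chosen map is in general neither additive nor
  isometric, and only its class modulo 4 carries meaning.\<close>

definition ap :: "('v set \<Rightarrow> 'v set) \<Rightarrow> 'v \<Rightarrow> 'v" where
  "ap k x = (SOME y. k (res 2 x) = res 2 y)"

lemma res_ap:
  assumes "k \<in> carrier (SpQ 2)"
  shows "res 2 (ap k x) = k (res 2 x)"
proof -
  have "k (res 2 x) \<in> range (res 2)"
    using SpQ_closed[OF assms, of "res 2 x"] by (simp add: carrier_Vquot)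
  then have "\<exists>y. k (res 2 x) = res 2 y" by auto
  then have "k (res 2 x) = res 2 (ap k x)" unfolding ap_def by (rule someI_ex)
  then show ?thesis ..
qed

lemma ap_cong: "k \<in> carrier (SpQ 2) \<Longrightarrow> res 2 x = res 2 y \<Longrightarrow> res 2 (ap k x) = res 2 (ap k y)"
  by (simp add: res_ap)

lemma ap_add:
  assumes k: "k \<in> carrier (SpQ 2)"
  shows "res 2 (ap k (x + y)) = res 2 (ap k x + ap k y)"
proof -
  have "k (res 2 x \<otimes>\<^bsub>Vquot 2\<^esub> res 2 y) = k (res 2 x) \<otimes>\<^bsub>Vquot 2\<^esub> k (res 2 y)"
    using k by (intro hom_mult[of k "Vquot 2" "Vquot 2"]) (simp_all add: SpQ_carrier_iff auto_def)
  then show ?thesis using k by (simp add: mult_Vquot flip: res_ap)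
qed

lemma ap_form: "k \<in> carrier (SpQ 2) \<Longrightarrow> 4 dvd form (ap k x) (ap k y) - form x y"
proof -
  assume k: "k \<in> carrier (SpQ 2)"
  then have "form_quot 2 (k (res 2 x)) (k (res 2 y)) = form_quot 2 (res 2 x) (res 2 y)"
    by (simp add: SpQ_carrier_iff)
  then show ?thesis using k by (simp add: form_quot_res residue_mod_2_eq_iff flip: res_ap)
qed

lemma SpQ_eqI:
  assumes "k \<in> carrier (SpQ 2)" "l \<in> carrier (SpQ 2)" "\<And>x. res 2 (ap k x) = res 2 (ap l x)"
  shows "k = l"
proof (rule extensionalityI[where A = "carrier (Vquot 2)"])
  show "k \<in> extensional (carrier (Vquot 2))" "l \<in> extensional (carrier (Vquot 2))"
    using assms by (auto dest!: SpQ_Bij simp: Bij_def)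
  fix X assume "X \<in> carrier (Vquot 2)"
  then show "k X = l X" using assms by (auto simp: carrier_Vquot simp flip: res_ap)
qed

lemma ap_mult: "k \<in> carrier (SpQ 2) \<Longrightarrow> l \<in> carrier (SpQ 2) \<Longrightarrow>
  res 2 (ap (k \<otimes>\<^bsub>SpQ 2\<^esub> l) x) = res 2 (ap k (ap l x))"
  by (simp add: res_ap monoid.m_closed[OF group.is_monoid[OF group_SpQ]]) (simp add: mult_SpQ compose_def)

lemma ap_one: "res 2 (ap \<one>\<^bsub>SpQ 2\<^esub> x) = res 2 x"
  by (simp add: res_ap monoid.one_closed[OF group.is_monoid[OF group_SpQ]]) (simp add: one_SpQ)

lemma ap_inv:
  assumes k: "k \<in> carrier (SpQ 2)"
  shows "res 2 (ap (inv\<^bsub>SpQ 2\<^esub> k) (ap k x)) = res 2 x" "res 2 (ap k (ap (inv\<^bsub>SpQ 2\<^esub> k) x)) = res 2 x"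
proof -
  have i: "inv\<^bsub>SpQ 2\<^esub> k \<in> carrier (SpQ 2)" using k by (rule group.inv_closed[OF group_SpQ])
  show "res 2 (ap (inv\<^bsub>SpQ 2\<^esub> k) (ap k x)) = res 2 x"
    using ap_mult[OF i k, of x] unfolding group.l_inv[OF group_SpQ k] ap_one by (rule sym)
  show "res 2 (ap k (ap (inv\<^bsub>SpQ 2\<^esub> k) x)) = res 2 x"
    using ap_mult[OF k i, of x] unfolding group.r_inv[OF group_SpQ k] ap_one by (rule sym)
qed

lemma ap_reduce: "f \<in> carrier SpV \<Longrightarrow> res 2 (ap (reduce 2 f) x) = res 2 (f x)"
  by (simp add: res_ap reduce_SpQ reduce_res)

lemma reduce_quot_res:
  assumes k: "k \<in> carrier (SpQ 2)"
  shows "reduce_quot 2 1 k (res 1 x) = res 1 (ap k x)"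
proof -
  have sub: "res 2 y \<subseteq> res 1 x \<longleftrightarrow> res 1 y = res 1 x" for y
  proof
    assume "res 2 y \<subseteq> res 1 x"
    then have "y \<in> res 1 x" using self_mem_res by blast
    then show "res 1 y = res 1 x" by (simp add: mem_res_iff)
  next
    assume "res 1 y = res 1 x"
    then show "res 2 y \<subseteq> res 1 x"
      using res_1_if_res_2 unfolding mem_res_iff subset_iff by metis
  qed
  have double: "res 2 (ap k (scale 2 z)) = res 2 (scale 2 (ap k z))" for z
    using ap_add[OF k, of z z] by (simp add: scale_2)
  have shift: "res 2 (ap k (y + scale 2 z)) = res 2 (ap k y + scale 2 (ap k z))" for y z
    using ap_add[OF k, of y "scale 2 z"] res_add_cong[OF refl double, of "ap k y" z] by (rule trans)
  have "(\<Union>Y\<in>{Y \<in> carrier (Vquot 2). Y \<subseteq> res 1 x}. k Y) = res 1 (ap k x)"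
  proof (intro equalityI subsetI)
    fix u assume "u \<in> (\<Union>Y\<in>{Y \<in> carrier (Vquot 2). Y \<subseteq> res 1 x}. k Y)"
    then obtain y where y: "res 1 y = res 1 x" "u \<in> k (res 2 y)" by (auto simp: carrier_Vquot sub)
    then obtain z where "y = x + scale 2 z" by (auto simp: res_eq_iff algebra_simps)
    then have "res 2 u = res 2 (ap k x + scale 2 (ap k z))"
      using y(2) shift by (simp add: mem_res_iff flip: res_ap[OF k])
    then have "res 1 u = res 1 (ap k x + scale 2 (ap k z))" by (rule res_1_if_res_2)
    also have "\<dots> = res 1 (ap k x)" by (simp add: res_eq_iff)
    finally show "u \<in> res 1 (ap k x)" by (simp add: mem_res_iff)
  next
    fix u assume "u \<in> res 1 (ap k x)"
    then obtain z where z: "u = ap k x + scale 2 z" unfolding res_def by auto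
    \<comment> \<open>\<open>k\<close> is onto modulo 4, so the shift by \<open>2 z\<close> in the
      image comes from a shift by \<open>2 z'\<close> in the argument.\<close>
    define z' where "z' = ap (inv\<^bsub>SpQ 2\<^esub> k) z"
    have "res 2 (ap k z') = res 2 z" using ap_inv(2)[OF k] by (simp add: z'_def)
    then have "res 2 (scale 2 (ap k z')) = res 2 (scale 2 z)" unfolding scale_2 by (intro res_add_cong)
    then have "res 2 (ap k x + scale 2 (ap k z')) = res 2 u" unfolding z by (intro res_add_cong refl)
    then have "res 2 u = res 2 (ap k (x + scale 2 z'))" unfolding shift ..
    then have "u \<in> k (res 2 (x + scale 2 z'))" by (simp add: mem_res_iff flip: res_ap[OF k])
    moreover have "res 2 (x + scale 2 z') \<subseteq> res 1 x" unfolding sub by (simp add: res_eq_iff)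
    ultimately show "u \<in> (\<Union>Y\<in>{Y \<in> carrier (Vquot 2). Y \<subseteq> res 1 x}. k Y)"
      using res_in_Vquot by blast
  qed
  then show ?thesis by (simp add: reduce_quot_def)
qed

end

section \<open>Coordinates modulo 2\<close>

lemma W0_carrier_iff: "w \<in> carrier (W0 d) \<longleftrightarrow> (\<forall>i. i \<notin> {1..d} \<longrightarrow> w i = 0) \<and> (\<Sum>i\<in>{1..d}. w i) = 0"
  by (simp add: W0_def)

lemma mult_W0: "w \<otimes>\<^bsub>W0 d\<^esub> w' = (\<lambda>i. w i + w' i)"
  by (simp add: W0_def)

lemma one_W0: "\<one>\<^bsub>W0 d\<^esub> = (\<lambda>_. 0)"
  by (simp add: W0_def)

lemma comm_group_W0: "comm_group (W0 d)"
proof (rule comm_groupI)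
  fix w assume "w \<in> carrier (W0 d)"
  moreover from this have "w \<otimes>\<^bsub>W0 d\<^esub> w = \<one>\<^bsub>W0 d\<^esub>" by (simp add: mult_W0 one_W0)
  ultimately show "\<exists>w'\<in>carrier (W0 d). w' \<otimes>\<^bsub>W0 d\<^esub> w = \<one>\<^bsub>W0 d\<^esub>" by blast
qed (auto simp: mult_W0 one_W0 W0_carrier_iff sum.distrib add_ac)

lemma sum_indicator_vec:
  assumes "finite A" "J \<subseteq> A"
  shows "(\<Sum>i\<in>A. indicator_vec J i) = (of_nat (card J) :: bit)"
proof -
  have "(\<Sum>i\<in>A. indicator_vec J i) = (\<Sum>i\<in>A. if i \<in> J then 1 else (0::bit))"
    by (rule sum.cong) (simp_all add: indicator_vec_def)
  also have "\<dots> = (\<Sum>i\<in>J. 1)" using assms by (simp flip: sum.inter_restrict add: Int_absorb1)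
  finally show ?thesis by simp
qed

lemma of_nat_bit_eq_0_iff: "(of_nat k :: bit) = 0 \<longleftrightarrow> even k"
  using of_int_bit_eq_0_iff[of "int k"] by simp

lemma indicator_vec_W0: "J \<subseteq> {1..d} \<Longrightarrow> even (card J) \<Longrightarrow> indicator_vec J \<in> carrier (W0 d)"
  using sum_indicator_vec[of "{1..d}" J]
  by (auto simp: W0_carrier_iff of_nat_bit_eq_0_iff) (auto simp: indicator_vec_def)

lemma subgroup_W0_radical: "subgroup (W0_radical d) (W0 d)"
proof -
  interpret comm_group "W0 d" by (rule comm_group_W0)
  have inv: "inv\<^bsub>W0 d\<^esub> w = w" if "w \<in> carrier (W0 d)" for w
    using that by (intro inv_equality) (simp_all add: mult_W0 one_W0)
  have W: "(\<lambda>_. 0) \<in> carrier (W0 d)" "even d \<Longrightarrow> indicator_vec {1..d} \<in> carrier (W0 d)"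
    using indicator_vec_W0[of "{1..d}" d] by (simp_all add: W0_carrier_iff)
  show ?thesis
    by (rule subgroupI) (auto simp: W0_radical_def W inv mult_W0 split: if_splits)
qed

lemma normal_W0_radical: "W0_radical d \<lhd> W0 d"
  by (rule comm_group.subgroup_imp_normal[OF comm_group_W0 subgroup_W0_radical])

abbreviation cls :: "nat \<Rightarrow> (nat \<Rightarrow> bit) \<Rightarrow> (nat \<Rightarrow> bit) set" where
  "cls d w \<equiv> W0_radical d #>\<^bsub>W0 d\<^esub> w"

lemma cls_eq: "cls d w = {\<lambda>i. r i + w i | r. r \<in> W0_radical d}"
  unfolding r_coset_def by (auto simp: mult_W0)

lemma cls_eq_image: "cls d w = (\<lambda>r i. r i + w i) ` W0_radical d"
  unfolding cls_eq by blast

lemma cls_odd: "odd d \<Longrightarrow> cls d w = {w}"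
  unfolding cls_eq_image by (simp add: W0_radical_def)

lemma cls_even: "even d \<Longrightarrow> cls d w = {w, \<lambda>i. indicator_vec {1..d} i + w i}"
  unfolding cls_eq_image by (simp add: W0_radical_def)

lemma vbar_eq: "vbar d J = cls d (indicator_vec J)"
  by (simp add: vbar_def)

lemma carrier_Vbar: "carrier (Vbar d) = cls d ` carrier (W0 d)"
  by (simp add: Vbar_def carrier_FactGroup)

lemma mult_Vbar: "w \<in> carrier (W0 d) \<Longrightarrow> w' \<in> carrier (W0 d) \<Longrightarrow>
  cls d w \<otimes>\<^bsub>Vbar d\<^esub> cls d w' = cls d (\<lambda>i. w i + w' i)"
  using normal.rcos_sum[OF normal_W0_radical, of w d w'] by (simp add: Vbar_def mult_W0)

lemma one_Vbar: "\<one>\<^bsub>Vbar d\<^esub> = cls d (\<lambda>_. 0)"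
  by (auto simp: Vbar_def cls_eq)

lemma sum_W0_radical_mult:
  assumes "r \<in> W0_radical d" "w \<in> carrier (W0 d)"
  shows "(\<Sum>i\<in>{1..d}. r i * w i) = 0"
proof (cases "r = (\<lambda>_. 0)")
  case False
  then have "r = indicator_vec {1..d}" using assms(1) by (simp add: W0_radical_def split: if_splits)
  then have "(\<Sum>i\<in>{1..d}. r i * w i) = (\<Sum>i\<in>{1..d}. w i)"
    by (intro sum.cong) (simp_all add: indicator_vec_def)
  then show ?thesis using assms(2) by (simp add: W0_carrier_iff)
qed simp

lemma Vbar_form_cls:
  assumes w: "w \<in> carrier (W0 d)" and w': "w' \<in> carrier (W0 d)"
  shows "Vbar_form d (cls d w) (cls d w') = (\<Sum>i\<in>{1..d}. w i * w' i)"
proof -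
  have "(\<Sum>i\<in>{1..d}. (r i + w i) * (r' i + w' i)) = (\<Sum>i\<in>{1..d}. w i * w' i)"
    if r: "r \<in> W0_radical d" "r' \<in> W0_radical d" for r r'
  proof -
    have r': "r' \<in> carrier (W0 d)" using r subgroup.subset[OF subgroup_W0_radical] by blast
    have "(\<Sum>i\<in>{1..d}. (r i + w i) * (r' i + w' i))
      = (\<Sum>i\<in>{1..d}. r i * r' i) + (\<Sum>i\<in>{1..d}. r i * w' i)
        + (\<Sum>i\<in>{1..d}. r' i * w i) + (\<Sum>i\<in>{1..d}. w i * w' i)"
      unfolding sum.distrib[symmetric] by (rule sum.cong) (simp_all add: algebra_simps)
    then show ?thesis
      by (simp only: sum_W0_radical_mult[OF r(1) r'] sum_W0_radical_mult[OF r(1) w']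
          sum_W0_radical_mult[OF r(2) w] add_0)
  qed
  moreover have "(\<lambda>_. 0) \<in> W0_radical d" by (simp add: W0_radical_def)
  then have "w \<in> cls d w" "w' \<in> cls d w'" unfolding cls_eq by force+
  ultimately have "{\<Sum>i\<in>{1..d}. u i * u' i | u u'. u \<in> cls d w \<and> u' \<in> cls d w'} = {\<Sum>i\<in>{1..d}. w i * w' i}"
    unfolding cls_eq_image by blast
  then show ?thesis unfolding Vbar_form_def by simp
qed

lemma W0_comp_inv:
  assumes "\<sigma> \<in> Sym d" "w \<in> carrier (W0 d)"
  shows "w \<circ> inv_into UNIV \<sigma> \<in> carrier (W0 d)"
proof -
  have p: "inv_into UNIV \<sigma> permutes {1..d}" using assms(1) by (simp add: Sym_def permutes_inv)
  have "(\<Sum>i\<in>{1..d}. w (inv_into UNIV \<sigma> i)) = (\<Sum>i\<in>{1..d}. w i)"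
    using sum.permute[OF p, of w] by (simp add: comp_def)
  then show ?thesis using assms(2) p by (auto simp: W0_carrier_iff permutes_not_in)
qed

lemma std_rep_cls:
  assumes \<sigma>: "\<sigma> \<in> Sym d" and w: "w \<in> carrier (W0 d)"
  shows "std_rep d \<sigma> (cls d w) = cls d (w \<circ> inv_into UNIV \<sigma>)"
proof -
  have p: "inv_into UNIV \<sigma> permutes {1..d}" using \<sigma> by (simp add: Sym_def permutes_inv)
  have r: "indicator_vec {1..d} \<circ> inv_into UNIV \<sigma> = indicator_vec {1..d}"
    by (simp add: indicator_vec_def fun_eq_iff comp_def permutes_in_image[OF p] del: atLeastAtMost_iff)
  have "(\<lambda>w. w \<circ> inv_into UNIV \<sigma>) ` cls d w = cls d (w \<circ> inv_into UNIV \<sigma>)"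
  proof (cases "odd d")
    case True
    then show ?thesis by (simp add: cls_odd)
  next
    case False
    then show ?thesis using r by (simp add: cls_even comp_def fun_eq_iff)
  qed
  moreover have "cls d w \<in> carrier (Vbar d)" using w by (simp add: carrier_Vbar)
  ultimately show ?thesis by (simp add: std_rep_def)
qed

lemma Sym_comp: "\<sigma> \<in> Sym d \<Longrightarrow> \<tau> \<in> Sym d \<Longrightarrow> \<sigma> \<circ> \<tau> \<in> Sym d"
  by (simp add: Sym_def permutes_compose)

lemma Sym_inv: "\<sigma> \<in> Sym d \<Longrightarrow> inv_into UNIV \<sigma> \<in> Sym d"
  by (simp add: Sym_def permutes_inv)

lemma Sym_id: "id \<in> Sym d"
  by (simp add: Sym_def permutes_id)

lemma Sym_transpose: "i \<in> {1..d} \<Longrightarrow> j \<in> {1..d} \<Longrightarrow> transpose i j \<in> Sym d"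
  by (simp add: Sym_def permutes_swap_id)

lemma std_rep_comp:
  assumes "\<sigma> \<in> Sym d" "\<tau> \<in> Sym d" "X \<in> carrier (Vbar d)"
  shows "std_rep d (\<sigma> \<circ> \<tau>) X = std_rep d \<sigma> (std_rep d \<tau> X)"
proof -
  obtain w where w: "w \<in> carrier (W0 d)" "X = cls d w" using assms(3) by (auto simp: carrier_Vbar)
  have "bij \<sigma>" "bij \<tau>" using assms by (auto simp: Sym_def permutes_bij)
  then show ?thesis using assms w
    by (simp add: std_rep_cls Sym_comp W0_comp_inv o_inv_distrib comp_assoc)
qed

lemma std_rep_id: "X \<in> carrier (Vbar d) \<Longrightarrow> std_rep d id X = X"
  by (auto simp: carrier_Vbar std_rep_cls Sym_id)

lemma std_rep_vbar:
  assumes "\<sigma> \<in> Sym d" "i \<in> {1..d}" "j \<in> {1..d}" "i \<noteq> j"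
  shows "std_rep d \<sigma> (vbar d {i, j}) = vbar d {\<sigma> i, \<sigma> j}"
proof -
  have b: "bij \<sigma>" using assms by (auto simp: Sym_def permutes_bij)
  have "indicator_vec {i, j} \<circ> inv_into UNIV \<sigma> = indicator_vec {\<sigma> i, \<sigma> j}"
    using b by (auto simp: indicator_vec_def fun_eq_iff) (metis bij_inv_eq_iff)+
  then show ?thesis using assms indicator_vec_W0[of "{i, j}" d] by (simp add: vbar_eq std_rep_cls)
qed

context symmetric_reduction
begin

text \<open>A common index set of odd size for both parities: all of \<open>{1..d}\<close> for odd
  \<open>d\<close>, and \<open>{1..d}\<close> without \<open>d\<close> for even \<open>d\<close>.
  The odd size makes complements of single points even.\<close>

definition idx :: "nat set" where
  "idx = {1..2 * g + 1}"

lemma finite_idx [simp]: "finite idx"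
  and card_idx: "card idx = 2 * g + 1"
  by (simp_all add: idx_def)

lemma d_cases:
  obtains (odd) "odd d" "d = 2 * g + 1" "{1..d} = idx"
    | (even) "even d" "d = 2 * g + 2" "{1..d} = insert d idx" "d \<notin> idx" "6 \<le> d"
proof (cases "odd d")
  case True
  then have "d = 2 * g + 1" using g_eq d_ge_3 by (auto elim!: oddE)
  then show ?thesis using True odd by (simp add: idx_def)
next
  case False
  then obtain m where "d = 2 * m" by auto
  then have "d = 2 * g + 2" "6 \<le> d" using g_eq d_ge_3 d_neq_4 by auto
  moreover from this(1) have "{1..d} = insert d idx" "d \<notin> idx" by (auto simp: idx_def)
  ultimately show ?thesis using False even by simp
qed

lemma idx_subset: "idx \<subseteq> {1..d}"
  using d_cases by blast

lemma idx_d: "i \<in> idx \<Longrightarrow> i \<in> {1..d}"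
  using idx_subset by blast

definition evens :: "(nat \<Rightarrow> bit) set" where
  "evens = {w. (\<forall>i. i \<notin> idx \<longrightarrow> w i = 0) \<and> sum w idx = 0}"

lemma evens_W0: "w \<in> evens \<Longrightarrow> w \<in> carrier (W0 d)"
  by (cases rule: d_cases) (auto simp: evens_def W0_carrier_iff)

lemma sum_d_evens: "w \<in> evens \<Longrightarrow> (\<Sum>i\<in>{1..d}. w i * u i) = (\<Sum>i\<in>idx. w i * u i)"
  by (cases rule: d_cases) (auto simp: evens_def)

lemma evens_add: "w \<in> evens \<Longrightarrow> w' \<in> evens \<Longrightarrow> (\<lambda>i. w i + w' i) \<in> evens"
  by (simp add: evens_def sum.distrib)

lemma cls_evens_inj:
  assumes "w \<in> evens" "w' \<in> evens" "cls d w = cls d w'"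
  shows "w = w'"
proof (cases rule: d_cases)
  case odd
  then show ?thesis using assms by (simp add: cls_odd)
next
  case even
  have "w d = 0" "w' d = 0" using assms even by (simp_all add: evens_def)
  moreover have "indicator_vec {1..d} d = 1" using even by (simp add: indicator_vec_def)
  \<comment> \<open>The second representative of the class is shifted by the all-ones vector and so
    has coordinate 1 at \<open>d\<close>, where vectors of \<open>evens\<close> vanish.\<close>
  ultimately have "w \<noteq> (\<lambda>i. indicator_vec {1..d} i + w' i)" by (metis add.right_neutral zero_neq_one)
  moreover have "w \<in> cls d w'" using assms even by (metis cls_even insertI1)
  ultimately show ?thesis using even by (simp add: cls_even)
qed

lemma W0_evens: "w \<in> carrier (W0 d) \<Longrightarrow> {1..d} = insert d idx \<Longrightarrow> d \<notin> idx \<Longrightarrow> w d = 0 \<Longrightarrow> w \<in> evens"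
  unfolding W0_carrier_iff evens_def by (auto simp del: atLeastAtMost_iff)

lemma Vbar_evens: "X \<in> carrier (Vbar d) \<Longrightarrow> \<exists>w\<in>evens. X = cls d w"
proof -
  assume "X \<in> carrier (Vbar d)"
  then obtain w where w: "w \<in> carrier (W0 d)" "X = cls d w" by (auto simp: carrier_Vbar)
  show ?thesis
  proof (cases rule: d_cases)
    case odd
    then have "w \<in> evens" using w by (simp add: W0_carrier_iff evens_def)
    then show ?thesis using w by blast
  next
    case even
    show ?thesis
    proof (cases "w d = 0")
      case True
      have "w \<in> evens" by (rule W0_evens[OF w(1) even(3,4) True])
      then show ?thesis using w by blast
    next
      case False
      \<comment> \<open>Adding the all-ones vector stays in the class and clears the coordinate at
        \<open>d\<close>.\<close>
      let ?w = "\<lambda>i. indicator_vec {1..d} i + w i"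
      have W: "?w \<in> carrier (W0 d)"
        using subgroup.m_closed[OF group.subgroup_self[OF comm_group.axioms(2)[OF comm_group_W0]]
            indicator_vec_W0[of "{1..d}" d] w(1)] even(1)
        by (simp add: mult_W0)
      have d: "?w d = 0" using False even by (simp add: indicator_vec_def)
      have "?w \<in> evens" by (rule W0_evens[OF W even(3,4) d])
      moreover have "cls d ?w = cls d w" using even by (auto simp: cls_even)
      ultimately show ?thesis using w by blast
    qed
  qed
qed

text \<open>For even \<open>d\<close> the representative that vanishes at \<open>d\<close> is chosen, so that the coordinates are indexed by \<open>idx\<close>.\<close>

definition crd :: "'v \<Rightarrow> nat \<Rightarrow> bit" where
  "crd x = (THE w. w \<in> evens \<and> red x = cls d w)"

lemma red_carrier: "red x \<in> carrier (Vbar d)"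
  using red_surj by blast

lemma crd_unique: "w \<in> evens \<Longrightarrow> red x = cls d w \<Longrightarrow> crd x = w"
  unfolding crd_def by (rule the_equality) (auto intro: cls_evens_inj)

lemma crd_evens: "crd x \<in> evens" and red_crd: "red x = cls d (crd x)"
  using Vbar_evens[OF red_carrier, of x] crd_unique by auto

lemma red_eq_iff_crd: "red x = red y \<longleftrightarrow> crd x = crd y"
  using crd_unique[OF crd_evens] red_crd by metis

lemma crd_W0: "crd x \<in> carrier (W0 d)"
  by (rule evens_W0[OF crd_evens])

lemma red_add: "red (x + y) = red x \<otimes>\<^bsub>Vbar d\<^esub> red y"
  using hom_mult[OF red_hom, of x y] by (simp add: additive_group_def)

lemma crd_add: "crd (x + y) = (\<lambda>i. crd x i + crd y i)"
  by (rule crd_unique[OF evens_add[OF crd_evens crd_evens]])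
    (simp add: red_add mult_Vbar[OF crd_W0 crd_W0, symmetric] flip: red_crd)

lemma crd_surj: "w \<in> evens \<Longrightarrow> \<exists>x. crd x = w"
proof -
  assume w: "w \<in> evens"
  then have "cls d w \<in> range red" unfolding red_surj carrier_Vbar by (intro imageI evens_W0)
  then show ?thesis using crd_unique[OF w] by force
qed

lemma crd_0 [simp]: "crd 0 = (\<lambda>_. 0)"
  using crd_add[of 0 0] by (metis add.left_neutral bit_add_self)

lemma crd_minus [simp]: "crd (- x) = crd x"
proof
  fix i
  have "crd (- x + x) i = 0" by simp
  then show "crd (- x) i = crd x i" unfolding crd_add by (simp add: bit_add_eq_0_iff)
qed

lemma crd_diff: "crd (x - y) = (\<lambda>i. crd x i + crd y i)"
  using crd_add[of x "- y"] by simp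

lemma red_eq_iff: "red x = red y \<longleftrightarrow> res 1 x = res 1 y"
proof -
  have "red x = red y \<longleftrightarrow> crd (x - y) = (\<lambda>_. 0)"
    by (simp add: red_eq_iff_crd crd_diff fun_eq_iff bit_add_eq_0_iff)
  also have "\<dots> \<longleftrightarrow> red (x - y) = \<one>\<^bsub>Vbar d\<^esub>"
    using crd_unique[of "\<lambda>_. 0" "x - y"] red_crd[of "x - y"] by (auto simp: evens_def one_Vbar)
  also have "\<dots> \<longleftrightarrow> x - y \<in> range (scale 2)"
    using red_kernel by (auto simp: kernel_def additive_group_def)
  finally show ?thesis by (simp add: res_eq_iff)
qed

lemma crd_eq_iff: "crd x = crd y \<longleftrightarrow> res 1 x = res 1 y"
  using red_eq_iff red_eq_iff_crd by simp

lemma par_form: "par (form x y) = (\<Sum>i\<in>idx. crd x i * crd y i)"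
  using red_form[of x y]
  by (simp add: red_crd[of x] red_crd[of y] Vbar_form_cls[OF crd_W0 crd_W0] sum_d_evens[OF crd_evens] par_def)

lemma crd_outside: "i \<notin> idx \<Longrightarrow> crd x i = 0"
  and sum_crd: "sum (crd x) idx = 0"
  using crd_evens[of x] by (simp_all add: evens_def)

lemma indicator_evens: "J \<subseteq> idx \<Longrightarrow> even (card J) \<Longrightarrow> indicator_vec J \<in> evens"
  using sum_indicator_vec[of idx J]
  by (auto simp: evens_def of_nat_bit_eq_0_iff) (auto simp: indicator_vec_def)

lemma crd_a: "i \<in> idx \<Longrightarrow> j \<in> idx \<Longrightarrow> i \<noteq> j \<Longrightarrow> crd (a i j) = indicator_vec {i, j}"
  by (rule crd_unique[OF indicator_evens]) (simp_all add: red_a[OF idx_d idx_d] vbar_eq)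

lemma sum_indicator_restrict:
  fixes u :: "nat \<Rightarrow> bit"
  assumes "J \<subseteq> idx"
  shows "(\<Sum>k\<in>idx. u k * indicator_vec J k) = sum u J"
proof -
  have "(\<Sum>k\<in>idx. u k * indicator_vec J k) = (\<Sum>k\<in>idx. if k \<in> J then u k else 0)"
    by (rule sum.cong) (simp_all add: indicator_vec_def)
  also have "\<dots> = sum u (idx \<inter> J)" by (rule sum.inter_restrict[symmetric]) simp
  also have "idx \<inter> J = J" using assms by blast
  finally show ?thesis .
qed

lemma par_form_a: "i \<in> idx \<Longrightarrow> j \<in> idx \<Longrightarrow> i \<noteq> j \<Longrightarrow> par (form x (a i j)) = crd x i + crd x j"
proof -
  assume *: "i \<in> idx" "j \<in> idx" "i \<noteq> j"
  then show ?thesis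
    unfolding par_form crd_a[OF *] by (subst sum_indicator_restrict) auto
qed

text \<open>
  The vectors \<open>dual i\<close> add up to \<open>0\<close> modulo \<open>2\<close>. They represent the coordinates, and as the coordinates
  of a vector add up to \<open>0\<close>, also \<open>x = (\<Sum>i. x\<^sub>i dual i)\<close> modulo \<open>2\<close>.
\<close>

definition dual :: "nat \<Rightarrow> 'v" where
  "dual i = (SOME x. crd x = indicator_vec (idx - {i}))"

lemma crd_dual: "i \<in> idx \<Longrightarrow> crd (dual i) = indicator_vec (idx - {i})"
  unfolding dual_def by (rule someI_ex, rule crd_surj, rule indicator_evens) (simp_all add: card_idx)

lemma par_form_dual:
  assumes "i \<in> idx"
  shows "par (form x (dual i)) = crd x i"
proof -
  have "par (form x (dual i)) = (\<Sum>k\<in>idx - {i}. crd x k)"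
    unfolding par_form crd_dual[OF assms] by (rule sum_indicator_restrict) auto
  moreover have "crd x i + (\<Sum>k\<in>idx - {i}. crd x k) = 0"
    using sum_crd[of x] assms by (simp add: sum.remove)
  ultimately show ?thesis by (simp add: bit_add_eq_0_iff add.commute)
qed

text \<open>Nondegeneracy modulo 2: pairing with \<open>dual i\<close> recovers the coordinate
  \<open>i\<close>.\<close>

lemma crd_cong_iff_form: "crd x = crd y \<longleftrightarrow> (\<forall>z. par (form x z) = par (form y z))"
proof
  assume *: "\<forall>z. par (form x z) = par (form y z)"
  show "crd x = crd y"
  proof
    fix i
    show "crd x i = crd y i"
      using *[rule_format, of "dual i"] by (cases "i \<in> idx") (simp_all add: par_form_dual crd_outside)
  qed
qed (simp add: par_form)

lemma res_1_iff_form: "res 1 x = res 1 y \<longleftrightarrow> (\<forall>z. par (form x z) = par (form y z))"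
  by (simp flip: crd_eq_iff add: crd_cong_iff_form)

text \<open>Nondegeneracy modulo 4, obtained by applying nondegeneracy modulo 2 twice: first to get
  \<open>x = y + 2 u\<close>, then to see that \<open>u\<close> is itself divisible by 2.\<close>

lemma res_2_iff_form: "res 2 x = res 2 y \<longleftrightarrow> (\<forall>z. 4 dvd form x z - form y z)"
proof
  assume "res 2 x = res 2 y"
  then obtain z where "x = y + scale 4 z" by (auto simp: res_eq_iff algebra_simps)
  then show "\<forall>z. 4 dvd form x z - form y z" by (simp add: form_simps)
next
  assume *: "\<forall>z. 4 dvd form x z - form y z"
  have "2 dvd form x z - form y z" for z
    using *[rule_format, of z] by (rule dvd_trans[rotated]) (rule dvdI[of _ _ 2], simp)
  then have "res 1 x = res 1 y"
    by (simp add: res_1_iff_form two_dvd_iff_par par_diff bit_add_eq_0_iff)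
  then obtain u where u: "x = y + scale 2 u" by (auto simp: res_eq_iff algebra_simps)
  then have "par (form u z) = par (form 0 z)" for z
    using *[rule_format, of z] by (simp add: form_simps two_adic_4_dvd_2_mult)
  then have "res 1 u = res 1 0" by (simp add: res_1_iff_form)
  then obtain v where "u = scale 2 v" by (auto simp: res_eq_iff)
  then show "res 2 x = res 2 y" using u by (simp add: res_eq_iff)
qed

lemma res_2_scale_2_iff: "res 2 (x + scale 2 u) = res 2 (x + scale 2 v) \<longleftrightarrow> res 1 u = res 1 v"
proof -
  have "form (x + scale 2 u) z - form (x + scale 2 v) z = 2 * (form u z - form v z)" for z
    by (simp add: form_simps algebra_simps)
  then show ?thesis
    by (simp only: res_2_iff_form res_1_iff_form two_adic_4_dvd_2_mult par_diff bit_add_eq_0_iff)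
qed

section \<open>Elements of the symplectic group modulo 4 lying over a permutation\<close>

lemma std_rep_V_res: "\<sigma> \<in> Sym d \<Longrightarrow> std_rep_V \<sigma> (res 1 x) = {y. red y = std_rep d \<sigma> (red x)}"
  unfolding std_rep_V_def by (auto simp: mem_res_iff simp flip: red_eq_iff)

lemma std_rep_V_eq_iff:
  assumes "\<sigma> \<in> Sym d" "F \<in> extensional (carrier (Vquot 1))" "\<And>x. F (res 1 x) = res 1 (f x)"
  shows "F = std_rep_V \<sigma> \<longleftrightarrow> (\<forall>x. red (f x) = std_rep d \<sigma> (red x))"
proof
  assume F: "F = std_rep_V \<sigma>"
  show "\<forall>x. red (f x) = std_rep d \<sigma> (red x)"
  proof
    fix x
    have "f x \<in> F (res 1 x)" by (simp add: assms(3))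
    then show "red (f x) = std_rep d \<sigma> (red x)" by (simp add: F std_rep_V_res[OF assms(1)])
  qed
next
  assume *: "\<forall>x. red (f x) = std_rep d \<sigma> (red x)"
  show "F = std_rep_V \<sigma>"
  proof (rule extensionalityI[OF assms(2)])
    show "std_rep_V \<sigma> \<in> extensional (carrier (Vquot 1))" by (simp add: std_rep_V_def)
    fix X assume "X \<in> carrier (Vquot 1)"
    then obtain x where "X = res 1 x" by (auto simp: carrier_Vquot)
    moreover have "y \<in> res 1 (f x) \<longleftrightarrow> red y = red (f x)" for y by (simp add: mem_res_iff red_eq_iff)
    ultimately show "F X = std_rep_V \<sigma> X" using * assms(3) by (auto simp: std_rep_V_res[OF assms(1)])
  qed
qed

text \<open>Reduction modulo 2, phrased as a relation to the permutation itself and tested on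
  vectors. Products and inverses of lifts then follow the composition of permutations
  directly.\<close>

definition over :: "('v set \<Rightarrow> 'v set) \<Rightarrow> (nat \<Rightarrow> nat) \<Rightarrow> bool" where
  "over k \<sigma> \<longleftrightarrow> k \<in> carrier (SpQ 2) \<and> \<sigma> \<in> Sym d \<and> (\<forall>x. red (ap k x) = std_rep d \<sigma> (red x))"

lemma over_iff_reduce_quot:
  "k \<in> carrier (SpQ 2) \<Longrightarrow> \<sigma> \<in> Sym d \<Longrightarrow> over k \<sigma> \<longleftrightarrow> reduce_quot 2 1 k = std_rep_V \<sigma>"
  unfolding over_def
  by (subst std_rep_V_eq_iff[where f = "ap k"]) (simp_all add: reduce_quot_res, simp add: reduce_quot_def)

lemma reduce_eq_std_rep_V_iff:
  "f \<in> carrier SpV \<Longrightarrow> \<sigma> \<in> Sym d \<Longrightarrow>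
    reduce 1 f = std_rep_V \<sigma> \<longleftrightarrow> (\<forall>x. red (f x) = std_rep d \<sigma> (red x))"
  by (rule std_rep_V_eq_iff) (simp_all add: reduce_res, simp add: reduce_def)

lemma over_reduce_iff:
  assumes "f \<in> carrier SpV" "\<sigma> \<in> Sym d"
  shows "over (reduce 2 f) \<sigma> \<longleftrightarrow> reduce 1 f = std_rep_V \<sigma>"
proof -
  have "red (ap (reduce 2 f) x) = red (f x)" for x
    using res_1_if_res_2[OF ap_reduce[OF assms(1)]] by (simp add: red_eq_iff)
  then show ?thesis using assms by (simp add: over_def reduce_SpQ reduce_eq_std_rep_V_iff)
qed

lemma Sym_preimage_eq: "Sym_preimage = {k. \<exists>\<sigma>. over k \<sigma>}"
proof (intro equalityI subsetI)
  fix k assume "k \<in> Sym_preimage"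
  then show "k \<in> {k. \<exists>\<sigma>. over k \<sigma>}"
    using over_iff_reduce_quot by (auto simp: Sym_preimage_def Sym_image_def)
next
  fix k assume "k \<in> {k. \<exists>\<sigma>. over k \<sigma>}"
  then obtain \<sigma> where *: "over k \<sigma>" by blast
  then have "k \<in> carrier (SpQ 2)" "\<sigma> \<in> Sym d" by (auto simp: over_def)
  then show "k \<in> Sym_preimage"
    using * over_iff_reduce_quot by (auto simp: Sym_preimage_def Sym_image_def)
qed

lemma over_mult:
  assumes "over k \<sigma>" "over l \<tau>"
  shows "over (k \<otimes>\<^bsub>SpQ 2\<^esub> l) (\<sigma> \<circ> \<tau>)"
proof -
  have k: "k \<in> carrier (SpQ 2)" "l \<in> carrier (SpQ 2)" "\<sigma> \<in> Sym d" "\<tau> \<in> Sym d"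
    using assms by (auto simp: over_def)
  have "red (ap (k \<otimes>\<^bsub>SpQ 2\<^esub> l) x) = red (ap k (ap l x))" for x
    using res_1_if_res_2[OF ap_mult[OF k(1,2)]] by (simp add: red_eq_iff)
  then show ?thesis
    using assms k group.is_monoid[OF group_SpQ, THEN monoid.m_closed, of k 2 l]
    by (simp add: over_def Sym_comp std_rep_comp red_carrier)
qed

lemma over_one: "over \<one>\<^bsub>SpQ 2\<^esub> id"
proof -
  have "red (ap \<one>\<^bsub>SpQ 2\<^esub> x) = red x" for x
    using res_1_if_res_2[OF ap_one] by (simp add: red_eq_iff)
  then show ?thesis
    using group.is_monoid[OF group_SpQ, THEN monoid.one_closed]
    by (simp add: over_def Sym_id std_rep_id red_carrier)
qed

lemma over_inv:
  assumes "over k \<sigma>"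
  shows "over (inv\<^bsub>SpQ 2\<^esub> k) (inv_into UNIV \<sigma>)"
proof -
  have k: "k \<in> carrier (SpQ 2)" "\<sigma> \<in> Sym d" using assms by (auto simp: over_def)
  have "red (ap (inv\<^bsub>SpQ 2\<^esub> k) x) = std_rep d (inv_into UNIV \<sigma>) (red x)" for x
  proof -
    let ?y = "ap (inv\<^bsub>SpQ 2\<^esub> k) x"
    have "red x = std_rep d \<sigma> (red ?y)"
      using assms res_1_if_res_2[OF ap_inv(2)[OF k(1)], of x] by (metis over_def red_eq_iff)
    moreover have "inv_into UNIV \<sigma> \<circ> \<sigma> = id"
      using k(2) by (simp add: Sym_def permutes_inv_o)
    ultimately show ?thesis
      using std_rep_comp[OF Sym_inv[OF k(2)] k(2) red_carrier, of ?y]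
      by (simp add: std_rep_id red_carrier)
  qed
  then show ?thesis using k by (simp add: over_def Sym_inv group.inv_closed[OF group_SpQ])
qed

end

section \<open>The kernel of reduction modulo 2\<close>

context symmetric_reduction
begin

abbreviation mult_mod_4 (infixl \<open>\<star>\<close> 70) where
  "x \<star> y \<equiv> x \<otimes>\<^bsub>SpQ 2\<^esub> y"

interpretation P: group "SpQ 2" by (rule group_SpQ)

section \<open>Linear forms on the lattice modulo 2\<close>

lemma crd_sum: "crd (sum f A) = (\<lambda>i. \<Sum>x\<in>A. crd (f x) i)"
  by (induction A rule: infinite_finite_induct) (simp_all add: crd_add)

definition linear_mod_2 :: "('v \<Rightarrow> bit) \<Rightarrow> bool" where
  "linear_mod_2 u \<longleftrightarrow> (\<forall>x y. u (x + y) = u x + u y) \<and> (\<forall>x y. crd x = crd y \<longrightarrow> u x = u y)"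

lemma linear_mod_2_add: "linear_mod_2 u \<Longrightarrow> u (x + y) = u x + u y"
  and linear_mod_2_cong: "linear_mod_2 u \<Longrightarrow> crd x = crd y \<Longrightarrow> u x = u y"
  unfolding linear_mod_2_def by blast+

lemma linear_mod_2_0: "linear_mod_2 u \<Longrightarrow> u 0 = 0"
  using linear_mod_2_add[of u 0 0] by simp

lemma linear_mod_2_sum: "linear_mod_2 u \<Longrightarrow> u (sum f A) = (\<Sum>x\<in>A. u (f x))"
  by (induction A rule: infinite_finite_induct) (simp_all add: linear_mod_2_0 linear_mod_2_add)

lemma linear_mod_2_plus: "linear_mod_2 u \<Longrightarrow> linear_mod_2 v \<Longrightarrow> linear_mod_2 (\<lambda>x. u x + v x)"
proof -
  assume u: "linear_mod_2 u" and v: "linear_mod_2 v"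
  show ?thesis
    unfolding linear_mod_2_def
  proof (intro conjI allI impI)
    show "u (x + y) + v (x + y) = u x + v x + (u y + v y)" for x y
      by (simp add: linear_mod_2_add[OF u] linear_mod_2_add[OF v] ac_simps)
    show "u x + v x = u y + v y" if "crd x = crd y" for x y
      by (simp only: linear_mod_2_cong[OF u that] linear_mod_2_cong[OF v that])
  qed
qed

lemma linear_mod_2_form: "linear_mod_2 (\<lambda>x. par (form x y))"
  unfolding linear_mod_2_def by (simp add: form_add_left par_add) (simp add: par_form)

lemma par_form_commute: "par (form x y) = par (form y x)"
  unfolding form_swap[of x y] by (rule par_uminus)

lemma crd_dual_expand:
  "crd x = crd (\<Sum>i\<in>idx. if crd x i = 1 then dual i else 0)"
proof
  fix k
  show "crd x k = crd (\<Sum>i\<in>idx. if crd x i = 1 then dual i else 0) k"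
  proof (cases "k \<in> idx")
    case True
    have "crd (\<Sum>i\<in>idx. if crd x i = 1 then dual i else 0) k
      = (\<Sum>i\<in>idx. crd x i * indicator_vec (idx - {k}) i)"
      unfolding crd_sum using True by (intro sum.cong) (auto simp: crd_dual indicator_vec_def)
    also have "\<dots> = sum (crd x) (idx - {k})" by (rule sum_indicator_restrict) auto
    finally have *: "crd (\<Sum>i\<in>idx. if crd x i = 1 then dual i else 0) k = sum (crd x) (idx - {k})" .
    have "sum (crd x) idx = crd x k + sum (crd x) (idx - {k})"
      using True by (intro sum.remove) simp_all
    then have "crd x k + sum (crd x) (idx - {k}) = 0" by (simp only: sum_crd)
    then show ?thesis unfolding * by (simp only: bit_add_eq_0_iff)
  qed (simp add: crd_outside)
qed

lemma linear_mod_2_dual: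
  assumes "linear_mod_2 u"
  shows "u x = (\<Sum>i\<in>idx. crd x i * u (dual i))"
proof -
  have "u x = (\<Sum>i\<in>idx. u (if crd x i = 1 then dual i else 0))"
    by (subst linear_mod_2_cong[OF assms crd_dual_expand]) (rule linear_mod_2_sum[OF assms])
  then show ?thesis
    by (simp add: linear_mod_2_0[OF assms] if_distrib cong: if_cong)
      (rule sum.cong, auto)
qed

text \<open>The vectors \<open>a 1 j\<close> span modulo 2: the coefficients are the coordinates
  other than the first, and the first is then right because the coordinates of a vector add up to
  0.\<close>

lemma crd_a_expand:
  "crd x = crd (\<Sum>j\<in>idx - {1}. if crd x j = 1 then a 1 j else 0)"
proof
  fix k
  let ?y = "\<Sum>j\<in>idx - {1}. if crd x j = 1 then a 1 j else 0"
  have 1: "1 \<in> idx" by (simp add: idx_def)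
  have a: "crd (if crd x j = 1 then a 1 j else 0) k = (if k = j then crd x j else if k = 1 then crd x j else 0)"
    if "j \<in> idx - {1}" for j
    using that crd_a[OF 1, of j] by (auto simp: indicator_vec_def)
  have *: "crd ?y k = (\<Sum>j\<in>idx - {1}. if k = j then crd x j else if k = 1 then crd x j else 0)"
    unfolding crd_sum by (rule sum.cong) (simp_all add: a)
  show "crd x k = crd ?y k"
  proof (cases "k = 1")
    case True
    have "sum (crd x) idx = crd x 1 + sum (crd x) (idx - {1})"
      using 1 by (intro sum.remove) simp_all
    then have "crd x 1 + sum (crd x) (idx - {1}) = 0" by (simp only: sum_crd)
    then show ?thesis using * True by (simp add: bit_add_eq_0_iff)
  next
    case False
    then have "crd ?y k = (\<Sum>j\<in>idx - {1}. if k = j then crd x j else 0)"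
      unfolding * by (intro sum.cong) simp_all
    also have "\<dots> = crd x k" using False by (simp add: sum.delta crd_outside)
    finally show ?thesis ..
  qed
qed

lemma linear_mod_2_eqI:
  assumes "linear_mod_2 u" "linear_mod_2 v" "\<And>j. j \<in> idx - {1} \<Longrightarrow> u (a 1 j) = v (a 1 j)"
  shows "u = v"
proof
  fix x
  have "u (\<Sum>j\<in>idx - {1}. if crd x j = 1 then a 1 j else 0) = v (\<Sum>j\<in>idx - {1}. if crd x j = 1 then a 1 j else 0)"
    unfolding linear_mod_2_sum[OF assms(1)] linear_mod_2_sum[OF assms(2)]
    by (rule sum.cong) (simp_all add: assms(3) linear_mod_2_0[OF assms(1)] linear_mod_2_0[OF assms(2)])
  then show "u x = v x"
    using linear_mod_2_cong[OF assms(1) crd_a_expand] linear_mod_2_cong[OF assms(2) crd_a_expand] by metis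
qed

lemma ap_scale_2: "k \<in> carrier (SpQ 2) \<Longrightarrow> res 2 (ap k (scale 2 z)) = res 2 (scale 2 (ap k z))"
  using ap_add[of k z z] by (simp add: scale_2)

lemma ap_add_scale_2:
  assumes "k \<in> carrier (SpQ 2)"
  shows "res 2 (ap k (x + scale 2 z)) = res 2 (ap k x + scale 2 (ap k z))"
  using ap_add[OF assms, of x "scale 2 z"] res_add_cong[OF refl ap_scale_2[OF assms], of "ap k x" z]
  by (rule trans)

lemma par_form_ap: "k \<in> carrier (SpQ 2) \<Longrightarrow> par (form (ap k x) (ap k y)) = par (form x y)"
proof -
  assume "k \<in> carrier (SpQ 2)"
  then have "4 dvd form (ap k x) (ap k y) - form x y" by (rule ap_form)
  then obtain t where "form (ap k x) (ap k y) - form x y = 4 * t" ..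
  then have "form (ap k x) (ap k y) - form x y = 2 * (2 * t)" by simp
  then have "par (form (ap k x) (ap k y) - form x y) = 0" by (simp only: par_mult par_2 mult_zero_left)
  then show ?thesis by (simp only: par_diff bit_add_eq_0_iff)
qed

section \<open>The bilinear form of an element of the kernel\<close>

lemma over_SpQ: "over k \<sigma> \<Longrightarrow> k \<in> carrier (SpQ 2)"
  by (simp add: over_def)

lemma over_id_crd: "over k id \<Longrightarrow> crd (ap k x) = crd x"
  by (simp add: over_def std_rep_id red_carrier flip: red_eq_iff_crd)

definition eta :: "('v set \<Rightarrow> 'v set) \<Rightarrow> 'v \<Rightarrow> 'v" where
  "eta k x = (SOME z. res 2 (ap k x) = res 2 (x + scale 2 z))"

lemma res_eta:
  assumes "over k id"
  shows "res 2 (ap k x) = res 2 (x + scale 2 (eta k x))"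
  unfolding eta_def
proof (rule someI_ex)
  have "res 1 (ap k x) = res 1 x" using over_id_crd[OF assms] by (simp add: crd_eq_iff)
  then obtain z where "ap k x = x + scale 2 z" by (auto simp: res_eq_iff algebra_simps)
  then show "\<exists>z. res 2 (ap k x) = res 2 (x + scale 2 z)" by auto
qed

text \<open>If \<open>k\<close> acts as \<open>1 + 2 X\<close>, then \<open>eta k x\<close> is \<open>X x\<close> modulo \<open>2\<close>.\<close>

definition kform :: "('v set \<Rightarrow> 'v set) \<Rightarrow> 'v \<Rightarrow> 'v \<Rightarrow> bit" where
  "kform k x y = par (form (eta k x) y)"

lemma kform_eqI:
  assumes "over k id" "res 2 (ap k x) = res 2 (x + scale 2 z)"
  shows "kform k x y = par (form z y)"
proof -
  have "res 2 (x + scale 2 (eta k x)) = res 2 (x + scale 2 z)" using res_eta[OF assms(1)] assms(2) by simp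
  then have "res 1 (eta k x) = res 1 z" by (simp only: res_2_scale_2_iff)
  then show ?thesis by (simp add: kform_def res_1_iff_form)
qed

lemma kform_add_right: "kform k x (y + z) = kform k x y + kform k x z"
  by (simp add: kform_def form_add_right par_add)

lemma kform_add_left:
  assumes k: "over k id"
  shows "kform k (x + y) z = kform k x z + kform k y z"
proof -
  have "res 2 (ap k (x + y)) = res 2 (ap k x + ap k y)" by (rule ap_add[OF over_SpQ[OF k]])
  also have "\<dots> = res 2 ((x + scale 2 (eta k x)) + (y + scale 2 (eta k y)))"
    by (intro res_add_cong res_eta k)
  also have "(x + scale 2 (eta k x)) + (y + scale 2 (eta k y)) = (x + y) + scale 2 (eta k x + eta k y)"
    by (simp add: scale_right_distrib algebra_simps)
  finally show ?thesis
    using kform_eqI[OF k] by (simp add: kform_def form_add_left par_add)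
qed

text \<open>The infinitesimal form of being symplectic: for 1 + 2X the value <x,y> changes by
  2(<Xx,y> + <x,Xy>) modulo 4, so this sum is even, and signs do not matter modulo 2.\<close>

lemma kform_sym:
  assumes k: "over k id"
  shows "kform k x y = kform k y x"
proof -
  let ?x = "x + scale 2 (eta k x)" and ?y = "y + scale 2 (eta k y)"
  have 1: "4 dvd form (ap k x) (ap k y) - form ?x (ap k y)"
    using res_eta[OF k, of x] unfolding res_2_iff_form by blast
  have 2: "4 dvd form (ap k y) ?x - form ?y ?x"
    using res_eta[OF k, of y] unfolding res_2_iff_form by blast
  \<comment> \<open>The two arguments are replaced by their expansions one at a time.
    \<open>form_swap\<close> brings the second one to the left slot, the one to which
    \<open>res_2_iff_form\<close> applies.\<close>
  have "form ?x ?y - form x y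
    = (form (ap k x) (ap k y) - form x y) - (form (ap k x) (ap k y) - form ?x (ap k y)) + (form (ap k y) ?x - form ?y ?x)"
    using form_swap[of ?x ?y] form_swap[of ?x "ap k y"] by simp
  then have "4 dvd form ?x ?y - form x y"
    using 1 2 ap_form[OF over_SpQ[OF k], of x y] by (metis dvd_add dvd_diff)
  moreover have "form ?x ?y - form x y = 2 * (form (eta k x) y + form x (eta k y) + 2 * form (eta k x) (eta k y))"
    by (simp add: form_simps algebra_simps)
  ultimately have "par (form (eta k x) y + form x (eta k y) + 2 * form (eta k x) (eta k y)) = 0"
    by (simp only: two_adic_4_dvd_2_mult)
  then show ?thesis
    using par_form_commute[of x] by (simp add: kform_def par_add par_mult[of 2] bit_add_eq_0_iff)
qed

lemma linear_mod_2_kform_right: "linear_mod_2 (kform k x)"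
  unfolding kform_def linear_mod_2_def by (simp add: form_add_right par_add) (simp add: par_form)

lemma linear_mod_2_kform_left:
  assumes "over k id"
  shows "linear_mod_2 (\<lambda>x. kform k x y)"
proof -
  have "(\<lambda>x. kform k x y) = kform k y" using kform_sym[OF assms] by (rule ext)
  then show ?thesis using linear_mod_2_kform_right by simp
qed

lemma over_id_eqI_kform:
  assumes k: "over k id" and l: "over l id" and eq: "\<And>x y. kform k x y = kform l x y"
  shows "k = l"
proof (rule SpQ_eqI[OF over_SpQ[OF k] over_SpQ[OF l]])
  fix x
  have "res 1 (eta k x) = res 1 (eta l x)" using eq by (simp add: res_1_iff_form kform_def)
  then show "res 2 (ap k x) = res 2 (ap l x)"
    unfolding res_eta[OF k] res_eta[OF l] res_2_scale_2_iff .
qed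

text \<open>Off-diagonal values suffice since \<open>dual i\<close> is modulo 2 the sum of the other
  dual vectors, which turns a diagonal value into a sum of off-diagonal ones.\<close>

lemma over_id_eqI:
  assumes k: "over k id" and l: "over l id"
    and eq: "\<And>i j. i \<in> idx \<Longrightarrow> j \<in> idx \<Longrightarrow> i \<noteq> j \<Longrightarrow> kform k (dual i) (dual j) = kform l (dual i) (dual j)"
  shows "k = l"
proof (rule over_id_eqI_kform[OF k l])
  have *: "kform m (dual i) (dual i) = (\<Sum>j\<in>idx - {i}. kform m (dual i) (dual j))"
    if "i \<in> idx" for m i
  proof -
    have "kform m (dual i) (dual i) = (\<Sum>j\<in>idx. kform m (dual i) (dual j) * indicator_vec (idx - {i}) j)"
      by (subst linear_mod_2_dual[OF linear_mod_2_kform_right]) (simp add: crd_dual[OF that] mult.commute)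
    also have "\<dots> = (\<Sum>j\<in>idx - {i}. kform m (dual i) (dual j))" by (rule sum_indicator_restrict) auto
    finally show ?thesis .
  qed
  have eq': "kform k (dual i) (dual j) = kform l (dual i) (dual j)" if "i \<in> idx" "j \<in> idx" for i j
  proof (cases "i = j")
    case True
    have "(\<Sum>j\<in>idx - {i}. kform k (dual i) (dual j)) = (\<Sum>j\<in>idx - {i}. kform l (dual i) (dual j))"
      using that by (intro sum.cong) (auto intro!: eq)
    then show ?thesis using True *[OF that(1)] by simp
  qed (rule eq[OF that])
  fix x y
  have "kform k (dual i) y = kform l (dual i) y" if "i \<in> idx" for i
    by (subst (1 2) linear_mod_2_dual[OF linear_mod_2_kform_right]) (simp add: eq' that)
  then show "kform k x y = kform l x y"
    by (subst linear_mod_2_dual[OF linear_mod_2_kform_left[OF k]],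
        subst linear_mod_2_dual[OF linear_mod_2_kform_left[OF l]]) simp
qed

lemma over_id_mult: "over k id \<Longrightarrow> over l id \<Longrightarrow> over (k \<star> l) id"
  using over_mult[of k id l id] by simp

lemma over_id_inv: "over k id \<Longrightarrow> over (inv\<^bsub>SpQ 2\<^esub> k) id"
  using over_inv[of k id] by simp

text \<open>This is (1 + 2X)(1 + 2Y) = 1 + 2(X + Y) modulo 4. It makes the kernel commutative and
  identifies it with an additive group of forms.\<close>

lemma kform_mult:
  assumes k: "over k id" and l: "over l id"
  shows "kform (k \<star> l) x y = kform k x y + kform l x y"
proof -
  note K = over_SpQ[OF k] and L = over_SpQ[OF l]
  have "res 2 (ap (k \<star> l) x) = res 2 (ap k (ap l x))" by (rule ap_mult[OF K L])
  also have "\<dots> = res 2 (ap k (x + scale 2 (eta l x)))" by (rule ap_cong[OF K res_eta[OF l]])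
  also have "\<dots> = res 2 (ap k x + scale 2 (ap k (eta l x)))" by (rule ap_add_scale_2[OF K])
  also have "\<dots> = res 2 (x + scale 2 (eta k x) + scale 2 (ap k (eta l x)))"
    by (intro res_add_cong res_eta[OF k] refl)
  also have "x + scale 2 (eta k x) + scale 2 (ap k (eta l x)) = x + scale 2 (eta k x + ap k (eta l x))"
    by (simp add: scale_right_distrib add.assoc)
  finally have "kform (k \<star> l) x y = par (form (eta k x + ap k (eta l x)) y)"
    by (rule kform_eqI[OF over_id_mult[OF k l]])
  \<comment> \<open>\<open>k\<close> is the identity modulo 2, so it may be dropped inside a term
    that is multiplied by 2.\<close>
  moreover have "par (form (ap k (eta l x)) y) = par (form (eta l x) y)"
    by (simp add: par_form over_id_crd[OF k])
  ultimately show ?thesis by (simp add: kform_def form_add_left par_add)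
qed

lemma kform_one: "kform \<one>\<^bsub>SpQ 2\<^esub> x y = 0"
  using kform_eqI[OF over_one, of x 0 y] ap_one[of x] by simp

lemma kform_inv: "over k id \<Longrightarrow> kform (inv\<^bsub>SpQ 2\<^esub> k) x y = kform k x y"
  using kform_mult[OF over_id_inv, of k k x y] kform_one[of x y]
  by (simp add: P.l_inv[OF over_SpQ] bit_add_eq_0_iff)

lemma over_conj: "over h \<sigma> \<Longrightarrow> over k id \<Longrightarrow> over (h \<star> k \<star> inv\<^bsub>SpQ 2\<^esub> h) id"
proof -
  assume h: "over h \<sigma>" and k: "over k id"
  have "over (h \<star> k \<star> inv\<^bsub>SpQ 2\<^esub> h) (\<sigma> \<circ> id \<circ> inv_into UNIV \<sigma>)"
    by (intro over_mult over_inv h k)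
  moreover have "\<sigma> \<circ> inv_into UNIV \<sigma> = id"
    using h permutes_inv_o(1) by (auto simp only: over_def Sym_def mem_Collect_eq)
  ultimately show ?thesis by simp
qed

text \<open>Conjugation turns 1 + 2X into 1 + 2hXh^(-1), and \<open>h\<close> preserves the form;
  hence the bilinear form is merely transported along \<open>h\<close>.\<close>

lemma kform_conj:
  assumes h: "over h \<sigma>" and k: "over k id"
  shows "kform (h \<star> k \<star> inv\<^bsub>SpQ 2\<^esub> h) (ap h x) (ap h y) = kform k x y"
proof -
  note H = over_SpQ[OF h] and K = over_SpQ[OF k]
  have "res 2 (ap (h \<star> k \<star> inv\<^bsub>SpQ 2\<^esub> h) (ap h x))
      = res 2 (ap (h \<star> k) (ap (inv\<^bsub>SpQ 2\<^esub> h) (ap h x)))"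
    by (rule ap_mult) (simp_all add: H K)
  also have "\<dots> = res 2 (ap (h \<star> k) x)" by (rule ap_cong) (simp_all add: H K ap_inv)
  also have "\<dots> = res 2 (ap h (ap k x))" by (rule ap_mult[OF H K])
  also have "\<dots> = res 2 (ap h (x + scale 2 (eta k x)))" by (rule ap_cong[OF H res_eta[OF k]])
  also have "\<dots> = res 2 (ap h x + scale 2 (ap h (eta k x)))" by (rule ap_add_scale_2[OF H])
  finally have "kform (h \<star> k \<star> inv\<^bsub>SpQ 2\<^esub> h) (ap h x) (ap h y)
      = par (form (ap h (eta k x)) (ap h y))"
    by (rule kform_eqI[OF over_conj[OF h k]])
  then show ?thesis by (simp add: par_form_ap[OF H] kform_def)
qed

section \<open>Squares of transvections as elements of the kernel\<close>

lemma over_id_reduceI: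
  assumes f: "f \<in> carrier SpV" and z: "\<And>x. f x = x + scale 2 (z x)"
  shows "over (reduce 2 f) id" "kform (reduce 2 f) x y = par (form (z x) y)"
proof -
  have "res 1 (ap (reduce 2 f) x) = res 1 x" for x
  proof -
    have "res 1 (ap (reduce 2 f) x) = res 1 (f x)" by (rule res_1_if_res_2[OF ap_reduce[OF f]])
    also have "\<dots> = res 1 x" by (simp add: res_eq_iff z)
    finally show ?thesis .
  qed
  then show 1: "over (reduce 2 f) id"
    by (simp add: over_def reduce_SpQ[OF f] Sym_id std_rep_id red_carrier red_eq_iff)
  show "kform (reduce 2 f) x y = par (form (z x) y)"
    by (rule kform_eqI[OF 1]) (simp add: ap_reduce[OF f] z)
qed

lemma transvection_square: "(transvection b \<circ> transvection b) x = x + scale 2 (scale (form x b) b)"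
  by (simp add: transvection_def form_simps form_alternating scale_2 scale_left_distrib del: scale_scale)

lemma over_transvection_square: "over (reduce 2 (transvection b \<circ> transvection b)) id"
  by (rule over_id_reduceI(1)[OF comp_SpV[OF transvection_SpV transvection_SpV] transvection_square])

lemma kform_transvection_square:
  "kform (reduce 2 (transvection b \<circ> transvection b)) x y = par (form x b) * par (form y b)"
  by (simp only: over_id_reduceI(2)[OF comp_SpV[OF transvection_SpV transvection_SpV] transvection_square]
      form_scale_left par_mult par_form_commute[of b y])

lemma std_rep_V_id: "std_rep_V id = \<one>\<^bsub>SpQ 1\<^esub>"
  by (rule sym, subst std_rep_V_eq_iff[where f = id])
    (simp_all add: Sym_id one_SpQ std_rep_id red_carrier)

lemma over_reduce_Gamma: "f \<in> Gamma 1 \<Longrightarrow> over (reduce 2 f) id"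
  by (simp add: Gamma_def kernel_def over_reduce_iff Sym_id std_rep_V_id)

lemma transvection_square_Gamma: "transvection b \<circ> transvection b \<in> Gamma 1"
  using over_transvection_square[of b]
  by (simp add: Gamma_def kernel_def over_reduce_iff Sym_id std_rep_V_id comp_SpV transvection_SpV)

lemma transvection_square_Gamma24: "reduce 2 (transvection b \<circ> transvection b) \<in> carrier Gamma24"
  using transvection_square_Gamma by (simp add: Gamma24_def)

lemma subgroup_Gamma24: "subgroup (carrier Gamma24) (SpQ 2)"
proof -
  have "subgroup (Gamma 1) SpV"
    unfolding Gamma_def by (rule group_hom.subgroup_kernel[OF group_hom_reduce])
  then show ?thesis
    using group_hom.subgroup_img_is_subgroup[OF group_hom_reduce] by (simp add: Gamma24_def)
qed

lemma mult_Gamma24 [simp]: "x \<otimes>\<^bsub>Gamma24\<^esub> y = x \<star> y"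
  and one_Gamma24 [simp]: "\<one>\<^bsub>Gamma24\<^esub> = \<one>\<^bsub>SpQ 2\<^esub>"
  by (simp_all add: Gamma24_def)

lemma Gamma24_over: "k \<in> carrier Gamma24 \<Longrightarrow> over k id"
  using over_reduce_Gamma by (auto simp: Gamma24_def)

lemma group_Gamma24: "group Gamma24"
  using subgroup.subgroup_is_group[OF subgroup_Gamma24 group_SpQ] by (simp add: Gamma24_def)

lemma comm_group_Gamma24: "comm_group Gamma24"
proof (rule group.group_comm_groupI[OF group_Gamma24])
  fix k l assume "k \<in> carrier Gamma24" "l \<in> carrier Gamma24"
  then have *: "over k id" "over l id" by (auto dest: Gamma24_over)
  show "k \<otimes>\<^bsub>Gamma24\<^esub> l = l \<otimes>\<^bsub>Gamma24\<^esub> k"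
    using * by (simp, intro over_id_eqI_kform over_id_mult) (simp_all add: kform_mult add.commute)
qed

interpretation K: comm_group Gamma24 by (rule comm_group_Gamma24)

section \<open>The brackets as a basis of the kernel\<close>

definition pairs :: "(nat \<times> nat) set" where
  "pairs = {(i, j). 1 \<le> i \<and> i < j \<and> j \<le> 2 * g + 1}"

lemma finite_pairs [simp]: "finite pairs"
  by (rule finite_subset[of _ "idx \<times> idx"]) (auto simp: pairs_def idx_def)

lemma mem_pairs_iff: "(i, j) \<in> pairs \<longleftrightarrow> i \<in> idx \<and> j \<in> idx \<and> i < j"
  by (auto simp: pairs_def idx_def)

lemma kform_finprod:
  assumes "finite A" "F \<in> A \<rightarrow> carrier Gamma24"
  shows "kform (finprod Gamma24 F A) x y = (\<Sum>p\<in>A. kform (F p) x y)"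
  using assms
proof (induction A rule: finite_induct)
  case empty
  then show ?case by (simp add: kform_one)
next
  case (insert p A)
  then have "F p \<in> carrier Gamma24" "F \<in> A \<rightarrow> carrier Gamma24" by auto
  then show ?case using insert
    by (simp add: kform_mult Gamma24_over K.finprod_closed)
qed

lemma
  assumes f: "\<And>i j. (i, j) \<in> pairs \<Longrightarrow> f i j \<in> carrier Gamma24"
  shows lin_comb_closed: "lin_comb c f \<in> carrier Gamma24"
    and kform_lin_comb: "kform (lin_comb c f) x y = (\<Sum>(i, j)\<in>pairs. c i j * kform (f i j) x y)"
proof -
  let ?F = "\<lambda>(i, j). if c i j = 1 then f i j else \<one>\<^bsub>Gamma24\<^esub>"
  have F: "?F \<in> pairs \<rightarrow> carrier Gamma24" using f K.one_closed by auto
  then show "lin_comb c f \<in> carrier Gamma24"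
    unfolding lin_comb_def pairs_def[symmetric] by (rule K.finprod_closed)
  have "kform (lin_comb c f) x y = (\<Sum>p\<in>pairs. kform (?F p) x y)"
    unfolding lin_comb_def pairs_def[symmetric] using F by (rule kform_finprod[OF finite_pairs])
  also have "\<dots> = (\<Sum>(i, j)\<in>pairs. c i j * kform (f i j) x y)"
    by (rule sum.cong) (auto simp: kform_one)
  finally show "kform (lin_comb c f) x y = (\<Sum>(i, j)\<in>pairs. c i j * kform (f i j) x y)" .
qed

lemma bracket_Gamma24: "bracket i j \<in> carrier Gamma24"
  by (simp add: bracket_def transvection_square_Gamma24)

lemma kform_bracket: "kform (bracket i j) x y = par (form x (a i j)) * par (form y (a i j))"
  by (simp add: bracket_def kform_transvection_square)

text \<open>The vector \<open>dual p\<close> pairs with \<open>a i j\<close> to 1 exactly for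
  \<open>p\<close> in \<open>{i, j}\<close>. Thus among all brackets only the one for the pair of
  \<open>p\<close> and \<open>q\<close> is nonzero at \<open>(dual p, dual q)\<close>, and
  coefficients can be read off.\<close>

lemma kform_lin_comb_dual:
  assumes c: "\<And>i j. c i j = c j i" and pq: "p \<in> idx" "q \<in> idx" "p \<noteq> q"
  shows "kform (lin_comb c bracket) (dual p) (dual q) = c p q"
proof -
  \<comment> \<open>Elements of \<open>pairs\<close> are increasing, so the pair of \<open>p\<close>
    and \<open>q\<close> appears as its minimum and maximum.\<close>
  have "c i j * kform (bracket i j) (dual p) (dual q)
      = (if (i, j) = (min p q, max p q) then c p q else 0)" if ij: "(i, j) \<in> pairs" for i j
  proof -
    have d: "par (form (dual r) (a i j)) = of_bool (i = r) + of_bool (j = r)" if "r \<in> idx" for r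
      using ij that by (auto simp: mem_pairs_iff par_form_a crd_dual indicator_vec_def)
    show ?thesis
      unfolding kform_bracket d[OF pq(1)] d[OF pq(2)] using ij pq c
      by (auto simp: mem_pairs_iff min_def max_def)
  qed
  then have "kform (lin_comb c bracket) (dual p) (dual q)
      = (\<Sum>z\<in>pairs. if z = (min p q, max p q) then c p q else 0)"
    unfolding kform_lin_comb[OF bracket_Gamma24] split_def
    by (intro sum.cong refl) (metis prod.collapse)
  also have "\<dots> = c p q" using pq by (simp add: sum.delta) (auto simp: mem_pairs_iff min_def max_def)
  finally show ?thesis .
qed

text \<open>The off-diagonal values of the form serve as coefficients: both sides then agree on
  them, and by \<open>over_id_eqI\<close> this determines the element.\<close>

lemma over_id_lin_comb:
  assumes k: "over k id"
  shows "k = lin_comb (\<lambda>i j. kform k (dual i) (dual j)) bracket"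
  by (rule over_id_eqI[OF k Gamma24_over[OF lin_comb_closed[OF bracket_Gamma24]]])
    (rule kform_lin_comb_dual[symmetric], rule kform_sym[OF k])

text \<open>Every automorphism modulo 4 that is trivial modulo 2 lifts to the lattice: it is a
  product of brackets, that is, of squares of transvections, and these are defined over the 2-adic
  integers.\<close>

lemma carrier_Gamma24: "carrier Gamma24 = {k. over k id}"
proof -
  have "k \<in> carrier Gamma24" if "over k id" for k
    by (subst over_id_lin_comb[OF that]) (rule lin_comb_closed[OF bracket_Gamma24])
  then show ?thesis using Gamma24_over by blast
qed

section \<open>The diagonal linear form and the subgroup N\<close>

definition lam :: "('v set \<Rightarrow> 'v set) \<Rightarrow> 'v \<Rightarrow> bit" where
  "lam k x = kform k x x"

text \<open>In characteristic 2 the diagonal of a symmetric bilinear form is additive, as the two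
  cross terms cancel.\<close>

lemma linear_mod_2_lam: "over k id \<Longrightarrow> linear_mod_2 (lam k)"
  unfolding linear_mod_2_def
proof safe
  assume k: "over k id"
  fix x y
  show "lam k (x + y) = lam k x + lam k y"
    by (simp add: lam_def kform_add_left[OF k] kform_add_right kform_sym[OF k, of y x] ac_simps)
  assume "crd x = crd y"
  then show "lam k x = lam k y"
    using linear_mod_2_cong[OF linear_mod_2_kform_left[OF k]] linear_mod_2_cong[OF linear_mod_2_kform_right]
    by (metis lam_def)
qed

lemma lam_dual: "i \<in> idx \<Longrightarrow> lam k (dual i) = (\<Sum>j\<in>idx - {i}. kform k (dual i) (dual j))"
proof -
  assume i: "i \<in> idx"
  have "lam k (dual i) = (\<Sum>j\<in>idx. kform k (dual i) (dual j) * indicator_vec (idx - {i}) j)"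
    unfolding lam_def
    by (subst linear_mod_2_dual[OF linear_mod_2_kform_right]) (simp add: crd_dual[OF i] mult.commute)
  also have "\<dots> = (\<Sum>j\<in>idx - {i}. kform k (dual i) (dual j))" by (rule sum_indicator_restrict) auto
  finally show ?thesis .
qed

text \<open>The row sum of the coefficients at \<open>i\<close> is the value of \<open>lam\<close>
  at \<open>dual i\<close>, because \<open>dual i\<close> is modulo 2 the sum of the other dual
  vectors. As these vectors span, vanishing row sums mean \<open>lam k = 0\<close>.\<close>

lemma N_eq: "N = {k. over k id \<and> lam k = (\<lambda>_. 0)}"
proof (intro equalityI subsetI)
  fix k assume "k \<in> N"
  then obtain c where c: "k = lin_comb c bracket" "\<And>i j. c i j = c j i"
      "\<And>i. i \<in> idx \<Longrightarrow> (\<Sum>j\<in>idx - {i}. c i j) = 0"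
    by (auto simp: N_def simp flip: idx_def)
  have k: "over k id" unfolding c(1) by (rule Gamma24_over[OF lin_comb_closed[OF bracket_Gamma24]])
  have "lam k (dual i) = 0" if "i \<in> idx" for i
    using that c(3)[OF that] unfolding lam_dual[OF that] c(1)
    by (subst sum.cong[OF refl kform_lin_comb_dual[OF c(2)]]) auto
  then have "lam k x = 0" for x by (subst linear_mod_2_dual[OF linear_mod_2_lam[OF k]]) simp
  then show "k \<in> {k. over k id \<and> lam k = (\<lambda>_. 0)}" using k by blast
next
  fix k assume "k \<in> {k. over k id \<and> lam k = (\<lambda>_. 0)}"
  then have k: "over k id" and l: "lam k = (\<lambda>_. 0)" by auto
  let ?c = "\<lambda>i j. kform k (dual i) (dual j)"
  have "(\<forall>i j. ?c i j = ?c j i) \<and> (\<forall>i\<in>idx. (\<Sum>j\<in>idx - {i}. ?c i j) = 0)"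
  proof (intro conjI allI ballI)
    show "?c i j = ?c j i" for i j by (rule kform_sym[OF k])
    show "(\<Sum>j\<in>idx - {i}. ?c i j) = 0" if "i \<in> idx" for i
      using lam_dual[OF that, of k] l by simp
  qed
  then have "lin_comb ?c bracket \<in> N" unfolding N_def idx_def[symmetric] by blast
  then show "k \<in> N" by (subst over_id_lin_comb[OF k])
qed

lemma lam_mult: "over k id \<Longrightarrow> over l id \<Longrightarrow> lam (k \<star> l) x = lam k x + lam l x"
  by (simp add: lam_def kform_mult)

lemma lam_one: "lam \<one>\<^bsub>SpQ 2\<^esub> x = 0"
  by (simp add: lam_def kform_one)

lemma lam_inv: "over k id \<Longrightarrow> lam (inv\<^bsub>SpQ 2\<^esub> k) x = lam k x"
  by (simp add: lam_def kform_inv)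

lemma lam_conj: "over h \<sigma> \<Longrightarrow> over k id \<Longrightarrow> 
  lam (h \<star> k \<star> inv\<^bsub>SpQ 2\<^esub> h) (ap h x) = lam k x"
  by (simp add: lam_def kform_conj)

lemma lam_transvection_square: "lam (reduce 2 (transvection b \<circ> transvection b)) x = par (form x b)"
  by (simp add: lam_def kform_transvection_square bit_mult_self)

lemma subgroup_N: "subgroup N Gamma24"
proof (rule K.subgroupI)
  show "N \<subseteq> carrier Gamma24" by (auto simp: N_eq carrier_Gamma24)
  show "N \<noteq> {}" using over_one lam_one by (auto simp: N_eq)
  fix k l assume k: "k \<in> N" and l: "l \<in> N"
  have kin: "k \<in> carrier Gamma24" using k by (simp add: N_eq carrier_Gamma24)
  have "SpQ 2\<lparr>carrier := carrier Gamma24\<rparr> = Gamma24" by (simp add: Gamma24_def)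
  then have "inv\<^bsub>Gamma24\<^esub> k = inv\<^bsub>SpQ 2\<^esub> k"
    using P.m_inv_consistent[OF subgroup_Gamma24 kin] by simp
  moreover have "over (inv\<^bsub>SpQ 2\<^esub> k) id" "lam (inv\<^bsub>SpQ 2\<^esub> k) = (\<lambda>_. 0)"
    using k by (auto simp: N_eq lam_inv over_id_inv)
  ultimately show "inv\<^bsub>Gamma24\<^esub> k \<in> N" by (simp add: N_eq)
  show "k \<otimes>\<^bsub>Gamma24\<^esub> l \<in> N" using k l by (auto simp: N_eq lam_mult over_id_mult fun_eq_iff)
qed

lemma normal_N: "N \<lhd> Gamma24"
  by (rule K.subgroup_imp_normal[OF subgroup_N])

section \<open>The quotient M and the action of permutations on it\<close>

lemma comm_group_M: "comm_group M"
  unfolding M_def by (rule K.abelian_FactGroup[OF subgroup_N])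

lemma carrier_M: "carrier M = proj_M ` {k. over k id}"
  by (simp add: M_def carrier_FactGroup proj_M_def carrier_Gamma24)

lemma proj_M_closed [simp]: "over k id \<Longrightarrow> proj_M k \<in> carrier M"
  by (simp add: carrier_M)

lemma mult_M: "over k id \<Longrightarrow> over l id \<Longrightarrow> proj_M k \<otimes>\<^bsub>M\<^esub> proj_M l = proj_M (k \<star> l)"
  using normal.rcos_sum[OF normal_N, of k l] by (simp add: M_def proj_M_def carrier_Gamma24)

lemma mem_proj_M_iff_lam:
  assumes k: "over k id"
  shows "m \<in> proj_M k \<longleftrightarrow> over m id \<and> lam m = lam k"
proof
  assume "m \<in> proj_M k"
  then obtain n where "n \<in> N" "m = n \<star> k" by (auto simp: proj_M_def r_coset_def)
  then have n: "over n id" "lam n = (\<lambda>_. 0)" and m: "m = n \<star> k" by (simp_all add: N_eq)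
  have "lam m x = lam k x" for x by (simp add: m lam_mult[OF n(1) k] n(2))
  then show "over m id \<and> lam m = lam k" unfolding m using over_id_mult[OF n(1) k] by (auto simp only: m)
next
  assume m: "over m id \<and> lam m = lam k"
  then have n: "m \<star> inv\<^bsub>SpQ 2\<^esub> k \<in> N"
    using k by (auto simp: N_eq over_id_mult over_id_inv lam_mult lam_inv fun_eq_iff)
  have "m = m \<star> inv\<^bsub>SpQ 2\<^esub> k \<star> k"
    using over_SpQ[OF conjunct1[OF m]] over_SpQ[OF k] by (simp add: P.m_assoc)
  with n have "\<exists>n\<in>N. m = n \<star> k" by blast
  then show "m \<in> proj_M k" by (simp add: proj_M_def r_coset_def)
qed

lemma proj_M_eq_iff:
  assumes k: "over k id" and l: "over l id"
  shows "proj_M k = proj_M l \<longleftrightarrow> lam k = lam l"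
proof
  assume "proj_M k = proj_M l"
  moreover have "k \<in> proj_M k" using mem_proj_M_iff_lam[OF k] k by blast
  ultimately show "lam k = lam l" using mem_proj_M_iff_lam[OF l] by simp
next
  assume *: "lam k = lam l"
  show "proj_M k = proj_M l" by (rule Set.set_eqI) (simp only: mem_proj_M_iff_lam[OF k] mem_proj_M_iff_lam[OF l] *)
qed

lemma mem_proj_M_iff: "over k id \<Longrightarrow> m \<in> proj_M k \<longleftrightarrow> over m id \<and> proj_M m = proj_M k"
  using mem_proj_M_iff_lam proj_M_eq_iff by blast

text \<open>An element \<open>h\<close> over \<sigma> maps \<open>a i j\<close> to
  \<open>a (\<sigma> i) (\<sigma> j)\<close> modulo 2, so conjugation by \<open>h\<close> sends
  brackets to brackets. This shows at the same time that the definite description in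
  \<open>act_Gamma24\<close> is well posed.\<close>

lemma act_Gamma24_eq:
  assumes h: "over h \<sigma>" and k: "over k id"
  shows "act_Gamma24 \<sigma> k = h \<star> k \<star> inv\<^bsub>SpQ 2\<^esub> h"
proof -
  let ?r = "h \<star> k \<star> inv\<^bsub>SpQ 2\<^esub> h"
  have \<sigma>: "\<sigma> \<in> Sym d" and H: "h \<in> carrier (SpQ 2)" using h by (auto simp: over_def)
  have br: "par (form (ap h x) (a (\<sigma> i) (\<sigma> j))) = par (form x (a i j))" if "(i, j) \<in> pairs" for i j x
  proof -
    have ij: "i \<in> {1..d}" "j \<in> {1..d}" "i \<noteq> j" using that idx_d by (auto simp: mem_pairs_iff)
    have p: "\<sigma> permutes {1..d}" using \<sigma> by (simp add: Sym_def)
    have s: "\<sigma> i \<in> {1..d}" "\<sigma> j \<in> {1..d}" "\<sigma> i \<noteq> \<sigma> j"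
      using ij permutes_in_image[OF p] permutes_inj[OF p] by (auto dest: injD)
    have "red (a (\<sigma> i) (\<sigma> j)) = std_rep d \<sigma> (red (a i j))"
      by (simp only: red_a[OF s] red_a[OF ij] std_rep_vbar[OF \<sigma> ij])
    then have "crd (a (\<sigma> i) (\<sigma> j)) = crd (ap h (a i j))"
      using h by (simp add: over_def flip: red_eq_iff_crd)
    then have "par (form (ap h x) (a (\<sigma> i) (\<sigma> j))) = par (form (ap h x) (ap h (a i j)))"
      by (simp add: par_form)
    then show ?thesis by (simp add: par_form_ap[OF H])
  qed
  have eq: "lin_comb c (\<lambda>i j. bracket (\<sigma> i) (\<sigma> j)) = ?r" if "k = lin_comb c bracket" for c
  proof (rule over_id_eqI_kform[OF Gamma24_over[OF lin_comb_closed[OF bracket_Gamma24]] over_conj[OF h k]])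
    fix x y
    have *: "kform (lin_comb c (\<lambda>i j. bracket (\<sigma> i) (\<sigma> j))) (ap h u) (ap h v) = kform ?r (ap h u) (ap h v)" for u v
    proof -
      have "kform (lin_comb c (\<lambda>i j. bracket (\<sigma> i) (\<sigma> j))) (ap h u) (ap h v) = kform (lin_comb c bracket) u v"
        unfolding kform_lin_comb[OF bracket_Gamma24] kform_bracket by (rule sum.cong) (auto simp: br)
      also have "\<dots> = kform k u v" by (simp only: that)
      also have "\<dots> = kform ?r (ap h u) (ap h v)" by (rule kform_conj[OF h k, symmetric])
      finally show ?thesis .
    qed
    \<comment> \<open>Every vector is modulo 2 of the form \<open>ap h u\<close>, so the comparison
      on such vectors carries over to all vectors.\<close>
    have cong: "kform l x y = kform l (ap h (ap (inv\<^bsub>SpQ 2\<^esub> h) x)) (ap h (ap (inv\<^bsub>SpQ 2\<^esub> h) y))" if l: "over l id" for l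
    proof -
      have c: "crd z = crd (ap h (ap (inv\<^bsub>SpQ 2\<^esub> h) z))" for z
        by (rule sym) (simp add: crd_eq_iff res_1_if_res_2[OF ap_inv(2)[OF H]])
      show ?thesis
        using linear_mod_2_cong[OF linear_mod_2_kform_left[OF l] c[of x]]
          linear_mod_2_cong[OF linear_mod_2_kform_right c[of y]] by simp
    qed
    show "kform (lin_comb c (\<lambda>i j. bracket (\<sigma> i) (\<sigma> j))) x y = kform ?r x y"
      by (rule trans[OF cong[OF Gamma24_over[OF lin_comb_closed[OF bracket_Gamma24]]]
          trans[OF * cong[OF over_conj[OF h k], symmetric]]])
  qed
  show ?thesis
    unfolding act_Gamma24_def
  proof (rule the_equality)
    show "\<exists>c. k = lin_comb c bracket \<and> ?r = lin_comb c (\<lambda>i j. bracket (\<sigma> i) (\<sigma> j))"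
      using over_id_lin_comb[OF k] eq by metis
  qed (use eq in blast)
qed

text \<open>Conjugation transports \<open>lam\<close>, so it maps a coset of \<open>N\<close> into a
  coset. As \<open>act_M\<close> is an image of a set, the other inclusion is needed too.\<close>

lemma act_M_proj:
  assumes h: "over h \<sigma>" and k: "over k id"
  shows "act_M \<sigma> (proj_M k) = proj_M (h \<star> k \<star> inv\<^bsub>SpQ 2\<^esub> h)"
proof -
  let ?c = "\<lambda>h k. h \<star> k \<star> inv\<^bsub>SpQ 2\<^esub> h"
  have cong: "proj_M (?c h k) = proj_M (?c h l)" if "over h \<sigma>" "over k id" "over l id" "proj_M k = proj_M l" for h \<sigma> k l
  proof -
    note H = over_SpQ[OF that(1)]
    have kl: "lam k = lam l" using that proj_M_eq_iff by blast
    have "lam (?c h k) x = lam (?c h l) x" for x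
    proof -
      have c: "crd x = crd (ap h (ap (inv\<^bsub>SpQ 2\<^esub> h) x))"
        by (rule sym) (simp add: crd_eq_iff res_1_if_res_2[OF ap_inv(2)[OF H]])
      show ?thesis
        using linear_mod_2_cong[OF linear_mod_2_lam[OF over_conj[OF that(1,2)]] c]
          linear_mod_2_cong[OF linear_mod_2_lam[OF over_conj[OF that(1,3)]] c]
        by (simp add: lam_conj[OF that(1,2)] lam_conj[OF that(1,3)] kl)
    qed
    then show ?thesis using that by (subst proj_M_eq_iff) (auto intro: over_conj)
  qed
  have inv: "?c (inv\<^bsub>SpQ 2\<^esub> h) (?c h l) = l" "?c h (?c (inv\<^bsub>SpQ 2\<^esub> h) l) = l" if "over l id" for l
  proof -
    note H = over_SpQ[OF h] and L = over_SpQ[OF that]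
    have "inv\<^bsub>SpQ 2\<^esub> h \<star> (h \<star> z) = z" "h \<star> (inv\<^bsub>SpQ 2\<^esub> h \<star> z) = z"
      if "z \<in> carrier (SpQ 2)" for z
      using H that by (simp_all flip: P.m_assoc)
    then show "?c (inv\<^bsub>SpQ 2\<^esub> h) (?c h l) = l" "?c h (?c (inv\<^bsub>SpQ 2\<^esub> h) l) = l"
      using H L by (simp_all add: P.m_assoc)
  qed
  show ?thesis
  proof (intro equalityI subsetI)
    fix m assume "m \<in> act_M \<sigma> (proj_M k)"
    then obtain l where l: "l \<in> proj_M k" "m = act_Gamma24 \<sigma> l" by (auto simp: act_M_def)
    then have l': "over l id" "proj_M l = proj_M k" using mem_proj_M_iff[OF k] by auto
    then have "m = ?c h l" using l act_Gamma24_eq[OF h] by simp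
    then show "m \<in> proj_M (?c h k)"
      using cong[OF h l'(1) k l'(2)] over_conj[OF h] k l' by (simp add: mem_proj_M_iff)
  next
    fix m assume "m \<in> proj_M (?c h k)"
    then have m: "over m id" "proj_M m = proj_M (?c h k)" using mem_proj_M_iff[OF over_conj[OF h k]] by auto
    \<comment> \<open>Conjugating back by the inverse of \<open>h\<close> produces the
      preimage.\<close>
    let ?l = "?c (inv\<^bsub>SpQ 2\<^esub> h) m"
    have hi: "over (inv\<^bsub>SpQ 2\<^esub> h) (inv_into UNIV \<sigma>)" by (rule over_inv[OF h])
    have l: "over ?l id" by (rule over_conj[OF hi m(1)])
    have "proj_M ?l = proj_M (?c (inv\<^bsub>SpQ 2\<^esub> h) (?c h k))"
      by (rule cong[OF hi m(1) over_conj[OF h k] m(2)])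
    then have "?l \<in> proj_M k" using l by (simp add: inv(1)[OF k] mem_proj_M_iff[OF k])
    moreover have "m = act_Gamma24 \<sigma> ?l" using act_Gamma24_eq[OF h l] inv(2)[OF m(1)] by simp
    ultimately show "m \<in> act_M \<sigma> (proj_M k)" unfolding act_M_def by blast
  qed
qed

end

section \<open>Quasi-cocycles and transpositions\<close>

context symmetric_reduction
begin

interpretation P: group "SpQ 2" by (rule group_SpQ)
interpretation M: comm_group M by (rule comm_group_M)

lemma par_form_cls:
  assumes "w \<in> carrier (W0 d)" "w' \<in> carrier (W0 d)" "red x = cls d w" "red y = cls d w'"
  shows "par (form x y) = (\<Sum>i\<in>{1..d}. w i * w' i)"
  using red_form[of x y] Vbar_form_cls[OF assms(1,2)] by (simp add: assms par_def)

lemma sum_indicator_pair: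
  fixes w :: "nat \<Rightarrow> bit"
  assumes "i \<in> {1..d}" "j \<in> {1..d}" "i \<noteq> j"
  shows "(\<Sum>k\<in>{1..d}. w k * indicator_vec {i, j} k) = w i + w j"
proof -
  have "(\<Sum>k\<in>{1..d}. w k * indicator_vec {i, j} k) = (\<Sum>k\<in>{1..d}. if k \<in> {i, j} then w k else 0)"
    by (rule sum.cong) (simp_all add: indicator_vec_def)
  also have "\<dots> = sum w ({1..d} \<inter> {i, j})" by (rule sum.inter_restrict[symmetric]) simp
  also have "{1..d} \<inter> {i, j} = {i, j}" using assms by blast
  finally show ?thesis using assms(3) by simp
qed

lemma indicator_pair_W0: "i \<in> {1..d} \<Longrightarrow> j \<in> {1..d} \<Longrightarrow> i \<noteq> j \<Longrightarrow> indicator_vec {i, j} \<in> carrier (W0 d)"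
  by (rule indicator_vec_W0) auto

text \<open>In contrast to \<open>par_form_a\<close> this admits the index \<open>d\<close> also for
  even \<open>d\<close>, where the normalised coordinate \<open>crd x d\<close> is 0.\<close>

lemma par_form_a_general:
  assumes "i \<in> {1..d}" "j \<in> {1..d}" "i \<noteq> j"
  shows "par (form x (a i j)) = crd x i + crd x j"
  using par_form_cls[OF crd_W0 indicator_pair_W0[OF assms] red_crd, of "a i j" x]
  by (simp only: red_a[OF assms] vbar_eq sum_indicator_pair[OF assms])

lemma par_form_a_a:
  assumes "i \<in> {1..d}" "j \<in> {1..d}" "i \<noteq> j" "k \<in> {1..d}" "l \<in> {1..d}" "k \<noteq> l"
  shows "par (form (a i j) (a k l)) = of_bool (k \<in> {i, j}) + of_bool (l \<in> {i, j})"
  using par_form_cls[OF indicator_pair_W0[OF assms(1-3)] indicator_pair_W0[OF assms(4-6)], of "a i j" "a k l"]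
  by (simp only: red_a[OF assms(1-3)] red_a[OF assms(4-6)] vbar_eq sum_indicator_pair[OF assms(4-6)])
    (simp add: indicator_vec_def)

lemma crd_scale: "crd (scale c x) = (if par c = 1 then crd x else (\<lambda>_. 0))"
proof -
  have "crd (scale c x) = crd (if par c = 1 then x else 0)"
    by (simp add: crd_cong_iff_form form_scale_left par_mult)
  then show ?thesis by simp
qed

lemma linear_mod_2_scale: "linear_mod_2 u \<Longrightarrow> u (scale c x) = par c * u x"
proof -
  assume u: "linear_mod_2 u"
  have "crd (scale c x) = crd (if par c = 1 then x else 0)" by (simp add: crd_scale)
  then have "u (scale c x) = u (if par c = 1 then x else 0)" by (rule linear_mod_2_cong[OF u])
  then show ?thesis using linear_mod_2_0[OF u] by simp
qed

lemma exists_crd_a: "\<exists>y. \<forall>j\<in>idx - {1}. par (form (a 1 j) y) = c j"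
proof -
  let ?t = "\<Sum>j\<in>idx - {1}. c j"
  \<comment> \<open>The pairing conditions say \<open>w 1 + w j = c j\<close>, so everything is
    determined by \<open>w 1\<close>. The coordinates must add up to 0, and since there are
    \<open>2 * g\<close> indices \<open>j\<close>, this forces \<open>w 1\<close> to be the sum of
    the \<open>c j\<close>.\<close>
  let ?w = "\<lambda>j. if j = 1 then ?t else if j \<in> idx then c j + ?t else 0"
  have 1: "1 \<in> idx" by (simp add: idx_def)
  have "sum ?w idx = ?w 1 + sum ?w (idx - {1})" by (rule sum.remove) (simp_all add: 1)
  also have "sum ?w (idx - {1}) = (\<Sum>j\<in>idx - {1}. c j + ?t)" by (rule sum.cong) auto
  also have "\<dots> = ?t + of_nat (card (idx - {1})) * ?t" by (simp add: sum.distrib)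
  also have "(of_nat (card (idx - {1})) :: bit) = 0" using 1 by (simp add: of_nat_bit_eq_0_iff card_idx)
  finally have "?w \<in> evens" using 1 by (auto simp: evens_def)
  then obtain y where y: "crd y = ?w" using crd_surj by blast
  have "par (form (a 1 j) y) = c j" if "j \<in> idx - {1}" for j
    using that 1 by (simp add: par_form_commute[of "a 1 j"] par_form_a y ac_simps)
  then show ?thesis by blast
qed

text \<open>Brackets only use the vectors \<open>a i j\<close>; squares of transvections along
  arbitrary vectors represent all classes of \<open>M\<close>, and \<open>b\<close> modulo 2 is then
  the corresponding vector of \<open>Vbar d\<close>.\<close>

definition sq :: "'v \<Rightarrow> 'v set \<Rightarrow> 'v set" where
  "sq b = reduce 2 (transvection b \<circ> transvection b)"

lemma over_sq: "over (sq b) id"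
  by (simp only: sq_def over_transvection_square)

lemma lam_sq: "lam (sq b) = (\<lambda>x. par (form x b))"
  by (rule ext) (simp only: sq_def lam_transvection_square)

lemma exists_sq:
  assumes "linear_mod_2 u"
  shows "\<exists>y. u = lam (sq y)"
proof -
  obtain y where "\<forall>j\<in>idx - {1}. par (form (a 1 j) y) = u (a 1 j)"
    using exists_crd_a[of "\<lambda>j. u (a 1 j)"] by blast
  then have "u = (\<lambda>x. par (form x y))"
    by (intro linear_mod_2_eqI assms linear_mod_2_form) simp
  then show ?thesis by (auto simp: lam_sq)
qed

lemma proj_sq_eq_iff: "proj_M (sq x) = proj_M (sq y) \<longleftrightarrow> red x = red y"
proof -
  have "lam (sq x) = lam (sq y) \<longleftrightarrow> (\<forall>z. par (form z x) = par (form z y))"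
    by (simp add: lam_sq fun_eq_iff)
  also have "\<dots> \<longleftrightarrow> red x = red y"
    unfolding par_form_commute[of _ x] par_form_commute[of _ y] red_eq_iff_crd crd_cong_iff_form ..
  finally show ?thesis by (simp add: proj_M_eq_iff over_sq)
qed

lemma proj_sq_add: "proj_M (sq (x + y)) = proj_M (sq x) \<otimes>\<^bsub>M\<^esub> proj_M (sq y)"
  by (simp add: mult_M over_sq proj_M_eq_iff over_id_mult lam_mult lam_sq fun_eq_iff form_add_right par_add)

text \<open>Evaluates the definite description of the isomorphism. The map
  \<open>red y \<mapsto> proj_M (sq y)\<close> is well defined and bijective by nondegeneracy, and a
  homomorphism with the same values on the vectors \<open>vbar d {i, j}\<close> agrees with it
  because the \<open>a 1 j\<close> span modulo 2.\<close>

lemma Vbar_to_M_red: "Vbar_to_M (red y) = proj_M (sq y)"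
proof -
  define th where "th = (\<lambda>X\<in>carrier (Vbar d). proj_M (sq (SOME y. red y = X)))"
  have th: "th (red y) = proj_M (sq y)" for y
  proof -
    have "red (SOME z. red z = red y) = red y" by (rule someI[of "\<lambda>z. red z = red y" y]) (rule refl)
    then show ?thesis by (simp add: th_def red_carrier proj_sq_eq_iff)
  qed
  have Vc: "carrier (Vbar d) = range red" by (rule red_surj[symmetric])
  have hom: "th \<in> hom (Vbar d) M"
    by (rule homI) (auto simp: Vc th over_sq proj_sq_add simp flip: red_add)
  have "inj_on th (carrier (Vbar d))" unfolding Vc by (auto simp: inj_on_def th proj_sq_eq_iff)
  moreover have "th ` carrier (Vbar d) = carrier M"
  proof
    show "th ` carrier (Vbar d) \<subseteq> carrier M" using hom by (auto simp: hom_def)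
    show "carrier M \<subseteq> th ` carrier (Vbar d)"
    proof
      fix m assume "m \<in> carrier M"
      then obtain k where k: "over k id" "m = proj_M k" by (auto simp: carrier_M)
      obtain y where "lam k = lam (sq y)" using exists_sq[OF linear_mod_2_lam[OF k(1)]] by blast
      then have "m = th (red y)" by (simp add: th k proj_M_eq_iff over_sq)
      then show "m \<in> th ` carrier (Vbar d)" using red_carrier by blast
    qed
  qed
  ultimately have iso: "th \<in> iso (Vbar d) M" using hom by (simp add: iso_def bij_betw_def)
  have br: "th (vbar d {i, j}) = proj_M (bracket i j)" if "i \<in> {1..d}" "j \<in> {1..d}" "i \<noteq> j" for i j
    by (simp only: red_a[OF that, symmetric] th bracket_def sq_def)
  have "Vbar_to_M = th"
    unfolding Vbar_to_M_def
  proof (rule the_equality)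
    show "th \<in> extensional (carrier (Vbar d)) \<and> th \<in> iso (Vbar d) M \<and>
     (\<forall>i\<in>{1..d}. \<forall>j\<in>{1..d}. i \<noteq> j \<longrightarrow> th (vbar d {i, j}) = proj_M (bracket i j))"
      using iso br by (simp add: th_def)
    fix th' assume th': "th' \<in> extensional (carrier (Vbar d)) \<and> th' \<in> iso (Vbar d) M \<and>
     (\<forall>i\<in>{1..d}. \<forall>j\<in>{1..d}. i \<noteq> j \<longrightarrow> th' (vbar d {i, j}) = proj_M (bracket i j))"
    then have hom': "th' \<in> hom (Vbar d) M" by (simp add: iso_def)
    have add': "th' (red (x + y)) = th' (red x) \<otimes>\<^bsub>M\<^esub> th' (red y)" for x y
      unfolding red_add by (rule hom_mult[OF hom' red_carrier red_carrier])
    have add: "th (red (x + y)) = th (red x) \<otimes>\<^bsub>M\<^esub> th (red y)" for x y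
      unfolding red_add by (rule hom_mult[OF hom red_carrier red_carrier])
    have c: "th (red x) \<in> carrier M" "th' (red x) \<in> carrier M" for x
      using hom hom' red_carrier by (auto simp: hom_def)
    have z: "th (red 0) = \<one>\<^bsub>M\<^esub>" "th' (red 0) = \<one>\<^bsub>M\<^esub>"
      using add[of 0 0] add'[of 0 0] c by (metis M.r_cancel_one' add.right_neutral)+
    have sum: "th' (red (sum f A)) = th (red (sum f A))"
      if "\<And>i. i \<in> A \<Longrightarrow> th' (red (f i)) = th (red (f i))" for f :: "nat \<Rightarrow> 'v" and A
      using that by (induction A rule: infinite_finite_induct) (simp_all add: z add add')
    have 1: "1 \<in> idx" by (simp add: idx_def)
    have "th' (red y) = th (red y)" for y
    proof -
      let ?z = "\<Sum>j\<in>idx - {1}. if crd y j = 1 then a 1 j else 0"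
      have "red y = red ?z" unfolding red_eq_iff_crd by (rule crd_a_expand)
      moreover have "th' (red ?z) = th (red ?z)"
      proof (rule sum)
        fix j assume j: "j \<in> idx - {1}"
        then have ij: "1 \<in> {1..d}" "j \<in> {1..d}" "1 \<noteq> j" using 1 idx_d by auto
        have "th' (red (a 1 j)) = th (red (a 1 j))"
          using th' ij br[OF ij] unfolding red_a[OF ij] by metis
        then show "th' (red (if crd y j = 1 then a 1 j else 0)) = th (red (if crd y j = 1 then a 1 j else 0))"
          by (simp add: z)
      qed
      ultimately show ?thesis by simp
    qed
    then show "th' = th"
      using th' by (intro extensionalityI[of th' "carrier (Vbar d)" th]) (auto simp: Vc th_def)
  qed
  then show ?thesis by (simp add: th)
qed

lemma v_M_pair: "i \<in> {1..d} \<Longrightarrow> j \<in> {1..d} \<Longrightarrow> i \<noteq> j \<Longrightarrow> v_M {i, j} = proj_M (sq (a i j))"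
  using Vbar_to_M_red[of "a i j"] by (simp add: v_M_def red_a)

lemma v_M_dual: "i \<in> idx \<Longrightarrow> v_M (idx - {i}) = proj_M (sq (dual i))"
  using Vbar_to_M_red[of "dual i"] red_crd[of "dual i"] by (simp add: v_M_def crd_dual vbar_eq)

section \<open>Elements of M as linear forms\<close>

definition mu :: "('v set \<Rightarrow> 'v set) set \<Rightarrow> 'v \<Rightarrow> bit" where
  "mu m = lam (SOME k. over k id \<and> proj_M k = m)"

lemma mu_proj: "over k id \<Longrightarrow> mu (proj_M k) = lam k"
proof -
  assume k: "over k id"
  have "over (SOME l. over l id \<and> proj_M l = proj_M k) id \<and> proj_M (SOME l. over l id \<and> proj_M l = proj_M k) = proj_M k"
    by (rule someI[of "\<lambda>l. over l id \<and> proj_M l = proj_M k" k]) (use k in blast)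
  then show ?thesis unfolding mu_def using k proj_M_eq_iff by blast
qed

lemma carrier_M_E:
  assumes "m \<in> carrier M"
  obtains k where "over k id" "m = proj_M k"
  using assms by (auto simp: carrier_M)

lemma linear_mod_2_mu: "m \<in> carrier M \<Longrightarrow> linear_mod_2 (mu m)"
  by (auto elim!: carrier_M_E simp: mu_proj linear_mod_2_lam)

lemma mu_inj: "m \<in> carrier M \<Longrightarrow> m' \<in> carrier M \<Longrightarrow> m = m' \<longleftrightarrow> mu m = mu m'"
  by (metis carrier_M_E mu_proj proj_M_eq_iff)

lemma mu_mult: "m \<in> carrier M \<Longrightarrow> m' \<in> carrier M \<Longrightarrow> mu (m \<otimes>\<^bsub>M\<^esub> m') x = mu m x + mu m' x"
  by (auto elim!: carrier_M_E simp: mu_proj mult_M over_id_mult lam_mult)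

lemma act_M_closed: "over h \<sigma> \<Longrightarrow> m \<in> carrier M \<Longrightarrow> act_M \<sigma> m \<in> carrier M"
  by (auto elim!: carrier_M_E simp: act_M_proj over_conj)

lemma linear_mod_2_ap_ap_inv:
  assumes "linear_mod_2 u" "k \<in> carrier (SpQ 2)"
  shows "u (ap k (ap (inv\<^bsub>SpQ 2\<^esub> k) x)) = u x"
  by (rule linear_mod_2_cong[OF assms(1)]) (simp add: crd_eq_iff res_1_if_res_2[OF ap_inv(2)[OF assms(2)]])

lemma mu_act_M:
  assumes h: "over h \<sigma>" and m: "m \<in> carrier M"
  shows "mu (act_M \<sigma> m) x = mu m (ap (inv\<^bsub>SpQ 2\<^esub> h) x)"
proof -
  obtain k where k: "over k id" "m = proj_M k" using m by (rule carrier_M_E)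
  let ?k = "h \<star> k \<star> inv\<^bsub>SpQ 2\<^esub> h"
  have kk: "over ?k id" by (rule over_conj[OF h k(1)])
  have "lam ?k x = lam ?k (ap h (ap (inv\<^bsub>SpQ 2\<^esub> h) x))"
    by (rule linear_mod_2_ap_ap_inv[OF linear_mod_2_lam[OF kk] over_SpQ[OF h], symmetric])
  then show ?thesis unfolding k(2) act_M_proj[OF h k(1)] mu_proj[OF kk] mu_proj[OF k(1)] lam_conj[OF h k(1)] .
qed

lemma crd_ap_over: "over h \<sigma> \<Longrightarrow> over h' \<sigma> \<Longrightarrow> crd (ap h x) = crd (ap h' x)"
  by (simp add: over_def flip: red_eq_iff_crd)

text \<open>Write \<open>form b c = 2 * e\<close>. The two products of transvections differ by
  -2e(<y,c>b + <y,b>c), twice a vector whose pairing with the argument is even because its two terms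
  cancel modulo 2. So the commutator lies in \<open>N\<close>.\<close>

lemma lam_transvection_commutator:
  assumes bc: "par (form b c) = 0"
    and B: "over (reduce 2 (transvection c \<circ> transvection b)) \<tau>"
    and A: "over (reduce 2 (transvection b \<circ> transvection c)) \<tau>"
  shows "over (reduce 2 (transvection b \<circ> transvection c) \<star>
      inv\<^bsub>SpQ 2\<^esub> (reduce 2 (transvection c \<circ> transvection b))) id"
    and "lam (reduce 2 (transvection b \<circ> transvection c) \<star>
      inv\<^bsub>SpQ 2\<^esub> (reduce 2 (transvection c \<circ> transvection b))) x = 0"
proof -
  let ?A = "transvection b \<circ> transvection c" and ?B = "transvection c \<circ> transvection b"
  let ?Z = "reduce 2 ?A \<star> inv\<^bsub>SpQ 2\<^esub> (reduce 2 ?B)"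
  have SpV: "?A \<in> carrier SpV" "?B \<in> carrier SpV" by (simp_all add: comp_SpV transvection_SpV)
  have "\<tau> \<circ> inv_into UNIV \<tau> = id"
    using A permutes_inv_o(1) by (auto simp only: over_def Sym_def mem_Collect_eq)
  then show Z: "over ?Z id" using over_mult[OF A over_inv[OF B]] by simp
  obtain e where e: "form b c = 2 * e" using bc two_dvd_iff_par by blast
  \<comment> \<open>With \<open>x\<close> written as the value at \<open>y\<close> of one product,
    applying the commutator to \<open>x\<close> amounts to applying the other product to
    \<open>y\<close>.\<close>
  define y where "y = ap (inv\<^bsub>SpQ 2\<^esub> (reduce 2 ?B)) x"
  let ?w = "scale (- e) (scale (form y c) b + scale (form y b) c)"
  have AB: "?A y = ?B y + scale 2 ?w"
  proof -
    have "form c b = - (2 * e)" using form_swap[of c b] e by simp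
    then show ?thesis
      by (simp add: transvection_def form_simps e algebra_simps)
  qed
  have xB: "res 2 x = res 2 (?B y)"
    using ap_inv(2)[OF over_SpQ[OF B], of x] ap_reduce[OF SpV(2), of y] unfolding y_def by simp
  have "res 2 (ap ?Z x) = res 2 (ap (reduce 2 ?A) y)"
    unfolding y_def by (rule ap_mult) (simp_all add: over_SpQ[OF A] over_SpQ[OF B])
  also have "\<dots> = res 2 (?A y)" by (rule ap_reduce[OF SpV(1)])
  also have "\<dots> = res 2 (?B y + scale 2 ?w)" by (simp only: AB)
  also have "\<dots> = res 2 (x + scale 2 ?w)" by (intro res_add_cong xB[symmetric] refl)
  finally have "lam ?Z x = par (form ?w x)" unfolding lam_def by (rule kform_eqI[OF Z])
  also have "\<dots> = par (form ?w (?B y))"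
    using res_1_if_res_2[OF xB] by (simp add: par_form flip: crd_eq_iff)
  also have "\<dots> = 0"
    using par_form_commute[of b y] par_form_commute[of c y] bc par_form_commute[of c b]
    by (simp add: transvection_def form_simps form_alternating algebra_simps)
      (simp add: par_mult par_add par_diff ac_simps)
  finally show "lam ?Z x = 0" .
qed

lemma lifting_subgroups_iff:
  "H \<in> lifting_subgroups \<longleftrightarrow> subgroup H (SpQ 2) \<and> (\<forall>h\<in>H. \<exists>\<sigma>. over h \<sigma>) \<and>
    (\<forall>\<sigma>\<in>Sym d. \<exists>h\<in>H. over h \<sigma>) \<and> H \<inter> {k. over k id} = N"
proof -
  have "reduce_quot 2 1 ` H = Sym_image \<longleftrightarrow> (\<forall>\<sigma>\<in>Sym d. \<exists>h\<in>H. over h \<sigma>)"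
    if H: "H \<subseteq> Sym_preimage"
  proof -
    have c: "h \<in> carrier (SpQ 2)" if "h \<in> H" for h using that H by (auto simp: Sym_preimage_def)
    have "reduce_quot 2 1 ` H \<subseteq> Sym_image" using H by (auto simp: Sym_preimage_def)
    moreover have "Sym_image \<subseteq> reduce_quot 2 1 ` H \<longleftrightarrow> (\<forall>\<sigma>\<in>Sym d. \<exists>h\<in>H. over h \<sigma>)"
      unfolding Sym_image_def using over_iff_reduce_quot[OF c]
      by (auto simp: image_subset_iff image_iff) metis+
    ultimately show ?thesis by blast
  qed
  then show ?thesis
    unfolding lifting_subgroups_def carrier_Gamma24 by (auto simp: Sym_preimage_eq)
qed

end

context symmetric_lifts
begin

interpretation P: group "SpQ 2" by (rule group_SpQ)
interpretation M: comm_group M by (rule comm_group_M)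

section \<open>The chosen lifts modulo 4 and their failure to be multiplicative\<close>

definition L :: "(nat \<Rightarrow> nat) \<Rightarrow> 'v set \<Rightarrow> 'v set" where
  "L \<sigma> = reduce 2 (lift \<sigma>)"

lemma over_L: "\<sigma> \<in> Sym d \<Longrightarrow> over (L \<sigma>) \<sigma>"
  by (simp add: L_def over_reduce_iff lift_in lift_reduce)

lemma L_id: "L id = \<one>\<^bsub>SpQ 2\<^esub>"
  by (simp only: L_def lift_id reduce_id)

lemma L_transpose: "i \<in> {1..d} \<Longrightarrow> j \<in> {1..d} \<Longrightarrow> i \<noteq> j \<Longrightarrow> L (transpose i j) = reduce 2 (transvection (a i j))"
  by (simp add: L_def lift_transpose)

definition E :: "(nat \<Rightarrow> nat) \<Rightarrow> (nat \<Rightarrow> nat) \<Rightarrow> 'v set \<Rightarrow> 'v set" where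
  "E \<sigma> \<tau> = L \<sigma> \<star> L \<tau> \<star> inv\<^bsub>SpQ 2\<^esub> L (\<sigma> \<circ> \<tau>)"

lemma E_eq:
  assumes "\<sigma> \<in> Sym d" "\<tau> \<in> Sym d"
  shows "reduce 2 (lift \<sigma> \<otimes>\<^bsub>SpV\<^esub> lift \<tau> \<otimes>\<^bsub>SpV\<^esub> inv\<^bsub>SpV\<^esub> lift (\<sigma> \<circ> \<tau>)) = E \<sigma> \<tau>"
proof -
  interpret R: group_hom SpV "SpQ 2" "reduce 2" by (rule group_hom_reduce)
  show ?thesis
    using assms lift_in Sym_comp by (simp add: E_def L_def)
qed

lemma over_E:
  assumes "\<sigma> \<in> Sym d" "\<tau> \<in> Sym d"
  shows "over (E \<sigma> \<tau>) id"
proof -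
  have "over (E \<sigma> \<tau>) (\<sigma> \<circ> \<tau> \<circ> inv_into UNIV (\<sigma> \<circ> \<tau>))"
    unfolding E_def by (intro over_mult over_inv over_L Sym_comp assms)
  moreover have "(\<sigma> \<circ> \<tau>) permutes {1..d}" using Sym_comp[OF assms] by (simp add: Sym_def)
  then have "\<sigma> \<circ> \<tau> \<circ> inv_into UNIV (\<sigma> \<circ> \<tau>) = id" by (rule permutes_inv_o(1))
  ultimately show ?thesis by simp
qed

lemma quasi_cocycle_iff:
  "quasi_cocycle \<phi> \<longleftrightarrow> \<phi> \<in> Sym d \<rightarrow>\<^sub>E carrier M \<and>
    (\<forall>\<sigma>\<in>Sym d. \<forall>\<tau>\<in>Sym d. \<phi> (\<sigma> \<circ> \<tau>) = \<phi> \<sigma> \<otimes>\<^bsub>M\<^esub> act_M \<sigma> (\<phi> \<tau>) \<otimes>\<^bsub>M\<^esub> proj_M (E \<sigma> \<tau>))"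
  unfolding quasi_cocycle_def by (simp add: E_eq)

lemma quasi_cocycle_closed: "quasi_cocycle \<phi> \<Longrightarrow> \<sigma> \<in> Sym d \<Longrightarrow> \<phi> \<sigma> \<in> carrier M"
  by (auto simp: quasi_cocycle_iff)

lemma quasi_cocycle_mult:
  assumes "quasi_cocycle \<phi>" "\<sigma> \<in> Sym d" "\<tau> \<in> Sym d"
  shows "\<phi> (\<sigma> \<circ> \<tau>) = \<phi> \<sigma> \<otimes>\<^bsub>M\<^esub> act_M \<sigma> (\<phi> \<tau>) \<otimes>\<^bsub>M\<^esub> proj_M (E \<sigma> \<tau>)"
  using assms by (simp add: quasi_cocycle_iff)

lemma mu_quasi_cocycle:
  assumes "quasi_cocycle \<phi>" "\<sigma> \<in> Sym d" "\<tau> \<in> Sym d"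
  shows "mu (\<phi> (\<sigma> \<circ> \<tau>)) x = mu (\<phi> \<sigma>) x + mu (\<phi> \<tau>) (ap (inv\<^bsub>SpQ 2\<^esub> L \<sigma>) x) + lam (E \<sigma> \<tau>) x"
proof -
  have c: "\<phi> \<sigma> \<in> carrier M" "\<phi> \<tau> \<in> carrier M" "act_M \<sigma> (\<phi> \<tau>) \<in> carrier M" "proj_M (E \<sigma> \<tau>) \<in> carrier M"
    using assms quasi_cocycle_closed act_M_closed[OF over_L] over_E by auto
  then show ?thesis
    unfolding quasi_cocycle_mult[OF assms]
    by (simp add: mu_mult mu_act_M[OF over_L] assms mu_proj over_E)
qed

lemma mu_quasi_cocycle_id:
  assumes "quasi_cocycle \<phi>"
  shows "mu (\<phi> id) x = 0"
proof -
  have c: "linear_mod_2 (mu (\<phi> id))"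
    by (rule linear_mod_2_mu[OF quasi_cocycle_closed[OF assms Sym_id]])
  have "mu (\<phi> id) (ap \<one>\<^bsub>SpQ 2\<^esub> x) = mu (\<phi> id) x"
    by (rule linear_mod_2_cong[OF c over_id_crd[OF over_one]])
  then show ?thesis
    using mu_quasi_cocycle[OF assms Sym_id Sym_id, of x] by (simp add: L_id E_def lam_one)
qed

lemma E_transpose_self:
  assumes "i \<in> {1..d}" "j \<in> {1..d}" "i \<noteq> j"
  shows "E (transpose i j) (transpose i j) = sq (a i j)"
  by (simp add: E_def L_transpose[OF assms] L_id sq_def reduce_mult transvection_SpV reduce_SpQ)

text \<open>Modulo 2 every element over the transposition \<open>(i j)\<close> acts as the
  transvection along \<open>a i j\<close>.\<close>

lemma linear_mod_2_L_transpose: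
  assumes "linear_mod_2 u" "i \<in> {1..d}" "j \<in> {1..d}" "i \<noteq> j" "over h (transpose i j)"
  shows "u (ap h x) = u x + par (form x (a i j)) * u (a i j)"
proof -
  have "crd (ap h x) = crd (ap (L (transpose i j)) x)"
    by (rule crd_ap_over[OF assms(5) over_L[OF Sym_transpose[OF assms(2,3)]]])
  also have "\<dots> = crd (transvection (a i j) x)"
    unfolding L_transpose[OF assms(2-4)]
    using res_1_if_res_2[OF ap_reduce[OF transvection_SpV]] by (simp add: crd_eq_iff)
  finally have "u (ap h x) = u (transvection (a i j) x)" by (rule linear_mod_2_cong[OF assms(1)])
  then show ?thesis
    by (simp add: transvection_def linear_mod_2_add[OF assms(1)] linear_mod_2_scale[OF assms(1)])
qed

lemma over_inv_transpose: "over h (transpose i j) \<Longrightarrow> over (inv\<^bsub>SpQ 2\<^esub> h) (transpose i j)"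
  using over_inv[of h "transpose i j"] by simp

lemma mu_transpose_a:
  assumes \<phi>: "quasi_cocycle \<phi>" and ij: "i \<in> {1..d}" "j \<in> {1..d}" "i \<noteq> j"
  shows "mu (\<phi> (transpose i j)) (a i j) = 1"
proof -
  let ?s = "transpose i j" and ?b = "a i j"
  let ?u = "mu (\<phi> ?s)"
  note s = Sym_transpose[OF ij(1,2)]
  have u: "linear_mod_2 ?u" by (rule linear_mod_2_mu[OF quasi_cocycle_closed[OF \<phi> s]])
  \<comment> \<open>A third index gives a vector \<open>a i k\<close> that pairs to 1 with
    \<open>a i j\<close>; at this vector the relation \<open>(i j)^2 = 1\<close> exposes the value
    at \<open>a i j\<close>.\<close>
  have "card {i, j} < card {1..d}" using ij d_ge_3 by simp
  then obtain k where "k \<in> {1..d}" "k \<notin> {i, j}" by (metis card_mono finite.emptyI finite_insert linorder_not_less subsetI)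
  then have x: "par (form (a i k) ?b) = 1" using ij by (subst par_form_a_a) auto
  have "0 = mu (\<phi> (?s \<circ> ?s)) (a i k)" by (simp add: mu_quasi_cocycle_id[OF \<phi>])
  also have "\<dots> = ?u (a i k) + ?u (ap (inv\<^bsub>SpQ 2\<^esub> L ?s) (a i k)) + lam (sq ?b) (a i k)"
    unfolding mu_quasi_cocycle[OF \<phi> s s] E_transpose_self[OF ij] ..
  also have "?u (ap (inv\<^bsub>SpQ 2\<^esub> L ?s) (a i k)) = ?u (a i k) + par (form (a i k) ?b) * ?u ?b"
    by (rule linear_mod_2_L_transpose[OF u ij over_inv_transpose[OF over_L[OF s]]])
  finally show ?thesis by (simp add: lam_sq x bit_add_eq_0_iff)
qed

lemma mu_transpose_disjoint:
  assumes \<phi>: "quasi_cocycle \<phi>" and ij: "i \<in> {1..d}" "j \<in> {1..d}" "i \<noteq> j"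
    and kl: "k \<in> {1..d}" "l \<in> {1..d}" "k \<noteq> l" and dis: "{i, j} \<inter> {k, l} = {}"
  shows "mu (\<phi> (transpose i j)) (a k l) = 0"
proof -
  let ?s = "transpose i j" and ?t = "transpose k l" and ?b = "a i j" and ?c = "a k l"
  note s = Sym_transpose[OF ij(1,2)] and t = Sym_transpose[OF kl(1,2)]
  have us: "linear_mod_2 (mu (\<phi> ?s))" by (rule linear_mod_2_mu[OF quasi_cocycle_closed[OF \<phi> s]])
  have ut: "linear_mod_2 (mu (\<phi> ?t))" by (rule linear_mod_2_mu[OF quasi_cocycle_closed[OF \<phi> t]])
  have st: "?s \<circ> ?t = ?t \<circ> ?s" using dis by (auto simp: fun_eq_iff transpose_def)
  \<comment> \<open>A fifth index is required. Four distinct indices are present already, so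
    \<open>d\<close> is at least 4, and \<open>d \<noteq> 4\<close> provides another one.\<close>
  have "card {i, j, k, l} = 4" using ij kl dis by auto
  moreover have "card {i, j, k, l} \<le> card {1..d}" using ij kl by (intro card_mono) auto
  ultimately have "card {i, j, k, l} < card {1..d}" using d_neq_4 by simp
  then obtain m where m: "m \<in> {1..d}" "m \<notin> {i, j, k, l}"
    by (metis card_mono finite.emptyI finite_insert linorder_not_less subsetI)
  \<comment> \<open>This vector pairs to 0 with \<open>a i j\<close> and to 1 with
    \<open>a k l\<close>. In the two expansions of the commuting product everything then cancels
    except the value at \<open>a k l\<close>.\<close>
  let ?x = "a k m"
  have x: "par (form ?x ?b) = 0" "par (form ?x ?c) = 1"
    using ij kl m dis by (subst par_form_a_a; auto)+
  have bc: "par (form ?b ?c) = 0" using ij kl dis by (subst par_form_a_a) auto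
  have A: "reduce 2 (transvection ?b \<circ> transvection ?c) = L ?s \<star> L ?t"
    and B: "reduce 2 (transvection ?c \<circ> transvection ?b) = L ?t \<star> L ?s"
    by (simp_all add: L_transpose[OF ij] L_transpose[OF kl] reduce_mult transvection_SpV)
  note oA = over_mult[OF over_L[OF s] over_L[OF t]] and oB = over_mult[OF over_L[OF t] over_L[OF s]]
  let ?Z = "L ?s \<star> L ?t \<star> inv\<^bsub>SpQ 2\<^esub> (L ?t \<star> L ?s)"
  have Z: "over ?Z id" "lam ?Z y = 0" for y
    using lam_transvection_commutator[OF bc, of "?s \<circ> ?t"] oA oB st unfolding A B by simp_all
  \<comment> \<open>As the permutations commute, the same lift of their product occurs in both
    defects. They differ by the commutator of the two transvections, which is invisible in
    \<open>M\<close>.\<close>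
  have "E ?s ?t = ?Z \<star> E ?t ?s"
  proof -
    have c: "L ?s \<in> carrier (SpQ 2)" "L ?t \<in> carrier (SpQ 2)" "L (?t \<circ> ?s) \<in> carrier (SpQ 2)"
      using over_SpQ over_L s t Sym_comp by blast+
    have "?Z \<star> E ?t ?s = L ?s \<star> L ?t \<star>
        (inv\<^bsub>SpQ 2\<^esub> (L ?t \<star> L ?s) \<star> (L ?t \<star> L ?s)) \<star> inv\<^bsub>SpQ 2\<^esub> L (?t \<circ> ?s)"
      unfolding E_def using c by (simp only: P.m_assoc P.m_closed P.inv_closed)
    then show ?thesis unfolding E_def st using c by simp
  qed
  then have E: "lam (E ?s ?t) ?x = lam (E ?t ?s) ?x" using Z by (simp add: lam_mult over_E s t)
  have "mu (\<phi> (?s \<circ> ?t)) ?x = mu (\<phi> ?s) ?x + mu (\<phi> ?t) (ap (inv\<^bsub>SpQ 2\<^esub> L ?s) ?x) + lam (E ?s ?t) ?x"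
    by (rule mu_quasi_cocycle[OF \<phi> s t])
  also have "mu (\<phi> ?t) (ap (inv\<^bsub>SpQ 2\<^esub> L ?s) ?x) = mu (\<phi> ?t) ?x"
    by (subst linear_mod_2_L_transpose[OF ut ij over_inv_transpose[OF over_L[OF s]]]) (simp add: x)
  finally have 1: "mu (\<phi> (?s \<circ> ?t)) ?x = mu (\<phi> ?s) ?x + mu (\<phi> ?t) ?x + lam (E ?s ?t) ?x" .
  have "mu (\<phi> (?t \<circ> ?s)) ?x = mu (\<phi> ?t) ?x + mu (\<phi> ?s) (ap (inv\<^bsub>SpQ 2\<^esub> L ?t) ?x) + lam (E ?t ?s) ?x"
    by (rule mu_quasi_cocycle[OF \<phi> t s])
  also have "mu (\<phi> ?s) (ap (inv\<^bsub>SpQ 2\<^esub> L ?t) ?x) = mu (\<phi> ?s) ?x + mu (\<phi> ?s) ?c"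
    by (subst linear_mod_2_L_transpose[OF us kl over_inv_transpose[OF over_L[OF t]]]) (simp add: x)
  finally have 2: "mu (\<phi> (?t \<circ> ?s)) ?x = mu (\<phi> ?t) ?x + (mu (\<phi> ?s) ?x + mu (\<phi> ?s) ?c) + lam (E ?t ?s) ?x" .
  show ?thesis using 1 2 unfolding st E
    by (cases "mu (\<phi> ?s) ?x"; cases "mu (\<phi> ?t) ?x"; cases "mu (\<phi> ?s) ?c"; cases "lam (E ?t ?s) ?x") simp_all
qed

end

section \<open>A quadratic refinement and the splitting for odd degree\<close>

lemma even_symmetric_sum:
  fixes s :: "nat \<Rightarrow> nat \<Rightarrow> 'a :: comm_ring_1"
  assumes "finite A" "\<And>i j. s i j = s j i" "\<And>i. s i i = 0"
  shows "2 dvd (\<Sum>i\<in>A. \<Sum>j\<in>A. s i j)"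
proof -
  let ?T = "\<Sum>i\<in>A. \<Sum>j\<in>A. if i < j then s i j else 0"
  have "(\<Sum>i\<in>A. \<Sum>j\<in>A. s i j) = ?T + (\<Sum>i\<in>A. \<Sum>j\<in>A. if j < i then s i j else 0)"
    unfolding sum.distrib[symmetric] by (intro sum.cong refl) (use assms(3) in \<open>auto simp: not_less_iff_gr_or_eq\<close>)
  also have "(\<Sum>i\<in>A. \<Sum>j\<in>A. if j < i then s i j else 0) = ?T"
    by (subst sum.swap) (intro sum.cong refl, metis assms(2))
  finally show ?thesis by (simp flip: mult_2)
qed

text \<open>The value type is left open because inversions are summed both over the 2-adic integers,
  where the sum matters modulo 4, and over the field with two elements.\<close>

definition inversion :: "(nat \<Rightarrow> nat) \<Rightarrow> nat \<Rightarrow> nat \<Rightarrow> 'a :: zero_neq_one" where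
  "inversion \<sigma> i j = of_bool (i \<noteq> j \<and> (i < j) \<noteq> (\<sigma> i < \<sigma> j))"

text \<open>The set-theoretic section of reduction modulo 2 with values 0 and 1. It is
  multiplicative but not additive, and the correction in \<open>bit_lift_add\<close> has to be shown
  harmless modulo 4.\<close>

definition bit_lift :: "bit \<Rightarrow> two_adic" where
  "bit_lift b = of_bool (b = 1)"

lemma par_bit_lift [simp]: "par (bit_lift b) = b"
  by (cases b) (simp_all add: bit_lift_def)

lemma bit_lift_0 [simp]: "bit_lift 0 = 0"
  by (simp add: bit_lift_def)

lemma bit_lift_add: "bit_lift (b + c) = bit_lift b + bit_lift c - 2 * (bit_lift b * bit_lift c)"
  by (cases b; cases c) (simp_all add: bit_lift_def)

lemma par_inversion: "par (inversion \<sigma> i j) = inversion \<sigma> i j"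
  by (simp add: inversion_def)

context symmetric_reduction
begin

text \<open>
  The sum runs over ordered pairs and is therefore twice the number of inversions. Only its class modulo
  \<open>4\<close> matters.
\<close>

definition kappa :: "(nat \<Rightarrow> nat) \<Rightarrow> (nat \<Rightarrow> bit) \<Rightarrow> two_adic" where
  "kappa \<sigma> w = (\<Sum>i\<in>idx. \<Sum>j\<in>idx. inversion \<sigma> i j * (bit_lift (w i) * bit_lift (w j)))"

lemma kappa_id: "kappa id w = 0"
  by (simp add: kappa_def inversion_def)

lemma kappa_0: "kappa \<sigma> (\<lambda>_. 0) = 0"
  by (simp add: kappa_def)

lemma inversion_commute:
  assumes "inj \<sigma>"
  shows "inversion \<sigma> i j = inversion \<sigma> j i"
proof (cases "i = j")
  case False
  then have "\<sigma> i \<noteq> \<sigma> j" using assms by (auto dest: injD)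
  then show ?thesis using False unfolding inversion_def by (intro arg_cong[where f = of_bool]) linarith
qed simp

lemma four_dvd_2_mult_sum:
  assumes "inj \<sigma>" "\<And>i j. s i j = (s j i :: two_adic)"
  shows "4 dvd 2 * (\<Sum>i\<in>idx. \<Sum>j\<in>idx. inversion \<sigma> i j * s i j)"
proof -
  have "2 dvd (\<Sum>i\<in>idx. \<Sum>j\<in>idx. inversion \<sigma> i j * s i j)"
    by (rule even_symmetric_sum) (simp_all add: inversion_commute[OF assms(1)] assms(2), simp add: inversion_def)
  then obtain t where "(\<Sum>i\<in>idx. \<Sum>j\<in>idx. inversion \<sigma> i j * s i j) = 2 * t" ..
  then show ?thesis by simp
qed

text \<open>Modulo 2, the inversions on a symmetric difference I + J are those on I, those on J, and
  the inverted pairs between I and J. Counting ordered pairs doubles this to a congruence modulo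
  4.\<close>

lemma kappa_add:
  assumes "inj \<sigma>"
  shows "4 dvd kappa \<sigma> (\<lambda>i. w i + w' i) - kappa \<sigma> w - kappa \<sigma> w'
    - 2 * (\<Sum>i\<in>idx. \<Sum>j\<in>idx. inversion \<sigma> i j * (bit_lift (w i) * bit_lift (w' j)))"
proof -
  let ?S = "\<lambda>s. \<Sum>i\<in>idx. \<Sum>j\<in>idx. inversion \<sigma> i j * (s i j :: two_adic)"
  let ?X = "\<lambda>i. bit_lift (w i)" and ?Y = "\<lambda>i. bit_lift (w' i)"
  \<comment> \<open>Collects the terms with coefficient -2 that come from the correction in
    \<open>bit_lift_add\<close>. It is symmetric in \<open>i\<close> and \<open>j\<close>, so its
    sum over inversions is even and twice that sum is divisible by 4.\<close>
  let ?m = "\<lambda>i j. ?X i * ?Y i * (?X j + ?Y j) + (?X i + ?Y i) * (?X j * ?Y j)"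
  have S_add: "?S (\<lambda>i j. s i j + t i j) = ?S s + ?S t" for s t :: "nat \<Rightarrow> nat \<Rightarrow> two_adic"
    by (simp add: sum.distrib distrib_left)
  have S_mult: "?S (\<lambda>i j. c * s i j) = c * ?S s" for s :: "nat \<Rightarrow> nat \<Rightarrow> two_adic" and c
    by (simp add: sum_distrib_left mult.left_commute)
  have "bit_lift (w i + w' i) * bit_lift (w j + w' j)
      = ?X i * ?X j + (?Y i * ?Y j + (?X i * ?Y j + (?Y i * ?X j
        + ((-2) * ?m i j + 4 * (?X i * ?Y i * (?X j * ?Y j))))))" for i j
    unfolding bit_lift_add by (simp add: algebra_simps)
  then have "kappa \<sigma> (\<lambda>i. w i + w' i) = kappa \<sigma> w + (kappa \<sigma> w' + (?S (\<lambda>i j. ?X i * ?Y j) + (?S (\<lambda>i j. ?Y i * ?X j)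
        + ((-2) * ?S ?m + 4 * ?S (\<lambda>i j. ?X i * ?Y i * (?X j * ?Y j))))))"
    unfolding kappa_def by (simp only: S_add S_mult)
  moreover have "?S (\<lambda>i j. ?Y i * ?X j) = ?S (\<lambda>i j. ?X i * ?Y j)"
    by (subst sum.swap) (simp add: inversion_commute[OF assms] mult.commute)
  ultimately have "kappa \<sigma> (\<lambda>i. w i + w' i) - kappa \<sigma> w - kappa \<sigma> w' - 2 * ?S (\<lambda>i j. ?X i * ?Y j)
      = 4 * ?S (\<lambda>i j. ?X i * ?Y i * (?X j * ?Y j)) - 2 * ?S ?m" by simp
  moreover have "4 dvd 2 * ?S ?m" by (rule four_dvd_2_mult_sum[OF assms]) (simp add: algebra_simps)
  ultimately show ?thesis by simp
qed

text \<open>The multiplication rule \<open>\<gamma>\<^sub>I \<gamma>\<^sub>J = (-1)\<^bsup>\<beta>(I, J)\<^esup> \<gamma>\<^bsub>I + J\<^esub>\<close> of Clifford monomials.\<close>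

definition beta :: "'v \<Rightarrow> 'v \<Rightarrow> bit" where
  "beta x y = (\<Sum>i\<in>idx. \<Sum>j\<in>idx. of_bool (j < i) * (crd x i * crd y j))"

text \<open>Pairs with \<open>j < i\<close>, with \<open>i < j\<close> and with \<open>i = j\<close>
  together contribute the product of the two coordinate sums, which is 0. In the Clifford algebra:
  monomials of even degree commute up to the parity of the intersection.\<close>

lemma beta_swap: "beta x y = beta y x + par (form x y)"
proof -
  have "(\<Sum>i\<in>idx. \<Sum>j\<in>idx. crd x i * crd y j) = sum (crd x) idx * sum (crd y) idx"
    by (simp add: sum_product)
  then have 0: "(\<Sum>i\<in>idx. \<Sum>j\<in>idx. crd x i * crd y j) = 0" by (simp add: sum_crd)
  have s: "beta y x = (\<Sum>i\<in>idx. \<Sum>j\<in>idx. of_bool (i < j) * (crd x i * crd y j))"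
    unfolding beta_def by (subst sum.swap) (simp add: mult.commute)
  have f: "par (form x y) = (\<Sum>i\<in>idx. \<Sum>j\<in>idx. of_bool (i = j) * (crd x i * crd y j))"
    unfolding par_form by (rule sum.cong) (simp_all add: of_bool_def if_distrib[where f = "\<lambda>t. t * _"] cong: if_cong)
  have "beta x y + beta y x + par (form x y) = (\<Sum>i\<in>idx. \<Sum>j\<in>idx. crd x i * crd y j)"
    unfolding s f unfolding beta_def sum.distrib[symmetric]
    by (intro sum.cong refl) (auto simp: not_less_iff_gr_or_eq)
  then show ?thesis unfolding 0 by (simp add: add.assoc bit_add_eq_0_iff)
qed

text \<open>It suffices to choose values on a basis. For one order of each pair any lift of
  \<open>beta\<close> will do; the relation with \<open>form\<close> then prescribes the other
  order, and its parity is correct by \<open>beta_swap\<close>. On the diagonal the relation is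
  automatic since the form is alternating.\<close>

lemma exists_bilinear_lift:
  "\<exists>b. (\<forall>x x' y. b (x + x') y = b x y + b x' y) \<and> (\<forall>x y y'. b x (y + y') = b x y + b x y') \<and>
    (\<forall>c x y. b (scale c x) y = c * b x y) \<and> (\<forall>c x y. b x (scale c y) = c * b x y) \<and>
    (\<forall>x y. b x y = b y x + form x y) \<and> (\<forall>x y. par (b x y) = beta x y)"
proof -
  obtain B where B: "finite B" "independent B" "span B = UNIV" using free by blast
  obtain e :: "'v \<Rightarrow> nat" where e: "inj_on e B" using finite_imp_inj_to_nat_seg[OF B(1)] by blast
  define n where "n = representation B"
  have n_add: "n (x + y) b = n x b + n y b" for x y b
    using representation_add[OF B(2), of y x] by (simp add: n_def B(3))
  have n_scale: "n (scale c x) b = c * n x b" for c x b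
    using representation_scale[OF B(2), of x c] by (simp add: n_def B(3))
  have n_sum: "x = (\<Sum>b\<in>B. scale (n x b) b)" for x
    using sum_representation_eq[OF B(2) _ B(1), of x] by (simp add: n_def B(3))
  define t where "t b b' = bit_lift (beta b b')" for b b'
  define q where "q b b' = (if e b' \<le> e b then t b b' else t b' b + form b b')" for b b'
  have q_swap: "q b b' = q b' b + form b b'" if "b \<in> B" "b' \<in> B" for b b'
  proof (cases "b = b'")
    case False
    then have "e b \<noteq> e b'" using e that by (auto dest: inj_onD)
    then show ?thesis using form_swap[of b b'] by (auto simp: q_def)
  qed (simp add: form_alternating)
  have q_par: "par (q b b') = beta b b'" for b b'
    using beta_swap[of b b'] by (simp add: q_def t_def par_add)
  define b where "b x y = (\<Sum>u\<in>B. \<Sum>v\<in>B. n x u * (n y v * q u v))" for x y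
  have form_b: "form x y = (\<Sum>u\<in>B. \<Sum>v\<in>B. n x u * (n y v * form u v))" for x y
  proof -
    have l: "form (\<Sum>u\<in>B. f u) z = (\<Sum>u\<in>B. form (f u) z)" "form z (\<Sum>u\<in>B. f u) = (\<Sum>u\<in>B. form z (f u))" for f z
      by (induction B rule: infinite_finite_induct) (simp_all add: form_add_left form_add_right)
    have "form x y = form (\<Sum>u\<in>B. scale (n x u) u) (\<Sum>u\<in>B. scale (n y u) u)"
      using n_sum[of x] n_sum[of y] by simp
    then show ?thesis
      by (simp add: l form_scale_left form_scale_right sum_distrib_left)
        (subst sum.swap, simp add: mult.left_commute)
  qed
  have crd_b: "crd x i = (\<Sum>u\<in>B. par (n x u) * crd u i)" for x i
  proof -
    have "crd x i = crd (\<Sum>u\<in>B. scale (n x u) u) i" using n_sum[of x] by simp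
    also have "\<dots> = (\<Sum>u\<in>B. par (n x u) * crd u i)"
      unfolding crd_sum by (rule sum.cong) (simp_all add: crd_scale)
    finally show ?thesis .
  qed
  have beta_l: "beta x y = (\<Sum>u\<in>B. par (n x u) * beta u y)" for x y
    unfolding beta_def crd_b[of x] sum_distrib_left sum_distrib_right
    by (subst sum.swap[of _ _ B], subst sum.swap[of _ idx B]) (simp add: ac_simps)
  have beta_r: "beta x y = (\<Sum>u\<in>B. par (n y u) * beta x u)" for x y
    unfolding beta_def crd_b[of y] sum_distrib_left sum_distrib_right
    by (subst sum.swap[of _ _ B], subst sum.swap[of _ idx B]) (simp add: ac_simps)
  have b1: "b (x + x') y = b x y + b x' y" for x x' y
    by (simp add: b_def n_add distrib_right sum.distrib)
  have b2: "b x (y + y') = b x y + b x y'" for x y y'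
    by (simp add: b_def n_add distrib_left distrib_right sum.distrib)
  have b3: "b (scale c x) y = c * b x y" for c x y
    by (simp add: b_def n_scale sum_distrib_left ac_simps)
  have b4: "b x (scale c y) = c * b x y" for c x y
    by (simp add: b_def n_scale sum_distrib_left ac_simps)
  have b5: "b x y = b y x + form x y" for x y
  proof -
    have "b y x = (\<Sum>u\<in>B. \<Sum>v\<in>B. n x u * (n y v * q v u))"
      unfolding b_def by (subst sum.swap) (simp add: ac_simps)
    then have "b y x + form x y = (\<Sum>u\<in>B. \<Sum>v\<in>B. n x u * (n y v * (q v u + form u v)))"
      unfolding form_b[of x y] by (simp add: sum.distrib distrib_left)
    also have "\<dots> = b x y" unfolding b_def by (intro sum.cong refl) (simp only: q_swap[symmetric])
    finally show ?thesis ..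
  qed
  have b6: "par (b x y) = beta x y" for x y
  proof -
    have "par (b x y) = (\<Sum>u\<in>B. par (n x u) * (\<Sum>v\<in>B. par (n y v) * beta u v))"
      by (simp add: b_def par_sum par_mult q_par sum_distrib_left)
    also have "\<dots> = (\<Sum>u\<in>B. par (n x u) * beta u y)" by (simp only: beta_r[symmetric])
    also have "\<dots> = beta x y" by (rule beta_l[symmetric])
    finally show ?thesis .
  qed
  show ?thesis by (intro exI[of _ b] conjI allI b1 b2 b3 b4 b5 b6)
qed

definition blift :: "'v \<Rightarrow> 'v \<Rightarrow> two_adic" where
  "blift = (SOME b. (\<forall>x x' y. b (x + x') y = b x y + b x' y) \<and> (\<forall>x y y'. b x (y + y') = b x y + b x y') \<and>
    (\<forall>c x y. b (scale c x) y = c * b x y) \<and> (\<forall>c x y. b x (scale c y) = c * b x y) \<and>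
    (\<forall>x y. b x y = b y x + form x y) \<and> (\<forall>x y. par (b x y) = beta x y))"

lemma blift_add_left: "blift (x + x') y = blift x y + blift x' y"
  and blift_add_right: "blift x (y + y') = blift x y + blift x y'"
  and blift_scale_left: "blift (scale c x) y = c * blift x y"
  and blift_scale_right: "blift x (scale c y) = c * blift x y"
  and blift_swap: "blift x y = blift y x + form x y"
  and par_blift: "par (blift x y) = beta x y"
  using someI_ex[OF exists_bilinear_lift, folded blift_def] by blast+

definition quad :: "'v \<Rightarrow> two_adic" where
  "quad x = blift x x"

lemma quad_add: "quad (x + y) = quad x + quad y + 2 * blift x y - form x y"
  using blift_swap[of x y] by (simp add: quad_def blift_add_left blift_add_right)

lemma quad_scale: "quad (scale c x) = c * (c * quad x)"
  by (simp add: quad_def blift_scale_left blift_scale_right)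

text \<open>Hence an element \<open>1 + 2 X\<close> of the kernel preserves \<open>quad\<close> modulo \<open>4\<close> if and only if it is in \<open>N\<close>.\<close>

lemma quad_add_scale_2: "4 dvd quad (x + scale 2 z) - quad x - 2 * form z x"
proof -
  have "quad (x + scale 2 z) - quad x - 2 * form z x = 4 * (quad z + blift x z)"
    unfolding quad_add quad_scale using form_swap[of x z]
    by (simp add: blift_scale_right form_scale_right algebra_simps)
  then show ?thesis by simp
qed

lemma quad_cong:
  assumes "res 2 x = res 2 y"
  shows "4 dvd quad x - quad y"
proof -
  obtain z where "x = y + scale 4 z" using assms by (auto simp: res_eq_iff algebra_simps)
  then have "x = y + scale 2 (scale 2 z)" by simp
  then have "4 dvd quad x - quad y - 2 * form (scale 2 z) y" using quad_add_scale_2 by blast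
  moreover have "4 dvd 2 * form (scale 2 z) y" by (simp add: form_scale_left)
  ultimately show ?thesis by (metis dvd_add diff_add_cancel)
qed

section \<open>Lifts that change the quadratic form by the inversion count\<close>

definition theta_lift :: "('v set \<Rightarrow> 'v set) \<Rightarrow> (nat \<Rightarrow> nat) \<Rightarrow> bool" where
  "theta_lift k \<sigma> \<longleftrightarrow> over k \<sigma> \<and> (\<forall>x. 4 dvd quad (ap k x) - quad x - kappa \<sigma> (crd x))"

lemma theta_lift_over: "theta_lift k \<sigma> \<Longrightarrow> over k \<sigma>"
  and theta_lift_quad: "theta_lift k \<sigma> \<Longrightarrow> 4 dvd quad (ap k x) - quad x - kappa \<sigma> (crd x)"
  unfolding theta_lift_def by blast+

context
  assumes odd_d: "odd d"
begin

lemma idx_eq_d: "{1..d} = idx"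
  using odd_d by (cases rule: d_cases; simp)

lemma Sym_permutes: "\<sigma> \<in> Sym d \<Longrightarrow> \<sigma> permutes idx"
  by (simp add: Sym_def flip: idx_eq_d)

text \<open>For odd \<open>d\<close> a class has a single representative, so coordinates are simply
  permuted. For even \<open>d\<close> the normalisation at \<open>d\<close> could add the all-ones
  vector afterwards.\<close>

lemma crd_ap_odd: "over k \<sigma> \<Longrightarrow> crd (ap k x) = crd x \<circ> inv_into UNIV \<sigma>"
proof -
  assume k: "over k \<sigma>"
  then have \<sigma>: "\<sigma> \<in> Sym d" and "red (ap k x) = std_rep d \<sigma> (red x)" by (simp_all add: over_def)
  from this(2) have "cls d (crd (ap k x)) = std_rep d \<sigma> (cls d (crd x))" by (simp only: red_crd)
  also have "\<dots> = cls d (crd x \<circ> inv_into UNIV \<sigma>)" by (rule std_rep_cls[OF \<sigma> crd_W0])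
  finally show ?thesis by (simp add: cls_odd odd_d)
qed

text \<open>The inversions of a composite form the symmetric difference of those of \<tau> and those
  of \<sigma> pulled back along \<tau>. The overlap enters twice, and its sum over ordered pairs is
  already even.\<close>

lemma kappa_comp:
  assumes \<sigma>: "\<sigma> \<in> Sym d" and \<tau>: "\<tau> \<in> Sym d"
  shows "4 dvd kappa (\<sigma> \<circ> \<tau>) w - kappa \<sigma> (w \<circ> inv_into UNIV \<tau>) - kappa \<tau> w"
proof -
  note p = Sym_permutes[OF \<tau>]
  have inj: "inj \<sigma>" "inj \<tau>" using \<sigma> \<tau> by (auto simp: Sym_def permutes_inj)
  let ?X = "\<lambda>i. bit_lift (w i)"
  have 1: "kappa \<sigma> (w \<circ> inv_into UNIV \<tau>)
      = (\<Sum>i\<in>idx. \<Sum>j\<in>idx. inversion \<sigma> (\<tau> i) (\<tau> j) * (?X i * ?X j))"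
    unfolding kappa_def
    by (subst sum.permute[OF p], subst sum.permute[OF p]) (simp add: permutes_inverses(2)[OF p])
  have "inversion (\<sigma> \<circ> \<tau>) i j * z = inversion \<sigma> (\<tau> i) (\<tau> j) * z + inversion \<tau> i j * z
      - 2 * (inversion \<tau> i j * (inversion \<sigma> (\<tau> i) (\<tau> j) * z))" for i j and z :: two_adic
    using inj by (auto simp: inversion_def dest: injD)
  then have "kappa (\<sigma> \<circ> \<tau>) w = kappa \<sigma> (w \<circ> inv_into UNIV \<tau>) + kappa \<tau> w
      - 2 * (\<Sum>i\<in>idx. \<Sum>j\<in>idx. inversion \<tau> i j * (inversion \<sigma> (\<tau> i) (\<tau> j) * (?X i * ?X j)))"
    unfolding 1 unfolding kappa_def by (simp add: sum.distrib sum_subtractf sum_distrib_left)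
  moreover have "4 dvd 2 * (\<Sum>i\<in>idx. \<Sum>j\<in>idx. inversion \<tau> i j * (inversion \<sigma> (\<tau> i) (\<tau> j) * (?X i * ?X j)))"
    by (rule four_dvd_2_mult_sum[OF inj(2)])
      (subst inversion_commute[OF inj(1)], simp add: mult.commute)
  ultimately show ?thesis by simp
qed

text \<open>Renaming the indices by \<sigma> leaves the products of coordinates unchanged and
  reverses the order of a pair precisely when the pair is an inversion.\<close>

lemma beta_ap:
  assumes "over k \<sigma>"
  shows "beta (ap k x) (ap k y) = beta x y + (\<Sum>i\<in>idx. \<Sum>j\<in>idx. inversion \<sigma> i j * (crd x i * crd y j))"
proof -
  have \<sigma>: "\<sigma> \<in> Sym d" using assms by (simp add: over_def)
  note p = Sym_permutes[OF \<sigma>]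
  have inj: "inj \<sigma>" using p by (rule permutes_inj)
  have "beta (ap k x) (ap k y) = (\<Sum>i\<in>idx. \<Sum>j\<in>idx. of_bool (\<sigma> j < \<sigma> i) * (crd x i * crd y j))"
    unfolding beta_def crd_ap_odd[OF assms]
    by (subst sum.permute[OF p], subst sum.permute[OF p]) (simp add: permutes_inverses(2)[OF p])
  also have "\<dots> = (\<Sum>i\<in>idx. \<Sum>j\<in>idx. of_bool (j < i) * (crd x i * crd y j) + inversion \<sigma> i j * (crd x i * crd y j))"
  proof (intro sum.cong refl)
    fix i j
    have "(of_bool (\<sigma> j < \<sigma> i) :: bit) = of_bool (j < i) + inversion \<sigma> i j"
      using injD[OF inj, of i j] by (cases i j rule: linorder_cases; cases "\<sigma> i" "\<sigma> j" rule: linorder_cases)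
        (simp_all add: inversion_def)
    then show "of_bool (\<sigma> j < \<sigma> i) * (crd x i * crd y j)
        = of_bool (j < i) * (crd x i * crd y j) + inversion \<sigma> i j * (crd x i * crd y j)"
      by (simp only: distrib_right)
  qed
  finally show ?thesis by (simp add: beta_def sum.distrib)
qed

lemma theta_lift_mult:
  assumes k: "theta_lift k \<sigma>" and l: "theta_lift l \<tau>"
  shows "theta_lift (k \<star> l) (\<sigma> \<circ> \<tau>)"
  unfolding theta_lift_def
proof (intro conjI allI)
  note ok = theta_lift_over[OF k] and ol = theta_lift_over[OF l]
  show "over (k \<star> l) (\<sigma> \<circ> \<tau>)" by (rule over_mult[OF ok ol])
  fix x
  have s: "\<sigma> \<in> Sym d" "\<tau> \<in> Sym d" using ok ol by (auto simp: over_def)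
  have 1: "4 dvd quad (ap (k \<star> l) x) - quad (ap k (ap l x))"
    by (rule quad_cong[OF ap_mult[OF over_SpQ[OF ok] over_SpQ[OF ol]]])
  have 2: "4 dvd quad (ap k (ap l x)) - quad (ap l x) - kappa \<sigma> (crd x \<circ> inv_into UNIV \<tau>)"
    using theta_lift_quad[OF k, of "ap l x"] by (simp only: crd_ap_odd[OF ol])
  have "quad (ap (k \<star> l) x) - quad x - kappa (\<sigma> \<circ> \<tau>) (crd x)
    = (quad (ap (k \<star> l) x) - quad (ap k (ap l x)))
    + (quad (ap k (ap l x)) - quad (ap l x) - kappa \<sigma> (crd x \<circ> inv_into UNIV \<tau>))
    + (quad (ap l x) - quad x - kappa \<tau> (crd x))
    - (kappa (\<sigma> \<circ> \<tau>) (crd x) - kappa \<sigma> (crd x \<circ> inv_into UNIV \<tau>) - kappa \<tau> (crd x))"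
    by simp
  then show "4 dvd quad (ap (k \<star> l) x) - quad x - kappa (\<sigma> \<circ> \<tau>) (crd x)"
    using 1 2 theta_lift_quad[OF l, of x] kappa_comp[OF s, of "crd x"] by (metis dvd_add dvd_diff)
qed

lemma theta_lift_one: "theta_lift \<one>\<^bsub>SpQ 2\<^esub> id"
  using quad_cong[OF ap_one] by (simp add: theta_lift_def over_one kappa_id)

lemma theta_lift_inv:
  assumes k: "theta_lift k \<sigma>"
  shows "theta_lift (inv\<^bsub>SpQ 2\<^esub> k) (inv_into UNIV \<sigma>)"
  unfolding theta_lift_def
proof (intro conjI allI)
  note ok = theta_lift_over[OF k]
  show "over (inv\<^bsub>SpQ 2\<^esub> k) (inv_into UNIV \<sigma>)" by (rule over_inv[OF ok])
  fix x
  have s: "\<sigma> \<in> Sym d" using ok by (simp add: over_def)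
  define y where "y = ap (inv\<^bsub>SpQ 2\<^esub> k) x"
  have yx: "res 2 (ap k y) = res 2 x" unfolding y_def by (rule ap_inv(2)[OF over_SpQ[OF ok]])
  have c: "crd y \<circ> inv_into UNIV \<sigma> = crd x"
    using crd_ap_odd[OF ok, of y] res_1_if_res_2[OF yx] by (simp add: crd_eq_iff[symmetric])
  have "inv_into UNIV \<sigma> \<circ> \<sigma> = id" using s permutes_inv_o(2) by (auto simp only: Sym_def mem_Collect_eq)
  then have "4 dvd - (kappa (inv_into UNIV \<sigma>) (crd x)) - kappa \<sigma> (crd y)"
    using kappa_comp[OF Sym_inv[OF s] s, of "crd y"] by (simp add: kappa_id c)
  moreover have "quad y - quad x - kappa (inv_into UNIV \<sigma>) (crd x)
    = (quad (ap k y) - quad x) - (quad (ap k y) - quad y - kappa \<sigma> (crd y))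
      + (- (kappa (inv_into UNIV \<sigma>) (crd x)) - kappa \<sigma> (crd y))" by simp
  ultimately show "4 dvd quad y - quad x - kappa (inv_into UNIV \<sigma>) (crd x)"
    using quad_cong[OF yx] theta_lift_quad[OF k, of y] by (metis dvd_add dvd_diff)
qed

lemma over_id_unique:
  assumes "over k id" "over k \<sigma>"
  shows "\<sigma> = id"
proof (rule ccontr)
  assume "\<sigma> \<noteq> id"
  then obtain i where i: "\<sigma> i \<noteq> i" by (auto simp: fun_eq_iff)
  have p: "\<sigma> permutes idx" using assms(2) Sym_permutes by (simp add: over_def)
  then have ii: "i \<in> idx" "\<sigma> i \<in> idx" using i permutes_not_in[OF p] permutes_in_image[OF p] by auto
  \<comment> \<open>A third index \<open>j\<close> gives the vector \<open>a i j\<close>, which has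
    coordinate 1 at \<open>i\<close> and 0 at \<open>\<sigma> i\<close>, so \<sigma> does not fix
    it.\<close>
  have "card {i, \<sigma> i} < card idx" using d_ge_3 by (simp add: i[symmetric] flip: idx_eq_d)
  then obtain j where j: "j \<in> idx" "j \<notin> {i, \<sigma> i}"
    by (metis card_mono finite.emptyI finite_insert linorder_not_less subsetI)
  have "crd (a i j) = crd (a i j) \<circ> inv_into UNIV \<sigma>"
    using over_id_crd[OF assms(1)] crd_ap_odd[OF assms(2)] by metis
  then have "crd (a i j) (\<sigma> i) = crd (a i j) i" by (metis comp_apply permutes_inverses(2)[OF p])
  then show False using ii j i by (simp add: crd_a indicator_vec_def split: if_splits)
qed

lemma theta_lift_id_iff:
  assumes k: "over k id"
  shows "theta_lift k id \<longleftrightarrow> lam k = (\<lambda>_. 0)"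
proof -
  have "4 dvd quad (ap k x) - quad x \<longleftrightarrow> lam k x = 0" for x
  proof -
    have "4 dvd (quad (ap k x) - quad (x + scale 2 (eta k x))) + (quad (x + scale 2 (eta k x)) - quad x - 2 * form (eta k x) x)"
      by (intro dvd_add quad_cong res_eta k quad_add_scale_2)
    then have "4 dvd (quad (ap k x) - quad x) - 2 * form (eta k x) x" by (simp add: algebra_simps)
    then have "4 dvd quad (ap k x) - quad x \<longleftrightarrow> 4 dvd 2 * form (eta k x) x"
      using dvd_add_right_iff[of 4 "quad (ap k x) - quad x - 2 * form (eta k x) x" "2 * form (eta k x) x"] by simp
    then show ?thesis by (simp add: two_adic_4_dvd_2_mult lam_def kform_def)
  qed
  then show ?thesis using k by (simp add: theta_lift_def kappa_id fun_eq_iff)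
qed

text \<open>The defect \<open>r\<close> of an arbitrary lift is additive modulo 4, since
  \<open>beta_ap\<close> and \<open>kappa_add\<close> have the same bilinear term. It is also even,
  hence twice a linear form modulo 4, and composing with the square of a suitable transvection
  cancels it.\<close>

lemma exists_theta_lift:
  assumes f: "f \<in> carrier SpV" and k: "over (reduce 2 f) \<sigma>"
  shows "\<exists>k. theta_lift k \<sigma>"
proof -
  have \<sigma>: "\<sigma> \<in> Sym d" using k by (simp add: over_def)
  have inj: "inj \<sigma>" using \<sigma> by (auto simp: Sym_def permutes_inj)
  define r where "r x = quad (f x) - quad x - kappa \<sigma> (crd x)" for x
  have par_f: "beta (f x) (f y) = beta (ap (reduce 2 f) x) (ap (reduce 2 f) y)" for x y
    unfolding beta_def using res_1_if_res_2[OF ap_reduce[OF f]] by (simp flip: crd_eq_iff)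
  have r_add: "4 dvd r (x + y) - r x - r y" for x y
  proof -
    let ?S = "\<Sum>i\<in>idx. \<Sum>j\<in>idx. inversion \<sigma> i j * (bit_lift (crd x i) * bit_lift (crd y j))"
    let ?K = "kappa \<sigma> (crd (x + y)) - kappa \<sigma> (crd x) - kappa \<sigma> (crd y) - 2 * ?S"
    have "par ?S = (\<Sum>i\<in>idx. \<Sum>j\<in>idx. inversion \<sigma> i j * (crd x i * crd y j))"
      by (simp add: par_sum par_mult par_inversion)
    then have "par (blift (f x) (f y) - blift x y - ?S) = 0"
      using beta_ap[OF k, of x y] by (simp add: par_diff par_blift par_f bit_add_eq_0_iff)
    then have 1: "4 dvd 2 * (blift (f x) (f y) - blift x y - ?S)" by (simp only: two_adic_4_dvd_2_mult)
    have 2: "4 dvd ?K" unfolding crd_add by (rule kappa_add[OF inj])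
    have "r (x + y) - r x - r y = 2 * (blift (f x) (f y) - blift x y - ?S) - ?K"
      unfolding r_def SpV_add[OF f] quad_add SpV_form[OF f] by (simp add: algebra_simps)
    then show ?thesis using dvd_diff[OF 1 2] by simp
  qed
  have r_double: "4 dvd r (scale 2 x)" for x
  proof -
    have "r (scale 2 x) = 4 * (quad (f x) - quad x)"
      unfolding r_def SpV_scale[OF f] quad_scale by (simp add: crd_scale kappa_0 algebra_simps)
    then show ?thesis by simp
  qed
  have r_even: "\<exists>s. r x = 2 * s" for x
  proof -
    \<comment> \<open>Additivity gives \<open>r (2 x) = 2 r x\<close> modulo 4, while
      \<open>r (2 x)\<close> vanishes modulo 4; so \<open>r x\<close> is even.\<close>
    have "4 dvd r (scale 2 x) - (r (x + x) - r x - r x)" using r_double r_add by (rule dvd_diff)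
    then have "4 dvd 2 * r x" by (simp add: scale_2)
    then have "par (r x) = 0" by (simp only: two_adic_4_dvd_2_mult)
    then show ?thesis using two_dvd_iff_par by (auto elim: dvdE)
  qed
  define u where "u x = (if 4 dvd r x then 0 else 1 :: bit)" for x
  have u_eq: "u x = par s" if "r x = 2 * s" for x s
    using that by (simp add: u_def two_adic_4_dvd_2_mult)
  have u_add: "u (x + y) = u x + u y" for x y
  proof -
    obtain s t v where stv: "r x = 2 * s" "r y = 2 * t" "r (x + y) = 2 * v" using r_even by metis
    have "4 dvd 2 * (v - s - t)" using r_add[of x y] stv by (simp add: algebra_simps)
    then have "par (v - s - t) = 0" by (simp only: two_adic_4_dvd_2_mult)
    then have "par v = par s + par t" by (simp only: par_diff add.assoc bit_add_eq_0_iff)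
    then show ?thesis using stv u_eq by metis
  qed
  have "linear_mod_2 u"
    unfolding linear_mod_2_def
  proof (intro conjI allI impI u_add)
    fix x y assume "crd x = crd y"
    then obtain z where "x = y + scale 2 z" by (auto simp: crd_eq_iff res_eq_iff algebra_simps)
    then show "u x = u y" using r_double[of z] by (simp add: u_add) (simp add: u_def)
  qed
  \<comment> \<open>By nondegeneracy the form \<open>u\<close> is the pairing with some
    \<open>b\<close>. The squared transvection moves \<open>x\<close> by 2<x,b>b and thereby changes
    \<open>quad\<close> by 2<x,b>^2 modulo 4, which is the defect \<open>2 u x\<close>.\<close>
  then obtain b where b: "u = lam (sq b)" using exists_sq by blast
  let ?t = "transvection b \<circ> transvection b"
  have t: "?t \<in> carrier SpV" by (rule comp_SpV[OF transvection_SpV transvection_SpV])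
  have ft: "f \<circ> ?t \<in> carrier SpV" by (rule comp_SpV[OF f t])
  have "over (reduce 2 (f \<circ> ?t)) \<sigma>"
    using over_mult[OF k over_sq[of b]] by (simp add: sq_def reduce_mult[OF f t])
  moreover have "4 dvd quad (ap (reduce 2 (f \<circ> ?t)) x) - quad x - kappa \<sigma> (crd x)" for x
  proof -
    define z where "z = scale (form x b) b"
    have c: "crd (x + scale 2 z) = crd x" by (simp add: crd_add crd_scale)
    have 1: "4 dvd quad (ap (reduce 2 (f \<circ> ?t)) x) - quad (f (x + scale 2 z))"
      using quad_cong[OF ap_reduce[OF ft, of x]] transvection_square[of b x] by (simp add: z_def)
    have 2: "4 dvd r (x + scale 2 z) - r x - r (scale 2 z)" by (rule r_add)
    have 3: "4 dvd quad (x + scale 2 z) - quad x - 2 * form z x" by (rule quad_add_scale_2)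
    obtain s where s: "r x = 2 * s" using r_even by blast
    have "par (s + form z x) = 0"
      using u_eq[OF s] b by (simp add: lam_sq z_def par_add par_mult form_scale_left par_form_commute[of b x] bit_mult_self)
    then have 4: "4 dvd 2 * (s + form z x)" by (simp only: two_adic_4_dvd_2_mult)
    have "quad (ap (reduce 2 (f \<circ> ?t)) x) - quad x - kappa \<sigma> (crd x)
      = (quad (ap (reduce 2 (f \<circ> ?t)) x) - quad (f (x + scale 2 z)))
      + (r (x + scale 2 z) - r x - r (scale 2 z)) + r (scale 2 z)
      + (quad (x + scale 2 z) - quad x - 2 * form z x) + 2 * (s + form z x)"
      using s by (simp add: r_def[of "x + scale 2 z"] c algebra_simps)
    then show ?thesis using dvd_add[OF dvd_add[OF dvd_add[OF dvd_add[OF 1 2] r_double[of z]] 3] 4] by (simp only:)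
  qed
  ultimately show ?thesis unfolding theta_lift_def by blast
qed

end

end

section \<open>Lifting subgroups\<close>

lemma sum_odd_even: "(\<Sum>r=1..m. f (2 * r - 1) + f (2 * r)) = (\<Sum>i=1..2 * m. f i)" for f :: "nat \<Rightarrow> 'a :: comm_monoid_add"
  by (induction m) (simp_all add: add.assoc)

context symmetric_lifts
begin

interpretation P: group "SpQ 2" by (rule group_SpQ)
interpretation M: comm_group M by (rule comm_group_M)

section \<open>Nonexistence in even degree\<close>

lemma no_quasi_cocycle_even:
  assumes d: "even d" and \<phi>: "quasi_cocycle \<phi>"
  shows False
proof -
  have d': "d = 2 * (g + 1)" "2 \<le> g" using d by (cases rule: d_cases; simp)+
  let ?b = "\<lambda>r. a (2 * r - 1) (2 * r)"
  let ?S = "\<Sum>r=1..g + 1. ?b r"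
  let ?u = "mu (\<phi> (transpose 1 2))"
  have in_d: "2 * r - 1 \<in> {1..d}" "2 * r \<in> {1..d}" "2 * r - 1 \<noteq> 2 * r" if "r \<in> {1..g + 1}" for r
    using that d' by auto
  have 12: "1 \<in> {1..d}" "2 \<in> {1..d}" "(1::nat) \<noteq> 2" using d' by auto
  have u: "linear_mod_2 ?u" by (rule linear_mod_2_mu[OF quasi_cocycle_closed[OF \<phi> Sym_transpose[OF 12(1,2)]]])
  have "par (form ?S z) = par (form 0 z)" for z
  proof -
    have "par (form z ?S) = (\<Sum>r=1..g + 1. par (form z (?b r)))"
    proof -
      have "form z (sum f A) = (\<Sum>x\<in>A. form z (f x))" for f :: "nat \<Rightarrow> 'v" and A
        by (induction A rule: infinite_finite_induct) (simp_all add: form_add_right)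
      then show ?thesis by (simp only: par_sum)
    qed
    also have "\<dots> = (\<Sum>r=1..g + 1. crd z (2 * r - 1) + crd z (2 * r))"
      by (rule sum.cong[OF refl]) (rule par_form_a_general[OF in_d])
    also have "\<dots> = (\<Sum>i\<in>{1..d}. crd z i)" by (simp only: sum_odd_even d'(1))
    also have "\<dots> = 0" using crd_W0[of z] by (simp add: W0_carrier_iff)
    finally show ?thesis by (simp add: par_form_commute)
  qed
  then have "crd ?S = crd 0" unfolding crd_cong_iff_form by blast
  then have "?u ?S = 0" using linear_mod_2_cong[OF u, of ?S 0] linear_mod_2_0[OF u] by simp
  moreover have "?u ?S = (\<Sum>r=1..g + 1. ?u (?b r))" by (rule linear_mod_2_sum[OF u])
  moreover have "(\<Sum>r=1..g + 1. ?u (?b r)) = ?u (?b 1) + (\<Sum>r\<in>{1..g + 1} - {1}. ?u (?b r))"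
    by (rule sum.remove) simp_all
  moreover have "?u (?b r) = 0" if "r \<in> {1..g + 1} - {1}" for r
  proof -
    have "r \<in> {1..g + 1}" "2 \<le> r" using that by auto
    then show ?thesis by (intro mu_transpose_disjoint[OF \<phi> 12 in_d]) auto
  qed
  then have "(\<Sum>r\<in>{1..g + 1} - {1}. ?u (?b r)) = 0" by (intro sum.neutral) blast
  moreover have "(2::nat) * 1 - 1 = 1" "(2::nat) * 1 = 2" by simp_all
  then have "?u (?b 1) = 1" using mu_transpose_a[OF \<phi> 12] by (simp only:)
  ultimately show False by simp
qed

section \<open>The quasi-cocycle of a lifting subgroup\<close>

definition section_elt :: "('v set \<Rightarrow> 'v set) set \<Rightarrow> (nat \<Rightarrow> nat) \<Rightarrow> 'v set \<Rightarrow> 'v set" where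
  "section_elt H \<sigma> = (SOME h. h \<in> H \<and> over h \<sigma>)"

definition coc :: "('v set \<Rightarrow> 'v set) set \<Rightarrow> (nat \<Rightarrow> nat) \<Rightarrow> ('v set \<Rightarrow> 'v set) set" where
  "coc H = (\<lambda>\<sigma>\<in>Sym d. proj_M (section_elt H \<sigma> \<star> inv\<^bsub>SpQ 2\<^esub> L \<sigma>))"

lemma over_Sym: "over h \<sigma> \<Longrightarrow> \<sigma> \<in> Sym d"
  by (simp add: over_def)

lemma Sym_inv_right: "\<sigma> \<in> Sym d \<Longrightarrow> \<sigma> \<circ> inv_into UNIV \<sigma> = id"
  using permutes_inv_o(1) by (auto simp only: Sym_def mem_Collect_eq)

lemma over_div: "over h \<sigma> \<Longrightarrow> over h' \<sigma> \<Longrightarrow> over (h \<star> inv\<^bsub>SpQ 2\<^esub> h') id"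
  using over_mult[OF _ over_inv, of h \<sigma> h' \<sigma>] Sym_inv_right[OF over_Sym, of h \<sigma>] by simp

lemma section_elt:
  assumes "H \<in> lifting_subgroups" "\<sigma> \<in> Sym d"
  shows "section_elt H \<sigma> \<in> H" "over (section_elt H \<sigma>) \<sigma>"
proof -
  have "\<exists>h. h \<in> H \<and> over h \<sigma>" using assms unfolding lifting_subgroups_iff by blast
  then have "section_elt H \<sigma> \<in> H \<and> over (section_elt H \<sigma>) \<sigma>" unfolding section_elt_def by (rule someI_ex)
  then show "section_elt H \<sigma> \<in> H" "over (section_elt H \<sigma>) \<sigma>" by auto
qed

lemma lifting_subgroup: "H \<in> lifting_subgroups \<Longrightarrow> subgroup H (SpQ 2)"
  and lifting_over: "H \<in> lifting_subgroups \<Longrightarrow> h \<in> H \<Longrightarrow> \<exists>\<sigma>. over h \<sigma>"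
  and lifting_Int: "H \<in> lifting_subgroups \<Longrightarrow> H \<inter> {k. over k id} = N"
  unfolding lifting_subgroups_iff by blast+

text \<open>Independence of the choice: two elements of \<open>H\<close> over the same permutation
  differ by an element of \<open>H\<close> in the kernel, that is, of \<open>N\<close>.\<close>

lemma coc_eq:
  assumes H: "H \<in> lifting_subgroups" and h: "h \<in> H" "over h \<sigma>"
  shows "coc H \<sigma> = proj_M (h \<star> inv\<^bsub>SpQ 2\<^esub> L \<sigma>)"
proof -
  have \<sigma>: "\<sigma> \<in> Sym d" by (rule over_Sym[OF h(2)])
  define r where "r = section_elt H \<sigma>"
  have r: "r \<in> H" "over r \<sigma>" using section_elt[OF H \<sigma>] by (simp_all add: r_def)
  let ?n = "h \<star> inv\<^bsub>SpQ 2\<^esub> r"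
  have n: "over ?n id" by (rule over_div[OF h(2) r(2)])
  moreover have "?n \<in> H"
    using lifting_subgroup[OF H] h r by (intro subgroup.m_closed subgroup.m_inv_closed)
  ultimately have "?n \<in> N" using lifting_Int[OF H] by blast
  then have lam: "lam ?n = (\<lambda>_. 0)" by (simp add: N_eq)
  note c = over_SpQ[OF h(2)] over_SpQ[OF r(2)] over_SpQ[OF over_L[OF \<sigma>]]
  have "?n \<star> (r \<star> inv\<^bsub>SpQ 2\<^esub> L \<sigma>)
      = h \<star> (inv\<^bsub>SpQ 2\<^esub> r \<star> r) \<star> inv\<^bsub>SpQ 2\<^esub> L \<sigma>"
    using c by (simp only: P.m_assoc P.m_closed P.inv_closed)
  also have "\<dots> = h \<star> inv\<^bsub>SpQ 2\<^esub> L \<sigma>" using c by simp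
  finally have eq: "h \<star> inv\<^bsub>SpQ 2\<^esub> L \<sigma> = ?n \<star> (r \<star> inv\<^bsub>SpQ 2\<^esub> L \<sigma>)" ..
  have rL: "over (r \<star> inv\<^bsub>SpQ 2\<^esub> L \<sigma>) id" by (rule over_div[OF r(2) over_L[OF \<sigma>]])
  have "lam (h \<star> inv\<^bsub>SpQ 2\<^esub> L \<sigma>) = lam (r \<star> inv\<^bsub>SpQ 2\<^esub> L \<sigma>)"
    unfolding eq by (rule ext) (simp only: lam_mult[OF n rL] lam add_0)
  then have "proj_M (h \<star> inv\<^bsub>SpQ 2\<^esub> L \<sigma>) = proj_M (r \<star> inv\<^bsub>SpQ 2\<^esub> L \<sigma>)"
    by (subst proj_M_eq_iff[OF over_div[OF h(2) over_L[OF \<sigma>]] rL])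
  then show ?thesis using \<sigma> by (simp add: coc_def r_def)
qed

text \<open>For \<open>h\<close> over \<sigma> and \<open>l\<close> over \<tau> the element
  \<open>h l L(\<sigma> \<tau>)^(-1)\<close> factors as \<open>h L(\<sigma>)^(-1)\<close>, times the
  conjugate of \<open>l L(\<tau>)^(-1)\<close> by \<open>L \<sigma>\<close>, times
  \<open>E \<sigma> \<tau>\<close>.\<close>

lemma quasi_cocycle_coc:
  assumes H: "H \<in> lifting_subgroups"
  shows "quasi_cocycle (coc H)"
  unfolding quasi_cocycle_iff
proof (intro conjI ballI)
  have "coc H \<sigma> \<in> carrier M" if "\<sigma> \<in> Sym d" for \<sigma>
    using that by (simp add: coc_def over_div[OF section_elt(2)[OF H that] over_L])
  then show "coc H \<in> Sym d \<rightarrow>\<^sub>E carrier M" by (simp add: coc_def PiE_iff)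
  fix \<sigma> \<tau> assume s: "\<sigma> \<in> Sym d" and t: "\<tau> \<in> Sym d"
  obtain h where h: "h \<in> H" "over h \<sigma>" using section_elt[OF H s] by blast
  obtain l where l: "l \<in> H" "over l \<tau>" using section_elt[OF H t] by blast
  have hl: "h \<star> l \<in> H" using lifting_subgroup[OF H] h l by (intro subgroup.m_closed)
  let ?h = "h \<star> inv\<^bsub>SpQ 2\<^esub> L \<sigma>" and ?l = "l \<star> inv\<^bsub>SpQ 2\<^esub> L \<tau>"
  let ?l' = "L \<sigma> \<star> ?l \<star> inv\<^bsub>SpQ 2\<^esub> L \<sigma>"
  have oh: "over ?h id" by (rule over_div[OF h(2) over_L[OF s]])
  have ol: "over ?l id" by (rule over_div[OF l(2) over_L[OF t]])
  have ol': "over ?l' id" by (rule over_conj[OF over_L[OF s] ol])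
  have oE: "over (E \<sigma> \<tau>) id" by (rule over_E[OF s t])
  note c = over_SpQ[OF h(2)] over_SpQ[OF l(2)] over_SpQ[OF over_L[OF s]] over_SpQ[OF over_L[OF t]]
    over_SpQ[OF over_L[OF Sym_comp[OF s t]]]
  have can: "inv\<^bsub>SpQ 2\<^esub> x \<star> (x \<star> z) = z"
    if "x \<in> carrier (SpQ 2)" "z \<in> carrier (SpQ 2)" for x z
    using that by (simp flip: P.m_assoc)
  have "?h \<star> ?l' \<star> E \<sigma> \<tau> = h \<star> l \<star> inv\<^bsub>SpQ 2\<^esub> L (\<sigma> \<circ> \<tau>)"
    unfolding E_def using c by (simp add: P.m_assoc can)
  then have "coc H (\<sigma> \<circ> \<tau>) = proj_M (?h \<star> ?l' \<star> E \<sigma> \<tau>)"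
    by (simp only: coc_eq[OF H hl over_mult[OF h(2) l(2)]])
  also have "\<dots> = proj_M ?h \<otimes>\<^bsub>M\<^esub> proj_M ?l' \<otimes>\<^bsub>M\<^esub> proj_M (E \<sigma> \<tau>)"
    by (simp only: mult_M[OF over_id_mult[OF oh ol'] oE] mult_M[OF oh ol'])
  also have "proj_M ?l' = act_M \<sigma> (proj_M ?l)" by (rule act_M_proj[OF over_L[OF s] ol, symmetric])
  finally show "coc H (\<sigma> \<circ> \<tau>) = coc H \<sigma> \<otimes>\<^bsub>M\<^esub> act_M \<sigma> (coc H \<tau>) \<otimes>\<^bsub>M\<^esub> proj_M (E \<sigma> \<tau>)"
    by (simp only: coc_eq[OF H h] coc_eq[OF H l])
qed

text \<open>Equal quasi-cocycles mean that elements of the two subgroups over the same permutation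
  differ by an element of \<open>N\<close>, and both subgroups contain \<open>N\<close>.\<close>

lemma lifting_subgroups_eqI:
  assumes H: "H \<in> lifting_subgroups" and H': "H' \<in> lifting_subgroups" and eq: "coc H = coc H'"
  shows "H = H'"
proof -
  have "H \<subseteq> H'" if H: "H \<in> lifting_subgroups" and H': "H' \<in> lifting_subgroups" and eq: "coc H = coc H'" for H H'
  proof
    fix h assume h: "h \<in> H"
    then obtain \<sigma> where \<sigma>: "over h \<sigma>" using lifting_over[OF H] by blast
    have s: "\<sigma> \<in> Sym d" by (rule over_Sym[OF \<sigma>])
    obtain h' where h': "h' \<in> H'" "over h' \<sigma>" using section_elt[OF H' s] by blast
    let ?n = "h \<star> inv\<^bsub>SpQ 2\<^esub> h'"
    let ?a = "h \<star> inv\<^bsub>SpQ 2\<^esub> L \<sigma>" and ?b = "h' \<star> inv\<^bsub>SpQ 2\<^esub> L \<sigma>"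
    have o: "over ?a id" "over ?b id" by (rule over_div[OF \<sigma> over_L[OF s]], rule over_div[OF h'(2) over_L[OF s]])
    have "proj_M ?a = proj_M ?b" using coc_eq[OF H h \<sigma>] coc_eq[OF H' h'] eq by simp
    then have lam: "lam ?a = lam ?b" using proj_M_eq_iff[OF o] by blast
    note c = over_SpQ[OF \<sigma>] over_SpQ[OF h'(2)] over_SpQ[OF over_L[OF s]]
    have "?n = ?a \<star> inv\<^bsub>SpQ 2\<^esub> ?b"
    proof -
      have "?a \<star> inv\<^bsub>SpQ 2\<^esub> ?b = h \<star> (inv\<^bsub>SpQ 2\<^esub> L \<sigma> \<star> (L \<sigma> \<star> inv\<^bsub>SpQ 2\<^esub> h'))"
        using c by (simp add: P.inv_mult_group P.m_assoc)
      also have "inv\<^bsub>SpQ 2\<^esub> L \<sigma> \<star> (L \<sigma> \<star> inv\<^bsub>SpQ 2\<^esub> h') = inv\<^bsub>SpQ 2\<^esub> h'"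
        using c by (simp flip: P.m_assoc)
      finally show ?thesis ..
    qed
    then have "lam ?n x = 0" for x using lam by (simp add: lam_mult[OF o(1) over_id_inv[OF o(2)]] lam_inv[OF o(2)])
    then have "?n \<in> N" using over_div[OF \<sigma> h'(2)] by (simp add: N_eq fun_eq_iff)
    then have "?n \<in> H'" using lifting_Int[OF H'] by blast
    then have "?n \<star> h' \<in> H'" by (rule subgroup.m_closed[OF lifting_subgroup[OF H'] _ h'(1)])
    then show "h \<in> H'" using c by (simp add: P.m_assoc)
  qed
  then show ?thesis using H H' eq by (metis subset_antisym)
qed

section \<open>Conjugation of lifting subgroups\<close>

lemma conjugate_lifting_subgroups:
  assumes H: "H \<in> lifting_subgroups" and x: "over x \<xi>"
  shows "conjugate x H \<in> lifting_subgroups"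
  unfolding lifting_subgroups_iff
proof (intro conjI ballI)
  note cx = over_SpQ[OF x] and sub = lifting_subgroup[OF H]
  let ?c = "\<lambda>h. x \<star> h \<star> inv\<^bsub>SpQ 2\<^esub> x"
  have conj: "conjugate x H = ?c ` H" by (simp add: conjugate_def)
  have ch: "h \<in> carrier (SpQ 2)" if "h \<in> H" for h using subgroup.mem_carrier[OF sub that] .
  have can: "inv\<^bsub>SpQ 2\<^esub> x \<star> (x \<star> z) = z" "x \<star> (inv\<^bsub>SpQ 2\<^esub> x \<star> z) = z"
    if "z \<in> carrier (SpQ 2)" for z
    using cx that by (simp_all flip: P.m_assoc)
  show "subgroup (conjugate x H) (SpQ 2)"
  proof (rule P.subgroupI)
    show "conjugate x H \<subseteq> carrier (SpQ 2)" unfolding conj using cx ch by auto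
    show "conjugate x H \<noteq> {}" unfolding conj using subgroup.one_closed[OF sub] by blast
  next
    fix u assume "u \<in> conjugate x H"
    then obtain h where h: "h \<in> H" "u = ?c h" unfolding conj by blast
    have "inv\<^bsub>SpQ 2\<^esub> u = ?c (inv\<^bsub>SpQ 2\<^esub> h)" using h cx ch by (simp add: P.inv_mult_group P.m_assoc)
    then show "inv\<^bsub>SpQ 2\<^esub> u \<in> conjugate x H" unfolding conj using subgroup.m_inv_closed[OF sub h(1)] by blast
  next
    fix u v assume "u \<in> conjugate x H" "v \<in> conjugate x H"
    then obtain h l where h: "h \<in> H" "u = ?c h" and l: "l \<in> H" "v = ?c l" unfolding conj by blast
    have "u \<star> v = ?c (h \<star> l)" using h l cx ch by (simp add: P.m_assoc can)
    then show "u \<star> v \<in> conjugate x H" unfolding conj using subgroup.m_closed[OF sub h(1) l(1)] by blast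
  qed
  fix u assume "u \<in> conjugate x H"
  then obtain h where h: "h \<in> H" "u = ?c h" unfolding conj by blast
  then obtain \<sigma> where "over h \<sigma>" using lifting_over[OF H] by blast
  then show "\<exists>\<sigma>. over u \<sigma>" using over_mult[OF over_mult[OF x] over_inv[OF x]] h(2) by blast
next
  let ?c = "\<lambda>h. x \<star> h \<star> inv\<^bsub>SpQ 2\<^esub> x"
  fix \<sigma> assume \<sigma>: "\<sigma> \<in> Sym d"
  have \<xi>: "\<xi> \<in> Sym d" by (rule over_Sym[OF x])
  \<comment> \<open>Conjugation by \<open>x\<close> also conjugates the permutation; starting over
    \<open>?t\<close> makes the result lie over \<sigma>.\<close>
  let ?t = "inv_into UNIV \<xi> \<circ> \<sigma> \<circ> \<xi>"
  obtain h where h: "h \<in> H" "over h ?t"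
    using section_elt[OF H Sym_comp[OF Sym_comp[OF Sym_inv[OF \<xi>] \<sigma>] \<xi>]] by blast
  have "over (?c h) (\<xi> \<circ> ?t \<circ> inv_into UNIV \<xi>)" by (intro over_mult over_inv x h)
  moreover have "\<xi> \<circ> ?t \<circ> inv_into UNIV \<xi> = (\<xi> \<circ> inv_into UNIV \<xi>) \<circ> \<sigma> \<circ> (\<xi> \<circ> inv_into UNIV \<xi>)"
    by (simp only: comp_assoc)
  ultimately have "over (?c h) \<sigma>" by (simp add: Sym_inv_right[OF \<xi>])
  then show "\<exists>u\<in>conjugate x H. over u \<sigma>" using h(1) unfolding conjugate_def by blast
next
  let ?c = "\<lambda>h. x \<star> h \<star> inv\<^bsub>SpQ 2\<^esub> x"
  let ?i = "inv\<^bsub>SpQ 2\<^esub> x"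
  note cx = over_SpQ[OF x]
  have can: "inv\<^bsub>SpQ 2\<^esub> x \<star> (x \<star> z) = z" "x \<star> (inv\<^bsub>SpQ 2\<^esub> x \<star> z) = z"
    if "z \<in> carrier (SpQ 2)" for z
    using cx that by (simp_all flip: P.m_assoc)
  have N_conj: "y \<star> n \<star> inv\<^bsub>SpQ 2\<^esub> y \<in> N" if y: "over y \<sigma>" and n: "n \<in> N" for y \<sigma> n
  proof -
    have n': "over n id" "lam n = (\<lambda>_. 0)" using n by (simp_all add: N_eq)
    let ?m = "y \<star> n \<star> inv\<^bsub>SpQ 2\<^esub> y"
    have m: "over ?m id" by (rule over_conj[OF y n'(1)])
    have "lam ?m z = 0" for z
      using lam_conj[OF y n'(1)] linear_mod_2_ap_ap_inv[OF linear_mod_2_lam[OF m] over_SpQ[OF y], of z] n'(2)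
      by simp
    then show ?thesis using m by (simp add: N_eq fun_eq_iff)
  qed
  show "conjugate x H \<inter> {k. over k id} = N"
  proof (intro equalityI subsetI)
    fix u assume "u \<in> conjugate x H \<inter> {k. over k id}"
    then obtain h where h: "h \<in> H" "u = ?c h" and u: "over u id" by (auto simp: conjugate_def)
    have ch: "h \<in> carrier (SpQ 2)" by (rule subgroup.mem_carrier[OF lifting_subgroup[OF H] h(1)])
    have "h = ?i \<star> u \<star> inv\<^bsub>SpQ 2\<^esub> ?i" using h(2) ch cx by (simp add: P.m_assoc can)
    then have "over h id" using over_conj[OF over_inv[OF x] u] by simp
    then have "h \<in> N" using h(1) lifting_Int[OF H] by blast
    then show "u \<in> N" unfolding h(2) by (rule N_conj[OF x])
  next
    fix n assume n: "n \<in> N"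
    let ?m = "?i \<star> n \<star> inv\<^bsub>SpQ 2\<^esub> ?i"
    have "?m \<in> N" by (rule N_conj[OF over_inv[OF x] n])
    then have "?m \<in> H" using lifting_Int[OF H] by blast
    have on: "over n id" using n by (simp add: N_eq)
    have "n = ?c ?m" using over_SpQ[OF on] cx by (simp add: P.m_assoc can)
    then show "n \<in> conjugate x H \<inter> {k. over k id}" using \<open>?m \<in> H\<close> on unfolding conjugate_def by blast
  qed
qed

text \<open>Conjugation by the kernel adds a coboundary: \<open>k h k^(-1)\<close> is
  \<open>k\<close> times the conjugate of \<open>k^(-1)\<close> by \<open>h\<close>, times
  \<open>h\<close>. The form \<open>lam k\<close> and its translate by the transposition differ by a
  multiple of the pairing with \<open>a i j\<close>.\<close>

lemma mu_coc_conjugate: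
  assumes H: "H \<in> lifting_subgroups" and k: "over k id" and ij: "i \<in> {1..d}" "j \<in> {1..d}" "i \<noteq> j"
  shows "mu (coc (conjugate k H) (transpose i j)) x
    = mu (coc H (transpose i j)) x + lam k (a i j) * par (form x (a i j))"
proof -
  let ?s = "transpose i j"
  have s: "?s \<in> Sym d" by (rule Sym_transpose[OF ij(1,2)])
  obtain h where h: "h \<in> H" "over h ?s" using section_elt[OF H s] by blast
  let ?h = "k \<star> h \<star> inv\<^bsub>SpQ 2\<^esub> k"
  let ?k = "h \<star> inv\<^bsub>SpQ 2\<^esub> k \<star> inv\<^bsub>SpQ 2\<^esub> h"
  let ?b = "h \<star> inv\<^bsub>SpQ 2\<^esub> L ?s"
  have h': "?h \<in> conjugate k H" using h(1) by (auto simp: conjugate_def)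
  have oh': "over ?h ?s" using over_mult[OF over_mult[OF k h(2)] over_inv[OF k]] by simp
  have ok: "over ?k id" by (rule over_conj[OF h(2) over_id_inv[OF k]])
  have ob: "over ?b id" by (rule over_div[OF h(2) over_L[OF s]])
  note c = over_SpQ[OF h(2)] over_SpQ[OF k] over_SpQ[OF over_L[OF s]]
  have "k \<star> ?k \<star> ?b = ?h \<star> (inv\<^bsub>SpQ 2\<^esub> h \<star> h) \<star> inv\<^bsub>SpQ 2\<^esub> L ?s"
    using c by (simp only: P.m_assoc P.m_closed P.inv_closed)
  also have "\<dots> = ?h \<star> inv\<^bsub>SpQ 2\<^esub> L ?s" using c by simp
  finally have "coc (conjugate k H) ?s = proj_M (k \<star> ?k \<star> ?b)"
    using coc_eq[OF conjugate_lifting_subgroups[OF H k] h' oh'] by simp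
  then have 1: "mu (coc (conjugate k H) ?s) x = lam k x + lam ?k x + lam ?b x"
    by (simp only: mu_proj[OF over_id_mult[OF over_id_mult[OF k ok] ob]]
        lam_mult[OF over_id_mult[OF k ok] ob] lam_mult[OF k ok])
  have "lam ?k x = lam ?k (ap h (ap (inv\<^bsub>SpQ 2\<^esub> h) x))"
    by (rule linear_mod_2_ap_ap_inv[OF linear_mod_2_lam[OF ok] over_SpQ[OF h(2)], symmetric])
  also have "\<dots> = lam k (ap (inv\<^bsub>SpQ 2\<^esub> h) x)"
    by (simp only: lam_conj[OF h(2) over_id_inv[OF k]] lam_inv[OF k])
  also have "\<dots> = lam k x + par (form x (a i j)) * lam k (a i j)"
    by (rule linear_mod_2_L_transpose[OF linear_mod_2_lam[OF k] ij over_inv_transpose[OF h(2)]])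
  finally have 2: "lam ?k x = lam k x + par (form x (a i j)) * lam k (a i j)" .
  have "mu (coc H ?s) x = lam ?b x" by (simp only: coc_eq[OF H h] mu_proj[OF ob])
  then show ?thesis unfolding 1 2 by (simp add: ac_simps)
qed

section \<open>Classification in odd degree\<close>

context
  assumes odd_d: "odd d"
begin

lemma idx_eq: "{1..d} = idx" "{2..2 * g + 1} = idx - {1}"
  using idx_eq_d[OF odd_d] by (auto simp: idx_def)

lemma idx_1: "j \<in> idx - {1} \<Longrightarrow> 1 \<in> {1..d} \<and> j \<in> {1..d} \<and> 1 \<noteq> j"
  unfolding idx_eq(1) by (auto simp: idx_def)

lemma quasi_cocycle_with_iff:
  assumes \<phi>: "quasi_cocycle \<phi>"
  shows "quasi_cocycle_with c \<phi> \<longleftrightarrow> (\<forall>j\<in>idx - {1}. \<forall>x.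
    mu (\<phi> (transpose 1 j)) x = c j * par (form x (a 1 j)) + par (form x (dual 1)))"
proof -
  have 1: "1 \<in> idx" by (simp add: idx_def)
  have "\<phi> (transpose 1 j) = (if c j = 1 then v_M {1, j} else \<one>\<^bsub>M\<^esub>) \<otimes>\<^bsub>M\<^esub> v_M (idx - {1}) \<longleftrightarrow>
      (\<forall>x. mu (\<phi> (transpose 1 j)) x = c j * par (form x (a 1 j)) + par (form x (dual 1)))"
    if j: "j \<in> idx - {1}" for j
  proof -
    have ij: "1 \<in> {1..d}" "j \<in> {1..d}" "1 \<noteq> j" using idx_1[OF j] by auto
    let ?m = "if c j = 1 then v_M {1, j} else \<one>\<^bsub>M\<^esub>"
    have m: "?m \<in> carrier M" by (simp add: v_M_pair[OF ij] over_sq)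
    have n: "v_M (idx - {1}) \<in> carrier M" by (simp add: v_M_dual[OF 1] over_sq)
    have "mu (?m \<otimes>\<^bsub>M\<^esub> v_M (idx - {1})) x = c j * par (form x (a 1 j)) + par (form x (dual 1))" for x
      unfolding v_M_dual[OF 1] v_M_pair[OF ij]
      by (cases "c j") (simp_all add: mu_mult mu_proj over_sq lam_sq)
    moreover have "\<phi> (transpose 1 j) = ?m \<otimes>\<^bsub>M\<^esub> v_M (idx - {1}) \<longleftrightarrow>
        mu (\<phi> (transpose 1 j)) = mu (?m \<otimes>\<^bsub>M\<^esub> v_M (idx - {1}))"
      by (rule mu_inj[OF quasi_cocycle_closed[OF \<phi> Sym_transpose[OF ij(1,2)]] M.m_closed[OF m n]])
    ultimately show ?thesis by (simp add: fun_eq_iff)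
  qed
  then show ?thesis unfolding quasi_cocycle_with_def idx_eq(2) using \<phi> by blast
qed

text \<open>The defining equation propagates agreement to products, and the transpositions
  \<open>(1 j)\<close> generate: \<open>(i j) = (1 i)(1 j)(1 i)\<close>.\<close>

lemma quasi_cocycle_with_unique:
  assumes \<phi>: "quasi_cocycle_with c \<phi>" and \<psi>: "quasi_cocycle_with c \<psi>"
  shows "\<phi> = \<psi>"
proof -
  have q: "quasi_cocycle \<phi>" "quasi_cocycle \<psi>" using \<phi> \<psi> by (simp_all add: quasi_cocycle_with_def)
  have mult: "\<phi> (\<sigma> \<circ> \<tau>) = \<psi> (\<sigma> \<circ> \<tau>)"
    if "\<sigma> \<in> Sym d" "\<tau> \<in> Sym d" "\<phi> \<sigma> = \<psi> \<sigma>" "\<phi> \<tau> = \<psi> \<tau>" for \<sigma> \<tau>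
    using quasi_cocycle_mult[OF q(1) that(1,2)] quasi_cocycle_mult[OF q(2) that(1,2)] that by simp
  have 1: "\<phi> (transpose 1 j) = \<psi> (transpose 1 j)" if "j \<in> {1..d} - {1}" for j
    using that \<phi> \<psi> unfolding quasi_cocycle_with_def idx_eq by metis
  have tr: "\<phi> (transpose i j) = \<psi> (transpose i j)" if ij: "i \<in> {1..d}" "j \<in> {1..d}" "i \<noteq> j" for i j
  proof -
    consider "i = 1" | "j = 1" | "i \<noteq> 1" "j \<noteq> 1" by blast
    then show ?thesis
    proof cases
      case 1
      then show ?thesis using \<open>\<And>j. j \<in> {1..d} - {1} \<Longrightarrow> _ j\<close> ij by auto
    next
      case 2
      then show ?thesis using \<open>\<And>j. j \<in> {1..d} - {1} \<Longrightarrow> _ j\<close>[of i] ij by (simp add: transpose_commute)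
    next
      case 3
      have o: "1 \<in> {1..d}" using d_ge_3 by simp
      have eq: "transpose i j = transpose 1 i \<circ> transpose 1 j \<circ> transpose 1 i"
        using transpose_comp_triple[of i j 1] 3 ij by (simp add: transpose_commute)
      have "i \<in> {1..d} - {1}" "j \<in> {1..d} - {1}" using ij 3 by auto
      then show ?thesis
        unfolding eq using ij o by (intro mult Sym_comp Sym_transpose 1)
    qed
  qed
  have on_id: "\<phi> id = \<psi> id"
    unfolding mu_inj[OF quasi_cocycle_closed[OF q(1) Sym_id] quasi_cocycle_closed[OF q(2) Sym_id]]
    by (rule ext) (simp add: mu_quasi_cocycle_id[OF q(1)] mu_quasi_cocycle_id[OF q(2)])
  have "\<phi> \<sigma> = \<psi> \<sigma>" if "\<sigma> \<in> Sym d" for \<sigma>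
  proof -
    have "\<sigma> permutes {1..d}" "finite {1..d}" using that by (simp_all add: Sym_def)
    then show ?thesis
    proof (induction rule: permutes_induct)
      case (swap i j p)
      then show ?case by (intro mult tr Sym_transpose) (auto simp: Sym_def)
    qed (rule on_id)
  qed
  moreover have "\<phi> \<in> extensional (Sym d)" "\<psi> \<in> extensional (Sym d)"
    using q by (auto simp: quasi_cocycle_iff PiE_iff)
  ultimately show ?thesis by (intro extensionalityI)
qed

lemma quasi_cocycle_with_param_unique:
  assumes "quasi_cocycle_with c \<phi>" "quasi_cocycle_with c' \<phi>"
    "c \<in> {2..2 * g + 1} \<rightarrow>\<^sub>E UNIV" "c' \<in> {2..2 * g + 1} \<rightarrow>\<^sub>E UNIV"
  shows "c = c'"
proof (rule extensionalityI)
  show "c \<in> extensional {2..2 * g + 1}" "c' \<in> extensional {2..2 * g + 1}"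
    using assms by (auto simp: PiE_iff)
  fix j assume "j \<in> {2..2 * g + 1}"
  then have j: "j \<in> idx - {1}" unfolding idx_eq .
  have q: "quasi_cocycle \<phi>" using assms(1) by (simp add: quasi_cocycle_with_def)
  have ij: "1 \<in> {1..d}" "j \<in> {1..d}" "1 \<noteq> j" using idx_1[OF j] by auto
  have jj: "j \<in> idx" using j by blast
  \<comment> \<open>The vector \<open>dual j\<close> detects the parameter: its coordinate is 1 at
    the index 1 and 0 at \<open>j\<close>.\<close>
  have "par (form (dual j) (a 1 j)) = 1"
    using ij j by (simp add: par_form_a_general[OF ij] crd_dual[OF jj] indicator_vec_def) (simp add: idx_def)
  then show "c j = c' j"
    using assms(1,2) j unfolding quasi_cocycle_with_iff[OF q] by (metis add_right_cancel mult_1_right)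
qed

text \<open>The linear form \<open>u\<close> at \<open>(1 j)\<close> vanishes on
  \<open>a k l\<close> for \<open>k\<close>, \<open>l\<close> outside \<open>{1, j}\<close>, so it
  is constant on the remaining vectors \<open>a 1 k\<close>. Together with
  \<open>u (a 1 j) = 1\<close> this leaves one free bit.\<close>

lemma exists_quasi_cocycle_with:
  assumes \<phi>: "quasi_cocycle \<phi>"
  shows "\<exists>c\<in>{2..2 * g + 1} \<rightarrow>\<^sub>E UNIV. quasi_cocycle_with c \<phi>"
proof -
  have 1: "1 \<in> idx" by (simp add: idx_def)
  have ex: "\<exists>c. \<forall>x. mu (\<phi> (transpose 1 j)) x = c * par (form x (a 1 j)) + par (form x (dual 1))"
    if j: "j \<in> idx - {1}" for j
  proof -
    have ij: "1 \<in> {1..d}" "j \<in> {1..d}" "1 \<noteq> j" using idx_1[OF j] by auto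
    let ?u = "mu (\<phi> (transpose 1 j))"
    have u: "linear_mod_2 ?u" by (rule linear_mod_2_mu[OF quasi_cocycle_closed[OF \<phi> Sym_transpose[OF ij(1,2)]]])
    have const: "?u (a 1 k) = ?u (a 1 l)" if k: "k \<in> idx - {1, j}" and l: "l \<in> idx - {1, j}" for k l
    proof (cases "k = l")
      case False
      have kl: "k \<in> {1..d}" "l \<in> {1..d}" "k \<noteq> l" using k l False idx_eq by auto
      have "crd (a 1 k + a 1 l) = crd (a k l)"
        using k l False 1 by (auto simp: crd_add crd_a indicator_vec_def fun_eq_iff)
      then have "?u (a 1 k) + ?u (a 1 l) = ?u (a k l)"
        using linear_mod_2_cong[OF u] linear_mod_2_add[OF u] by metis
      also have "\<dots> = 0" by (rule mu_transpose_disjoint[OF \<phi> ij kl]) (use k l in auto)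
      finally show ?thesis by (simp only: bit_add_eq_0_iff)
    qed simp
    \<comment> \<open>The shift by 1 compensates for the pairing with \<open>dual 1\<close>, which
      is 1 on each \<open>a 1 k\<close>.\<close>
    define c where "c = 1 + ?u (a 1 (SOME k. k \<in> idx - {1, j}))"
    have uk: "?u (a 1 k) = c + 1" if k: "k \<in> idx - {1, j}" for k
    proof -
      have "(SOME k. k \<in> idx - {1, j}) \<in> idx - {1, j}" using k by (rule someI)
      then show ?thesis using const[OF k] by (simp add: c_def add.commute[of 1])
    qed
    have "?u = (\<lambda>x. c * par (form x (a 1 j)) + par (form x (dual 1)))"
    proof (rule linear_mod_2_eqI[OF u])
      have "linear_mod_2 (\<lambda>x. c * par (form x (a 1 j)))"
        by (cases c) (simp_all add: linear_mod_2_form, simp add: linear_mod_2_def)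
      then show "linear_mod_2 (\<lambda>x. c * par (form x (a 1 j)) + par (form x (dual 1)))"
        by (rule linear_mod_2_plus[OF _ linear_mod_2_form])
      fix k assume k: "k \<in> idx - {1}"
      have ik: "1 \<in> {1..d}" "k \<in> {1..d}" "1 \<noteq> k" using idx_1[OF k] by auto
      have kk: "k \<in> idx" using k by blast
      have D: "par (form (a 1 k) (dual 1)) = 1"
        using ik(3) by (simp add: par_form_dual[OF 1] crd_a[OF 1 kk ik(3)] indicator_vec_def)
      show "?u (a 1 k) = c * par (form (a 1 k) (a 1 j)) + par (form (a 1 k) (dual 1))"
      proof (cases "k = j")
        case True
        then show ?thesis using mu_transpose_a[OF \<phi> ij] D
          by (simp add: par_form_a_a[OF ij ij] form_alternating)
      next
        case False
        then have "par (form (a 1 k) (a 1 j)) = 1"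
          unfolding par_form_a_a[OF ik ij] using ij by simp
        then show ?thesis using uk k False D by simp
      qed
    qed
    then show ?thesis by metis
  qed
  have "\<exists>c. \<forall>j\<in>idx - {1}. \<forall>x. mu (\<phi> (transpose 1 j)) x = c j * par (form x (a 1 j)) + par (form x (dual 1))"
    by (rule bchoice, rule ballI, rule ex)
  then obtain b where b: "\<forall>j\<in>idx - {1}. \<forall>x.
    mu (\<phi> (transpose 1 j)) x = b j * par (form x (a 1 j)) + par (form x (dual 1))" ..
  let ?c = "restrict b (idx - {1})"
  have "?c j = b j" if "j \<in> idx - {1}" for j by (rule restrict_apply'[OF that])
  then have "quasi_cocycle_with ?c \<phi>" unfolding quasi_cocycle_with_iff[OF \<phi>] using b by metis
  moreover have "?c \<in> {2..2 * g + 1} \<rightarrow>\<^sub>E UNIV" unfolding idx_eq by simp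
  ultimately show ?thesis by blast
qed

lemma exists_lifting_subgroup: "\<exists>H. H \<in> lifting_subgroups"
proof
  let ?H = "{k. \<exists>\<sigma>. theta_lift k \<sigma>}"
  note od = odd_d
  show "?H \<in> lifting_subgroups"
    unfolding lifting_subgroups_iff
  proof (intro conjI ballI)
    show "subgroup ?H (SpQ 2)"
    proof (rule P.subgroupI)
      show "?H \<subseteq> carrier (SpQ 2)" using theta_lift_over over_SpQ by blast
      show "?H \<noteq> {}" using theta_lift_one[OF od] by blast
      show "inv\<^bsub>SpQ 2\<^esub> k \<in> ?H" if "k \<in> ?H" for k using that theta_lift_inv[OF od] by blast
      show "k \<star> l \<in> ?H" if "k \<in> ?H" "l \<in> ?H" for k l
        using that theta_lift_mult[OF od] by blast
    qed
    show "\<exists>\<sigma>. over h \<sigma>" if "h \<in> ?H" for h using that theta_lift_over by blast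
    show "\<exists>h\<in>?H. over h \<sigma>" if \<sigma>: "\<sigma> \<in> Sym d" for \<sigma>
      using exists_theta_lift[OF od lift_in[OF \<sigma>] over_L[OF \<sigma>, unfolded L_def]] theta_lift_over by blast
    show "?H \<inter> {k. over k id} = N"
    proof (intro equalityI subsetI)
      fix k assume "k \<in> ?H \<inter> {k. over k id}"
      then obtain \<sigma> where k: "over k id" "theta_lift k \<sigma>" by blast
      \<comment> \<open>Membership in the subgroup only supplies some permutation; faithfulness of
        the standard representation shows that it is the identity.\<close>
      then have "\<sigma> = id" using over_id_unique[OF od] theta_lift_over by blast
      then show "k \<in> N" using k theta_lift_id_iff[OF od k(1)] by (simp add: N_eq)
    next
      fix k assume "k \<in> N"
      then have k: "over k id" "lam k = (\<lambda>_. 0)" by (simp_all add: N_eq)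
      then show "k \<in> ?H \<inter> {k. over k id}" using theta_lift_id_iff[OF od k(1)] by blast
    qed
  qed
qed

lemma exists_conjugate:
  assumes H: "H \<in> lifting_subgroups"
  shows "\<exists>k. over k id \<and> quasi_cocycle_with c (coc (conjugate k H))"
proof -
  obtain b where b: "quasi_cocycle_with b (coc H)"
    using exists_quasi_cocycle_with[OF quasi_cocycle_coc[OF H]] by blast
  \<comment> \<open>Conjugation by the square of the transvection along \<open>y\<close> adds the
    pairing of \<open>a 1 j\<close> with \<open>y\<close> to the parameter at \<open>j\<close>. The
    required shifts are \<open>b j + c j\<close>, and all of them can be prescribed at once.\<close>
  obtain y where y: "\<forall>j\<in>idx - {1}. par (form (a 1 j) y) = b j + c j"
    using exists_crd_a[of "\<lambda>j. b j + c j"] by blast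
  have "quasi_cocycle_with c (coc (conjugate (sq y) H))"
    unfolding quasi_cocycle_with_iff[OF quasi_cocycle_coc[OF conjugate_lifting_subgroups[OF H over_sq]]]
  proof (intro ballI allI)
    fix j x assume j: "j \<in> idx - {1}"
    then have ij: "1 \<in> {1..d}" "j \<in> {1..d}" "1 \<noteq> j" using idx_1 by auto
    have "mu (coc H (transpose 1 j)) x = b j * par (form x (a 1 j)) + par (form x (dual 1))"
      using b j unfolding quasi_cocycle_with_iff[OF quasi_cocycle_coc[OF H]] by blast
    moreover have "lam (sq y) (a 1 j) = b j + c j" using y j by (simp add: lam_sq)
    ultimately show "mu (coc (conjugate (sq y) H) (transpose 1 j)) x = c j * par (form x (a 1 j)) + par (form x (dual 1))"
      unfolding mu_coc_conjugate[OF H over_sq ij]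
      by (cases "b j"; cases "c j") (simp_all add: ac_simps)
  qed
  then show ?thesis using over_sq by blast
qed

lemma exists_lifting_with:
  "\<exists>H\<in>lifting_subgroups. quasi_cocycle_with c (coc H)"
  using exists_lifting_subgroup exists_conjugate conjugate_lifting_subgroups by blast

text \<open>A lifting subgroup is determined by its quasi-cocycle, the quasi-cocycle by its
  parameter, and every parameter occurs.\<close>

lemma card_lifting_subgroups: "card lifting_subgroups = 2 ^ (2 * g)"
proof -
  let ?C = "{2..2 * g + 1} \<rightarrow>\<^sub>E (UNIV :: bit set)"
  define f where "f c = (SOME H. H \<in> lifting_subgroups \<and> quasi_cocycle_with c (coc H))" for c
  have f: "f c \<in> lifting_subgroups \<and> quasi_cocycle_with c (coc (f c))" for c
    unfolding f_def by (rule someI_ex) (use exists_lifting_with in blast)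
  have "bij_betw f ?C lifting_subgroups"
  proof (rule bij_betwI')
    show "f c = f c' \<longleftrightarrow> c = c'" if "c \<in> ?C" "c' \<in> ?C" for c c'
      using that f quasi_cocycle_with_param_unique by metis
    show "f c \<in> lifting_subgroups" for c using f by blast
    show "\<exists>c\<in>?C. H = f c" if H: "H \<in> lifting_subgroups" for H
    proof -
      obtain c where c: "c \<in> ?C" "quasi_cocycle_with c (coc H)"
        using exists_quasi_cocycle_with[OF quasi_cocycle_coc[OF H]] by blast
      then have "coc H = coc (f c)" using f quasi_cocycle_with_unique by blast
      then have "H = f c" using lifting_subgroups_eqI H f by blast
      then show ?thesis using c(1) by blast
    qed
  qed
  then have "card lifting_subgroups = card ?C" by (metis bij_betw_same_card)
  also have "\<dots> = card (UNIV :: bit set) ^ (2 * g)" by (simp add: card_PiE)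
  also have "(UNIV :: bit set) = {0, 1}" by (auto intro: bit.exhaust)
  finally show ?thesis by (simp add: numeral_2_eq_2)
qed

lemma lifting_subgroups_conjugate:
  assumes H: "H \<in> lifting_subgroups"
  shows "lifting_subgroups = {conjugate x H | x. x \<in> Sym_preimage}"
proof (intro equalityI subsetI)
  fix H' assume H': "H' \<in> lifting_subgroups"
  obtain c where c: "quasi_cocycle_with c (coc H')"
    using exists_quasi_cocycle_with[OF quasi_cocycle_coc[OF H']] by blast
  obtain k where k: "over k id" "quasi_cocycle_with c (coc (conjugate k H))"
    using exists_conjugate[OF H] by blast
  have "H' = conjugate k H"
    using lifting_subgroups_eqI[OF H' conjugate_lifting_subgroups[OF H k(1)]]
      quasi_cocycle_with_unique[OF c k(2)] by blast
  then show "H' \<in> {conjugate x H | x. x \<in> Sym_preimage}" using k(1) by (auto simp: Sym_preimage_eq)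
next
  fix H' assume "H' \<in> {conjugate x H | x. x \<in> Sym_preimage}"
  then show "H' \<in> lifting_subgroups" using conjugate_lifting_subgroups[OF H] by (auto simp: Sym_preimage_eq)
qed

end

end

theorem theorem3p8:
  fixes scale :: "two_adic \<Rightarrow> 'v::ab_group_add \<Rightarrow> 'v"
    and form :: "'v \<Rightarrow> 'v \<Rightarrow> two_adic"
    and d g :: nat
    and red :: "'v \<Rightarrow> (nat \<Rightarrow> bit) set"
    and a :: "nat \<Rightarrow> nat \<Rightarrow> 'v"
    and lift :: "(nat \<Rightarrow> nat) \<Rightarrow> 'v \<Rightarrow> 'v"
  assumes "symmetric_lifts scale form d g red a lift"
  shows "(d = 2 * g + 2 \<and> 2 \<le> g \<longrightarrow>
      (\<nexists>\<phi>. symmetric_lifts.quasi_cocycle scale form d g a lift \<phi>) \<and>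
      (\<nexists>H. H \<in> symmetric_reduction.lifting_subgroups scale form d g red a)) \<and>
    (d = 2 * g + 1 \<longrightarrow>
      (\<forall>c\<in>{2..2 * g + 1} \<rightarrow>\<^sub>E (UNIV :: bit set).
         \<exists>!\<phi>. symmetric_lifts.quasi_cocycle_with scale form d g a lift c \<phi>) \<and>
      (\<forall>\<phi>. symmetric_lifts.quasi_cocycle scale form d g a lift \<phi> \<longrightarrow>
         (\<exists>c\<in>{2..2 * g + 1} \<rightarrow>\<^sub>E (UNIV :: bit set).
            symmetric_lifts.quasi_cocycle_with scale form d g a lift c \<phi>)) \<and>
      card (symmetric_reduction.lifting_subgroups scale form d g red a) = 2 ^ (2 * g) \<and>
      (\<exists>H\<in>symmetric_reduction.lifting_subgroups scale form d g red a.
         symmetric_reduction.lifting_subgroups scale form d g red a =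
           {two_adic_form.conjugate scale form x H | x.
              x \<in> symmetric_reduction.Sym_preimage scale form d red}))"
proof -
  interpret symmetric_lifts scale form d g red a lift by (rule assms)
  show ?thesis
  proof (intro conjI impI)
    assume "d = 2 * g + 2 \<and> 2 \<le> g"
    then have d: "even d" by simp
    show "\<nexists>\<phi>. quasi_cocycle \<phi>" using no_quasi_cocycle_even[OF d] by blast
    show "\<nexists>H. H \<in> lifting_subgroups" using no_quasi_cocycle_even[OF d] quasi_cocycle_coc by blast
  next
    assume "d = 2 * g + 1"
    then have d: "odd d" by simp
    show "\<forall>c\<in>{2..2 * g + 1} \<rightarrow>\<^sub>E UNIV. \<exists>!\<phi>. quasi_cocycle_with c \<phi>"
      using exists_lifting_with[OF d] quasi_cocycle_with_unique[OF d] by blast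
    show "\<forall>\<phi>. quasi_cocycle \<phi> \<longrightarrow> (\<exists>c\<in>{2..2 * g + 1} \<rightarrow>\<^sub>E UNIV. quasi_cocycle_with c \<phi>)"
      using exists_quasi_cocycle_with[OF d] by blast
    show "card lifting_subgroups = 2 ^ (2 * g)" by (rule card_lifting_subgroups[OF d])
    show "\<exists>H\<in>lifting_subgroups. lifting_subgroups = {conjugate x H | x. x \<in> Sym_preimage}"
      using exists_lifting_subgroup[OF d] lifting_subgroups_conjugate[OF d] by blast
  qed
qed

end
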